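(* Let $J$ and $\mathfrak a$ be as in the context. Let $u_0\in L^\infty(\mathbb R^N)$ be nonnegative and such that there exist $0<\alpha\le N$ and $A>0$ with $|x|^\alpha u_0(x)\to A$ as $|x|\to\infty$. Let $u$ be the solution of $$u_t(x,t)=\int_{\mathbb R^N}J(x-y)\big(u(y,t)-u(x,t)\big)\,dy\quad\text{in }\mathbb R^N\times(0,\infty),\qquad u(x,0)=u_0(x),$$ and let $u_\Delta$ be the solution of the heat equation with diffusivity $\mathfrak a$ and initial datum $u_0$. Then, for every $0<\mu<\frac{\alpha}{2N}$ there exists a constant $C_\mu$ such that for all $t>0$ $$t^{\alpha/2}\,\|u(\cdot,t)-u_\Delta(\cdot,t)\|_{L^\infty(\mathbb R^N)}\le C_\mu t^{-\mu}.$$ In particular: (i) If $\alpha<N$, there is a constant $C$ such that $u(x,t)\le C t^{-\alpha/2}$ for all $x\in\mathbb R^N$, $t>0$, and for every $K>0$ $$t^{\alpha/2}\,\|u(\cdot,t)-U_{\alpha,A}(\cdot,t)\|_{L^\infty(\{|x|\le K\sqrt t\})}\to0\quad\text{as }t\to\infty.$$ (ii) If $\alpha=N$, there is a constant $C$ such that $u(x,t)\le C t^{-N/2}\log t$ for all $x\in\mathbb R^N$, $t\ge 2$, and for every $K>0$ $$t^{N/2}\,\Big\|\frac{u(\cdot,t)}{\log t}-C_{A,N}\,U_{\mathfrak a}(\cdot,t)\Big\|_{L^\infty(\{|x|\le K\sqrt t\})}\to0\quad\text{as }t\to\infty,$$ where $C_{A,N}$ is a constant that depends only on $A$ and $N$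 (not on $J$, $u_0$ or $K$).
   Context: $J\in C_0^\infty(\mathbb R^N)$ (smooth with compact support) is radially symmetric, $J\ge0$, $\int_{\mathbb R^N} J=1$. The diffusivity associated with $J$ is $\mathfrak a=\frac{1}{2N}\int_{\mathbb R^N}|z|^2J(z)\,dz$. The solution $u$ is the unique bounded solution: a bounded measurable function on $\mathbb R^N\times[0,\infty)$ that, for each $x$, is $C^1$ in $t$ and satisfies the equation and the initial condition. The conditions on $u_0$ are understood pointwise for $u_0$ as a bounded measurable function. $U_{\mathfrak a}(x,t)=(4\pi\mathfrak a t)^{-N/2}e^{-|x|^2/(4\mathfrak a t)}$ is the fundamental solution of the heat equation with diffusivity $\mathfrak a$, and $u_\Delta(x,t)=\int_{\mathbb R^N}U_{\mathfrak a}(x-y,t)u_0(y)\,dy$. For $0<\alpha<N$, $U_{\alpha,A}$ is the solution of the heat equation $U_t=\mathfrak a\Delta U$ in $\mathbb R^N\times(0,\infty)$ with $U(x,0)=A|x|^{-\alpha}$, i.e. $U_{\alpha,A}(x,t)=\int_{\mathbb R^N}U_{\mathfrak a}(x-y,t)\,A|y|^{-\alpha}\,dy$. *)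

theory Defs
  imports "HOL-Analysis.Analysis" "HOL-Probability.Essential_Supremum"
begin

primrec Ck :: "nat \<Rightarrow> ('a::euclidean_space \<Rightarrow> real) \<Rightarrow> bool" where
  "Ck 0 f \<longleftrightarrow> continuous_on UNIV f"
| "Ck (Suc k) f \<longleftrightarrow> (\<forall>x. f differentiable (at x)) \<and>
     (\<forall>v. Ck k (\<lambda>x. frechet_derivative f (at x) v))"

definition smooth :: "('a::euclidean_space \<Rightarrow> real) \<Rightarrow> bool" where
  "smooth f \<longleftrightarrow> (\<forall>k. Ck k f)"

definition compactly_supported :: "('a::euclidean_space \<Rightarrow> real) \<Rightarrow> bool" where
  "compactly_supported f \<longleftrightarrow> compact (closure {x. f x \<noteq> 0})"

definition radially_symmetric :: "('a::euclidean_space \<Rightarrow> real) \<Rightarrow> bool" where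
  "radially_symmetric f \<longleftrightarrow> (\<forall>x y. norm x = norm y \<longrightarrow> f x = f y)"

definition convolution_kernel :: "(real^'n \<Rightarrow> real) \<Rightarrow> bool" where
  "convolution_kernel J \<longleftrightarrow>
     smooth J \<and> compactly_supported J \<and> radially_symmetric J \<and> (\<forall>x. 0 \<le> J x) \<and>
     integral\<^sup>L lebesgue J = 1"

definition diffusivity :: "(real^'n \<Rightarrow> real) \<Rightarrow> real" where
  "diffusivity J = 1 / (2 * real CARD('n)) * (LINT z|lebesgue. (norm z)\<^sup>2 * J z)"

text \<open>One-sided derivative at time 0. The library predicate for C1 functions asks for a two-sided
  derivative at every point of the set, which would involve the meaningless values at negative
  times.\<close>

definition C1_nonneg :: "(real \<Rightarrow> real) \<Rightarrow> bool" where
  "C1_nonneg f \<longleftrightarrow>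
     (\<exists>D. (\<forall>t\<ge>0. (f has_real_derivative D t) (at t within {0..})) \<and> continuous_on {0..} D)"

text \<open>Functions on space-time are total in the time variable; only their values at nonnegative times
  enter.\<close>

definition nonlocal_solution ::
  "(real^'n \<Rightarrow> real) \<Rightarrow> (real^'n \<Rightarrow> real) \<Rightarrow> (real^'n \<Rightarrow> real \<Rightarrow> real) \<Rightarrow> bool" where
  "nonlocal_solution J u0 u \<longleftrightarrow>
     (\<lambda>(x, t). u x t) \<in> borel_measurable (lebesgue_on (UNIV \<times> {0..})) \<and>
     (\<exists>M. \<forall>x. \<forall>t\<ge>0. \<bar>u x t\<bar> \<le> M) \<and>
     (\<forall>x. C1_nonneg (u x)) \<and>
     (\<forall>x. \<forall>t>0. (u x has_real_derivative
        (LINT y|lebesgue. J (x - y) * (u y t - u x t))) (at t)) \<and>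
     (\<forall>x. u x 0 = u0 x)"

definition heat_kernel :: "real \<Rightarrow> real^'n \<Rightarrow> real \<Rightarrow> real" where
  "heat_kernel a x t =
     (4 * pi * a * t) powr (- (real CARD('n) / 2)) * exp (- ((norm x)\<^sup>2 / (4 * a * t)))"

definition heat_solution :: "real \<Rightarrow> (real^'n \<Rightarrow> real) \<Rightarrow> real^'n \<Rightarrow> real \<Rightarrow> real" where
  "heat_solution a u0 x t = (LINT y|lebesgue. heat_kernel a (x - y) t * u0 y)"

text \<open>The value of the datum at the origin is 0 here, which is immaterial under the integral.\<close>

definition U_power :: "real \<Rightarrow> real \<Rightarrow> real \<Rightarrow> real^'n \<Rightarrow> real \<Rightarrow> real" where
  "U_power a \<alpha> A = heat_solution a (\<lambda>y. A * norm y powr (- \<alpha>))"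

text \<open>With values in the extended nonnegative reals: top if the function is not measurable or not
  essentially bounded on the set.\<close>

definition Linf_norm :: "'a::euclidean_space set \<Rightarrow> ('a \<Rightarrow> real) \<Rightarrow> ennreal" where
  "Linf_norm S f = esssup (lebesgue_on S) (\<lambda>x. ennreal \<bar>f x\<bar>)"

end

theory Submission
  imports Defs "HOL-Probability.Probability"
begin

text \<open>The proof compares two semigroups on bounded functions. The solution of the nonlocal equation arises from its
  datum by the transition operator \<open>P\<close> of a random walk with step distribution \<open>J\<close> observed after a Poisson number of
  steps (\<open>nonlocal_solution_representation\<close>), and the caloric function is convolution with a Gaussian
  \<open>G\<close> whose second moments agree with those of the walk. The comparison
  is a central limit theorem in total variation.

  The starting point is a gradient estimate for iterated convolutions (\<open>bdd_dconv_power\<close>): \<open>n\<close> convolutions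
  with a kernel of finite Fisher information map bounded functions to functions with derivatives of order
  \<open>n powr - (1 / 2)\<close>. The jump kernel has finite Fisher information because a nonnegative function with bounded
  second derivatives controls the square of its gradient. Lindeberg's replacement of one factor at a time
  then needs three derivatives of a function that has been smoothed about \<open>n\<close> times, and as the moments up
  to order two agree, each of the \<open>n\<close> replacements costs \<open>n powr - (3 / 2)\<close> (\<open>power_difference_le\<close>). Averaging over
  the Poisson number of steps, which deviates from \<open>t\<close> by \<open>sqrt t\<close>, gives
  \<open>\<bar>P \<psi> - G \<psi>\<bar> \<le> C / sqrt t\<close> for all data bounded by 1 (\<open>jump_gauss_difference\<close>).

  This estimate ignores the decay of the datum. The decay enters through
  \<open>P P \<phi> - G G \<phi> = (P - G) (P \<phi> + G \<phi>)\<close>, which holds as the operators commute: the first factor is small in norm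
  and the second is small in the sup norm. If the caloric function decays like \<open>t powr - b\<close>, the error hence decays like
  \<open>t powr - (b + 1 / 2)\<close> (\<open>jump_gauss_difference_decay\<close>). As \<open>b\<close> may be any number below \<open>\<alpha> / 2\<close>, and
  \<open>\<mu> < 1 / 2\<close>, this is the rate claimed.

  What remains concerns the heat equation only. For \<open>\<alpha>\<close> below the dimension, the datum may be replaced by its
  limiting power (\<open>caloric_selfsimilar_limit\<close>). For \<open>\<alpha>\<close> equal to the dimension, the datum seen at time \<open>t\<close> acts like a
  point mass at the origin of the size of its integral over the ball of radius \<open>sqrt t\<close>, which grows like
  \<open>ln t\<close> (\<open>caloric_critical_limit\<close>). Both limits are uniform on the whole space.\<close>

section \<open>Convolution with an integrable kernel\<close>

lemma lborel_distr_reflect: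
  fixes c :: "'a::euclidean_space"
  shows "distr lborel borel (\<lambda>z. c - z) = lborel"
proof -
  have "lborel = density (distr lborel borel (\<lambda>z. c + (-1) *\<^sub>R z)) (\<lambda>_. \<bar>-1::real\<bar> ^ DIM('a))"
    by (rule lborel_affine) simp
  then show ?thesis by (simp add: density_1)
qed

lemma lborel_integral_reflect:
  fixes f :: "'a::euclidean_space \<Rightarrow> real"
  assumes [measurable]: "f \<in> borel_measurable borel"
  shows "(LINT z|lborel. f (c - z)) = (LINT z|lborel. f z)"
  using integral_distr[of "\<lambda>z. c - z" lborel borel f] by (simp add: lborel_distr_reflect)

lemma lborel_integrable_reflect:
  fixes f :: "'a::euclidean_space \<Rightarrow> real"
  assumes [measurable]: "f \<in> borel_measurable borel"
  shows "integrable lborel (\<lambda>z. f (c - z)) \<longleftrightarrow> integrable lborel f"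
  using integrable_distr_eq[of "\<lambda>z. c - z" lborel borel f] by (simp add: lborel_distr_reflect)

lemma lborel_integral_translate:
  fixes f :: "'a::euclidean_space \<Rightarrow> real"
  assumes [measurable]: "f \<in> borel_measurable borel"
  shows "(LINT z|lborel. f (c + z)) = (LINT z|lborel. f z)"
  using integral_distr[of "(+) c" lborel borel f] by (simp add: lborel_distr_plus)

lemma lborel_integrable_translate:
  fixes f :: "'a::euclidean_space \<Rightarrow> real"
  assumes [measurable]: "f \<in> borel_measurable borel"
  shows "integrable lborel (\<lambda>z. f (c + z)) \<longleftrightarrow> integrable lborel f"
  using integrable_distr_eq[of "(+) c" lborel borel f] by (simp add: lborel_distr_plus)

text \<open>Bounded Borel functions, with the bound as a parameter: every estimate below is an operator bound
  on this class, so the bound has to be carried through compositions.\<close>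

definition bdd_borel :: "real \<Rightarrow> ('a::euclidean_space \<Rightarrow> real) \<Rightarrow> bool" where
  "bdd_borel B f \<longleftrightarrow> f \<in> borel_measurable borel \<and> (\<forall>x. \<bar>f x\<bar> \<le> B)"

lemma bdd_borelI: "f \<in> borel_measurable borel \<Longrightarrow> (\<And>x. \<bar>f x\<bar> \<le> B) \<Longrightarrow> bdd_borel B f"
  by (simp add: bdd_borel_def)

lemma bdd_borel_meas: "bdd_borel B f \<Longrightarrow> f \<in> borel_measurable borel"
  and bdd_borel_le: "bdd_borel B f \<Longrightarrow> \<bar>f x\<bar> \<le> B"
  by (simp_all add: bdd_borel_def)

lemma bdd_borel_nonneg: "bdd_borel B f \<Longrightarrow> 0 \<le> B"
  using bdd_borel_le[of B f undefined] by linarith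

lemma bdd_borel_diff: "bdd_borel B f \<Longrightarrow> bdd_borel C g \<Longrightarrow> bdd_borel (B + C) (\<lambda>x. f x - g x)"
  unfolding bdd_borel_def by (auto intro: order_trans[OF abs_triangle_ineq4] add_mono)

lemma bdd_borel_cmult: "bdd_borel B f \<Longrightarrow> bdd_borel (\<bar>c\<bar> * B) (\<lambda>x. c * f x)"
  unfolding bdd_borel_def by (auto simp: abs_mult intro: mult_left_mono)

lemma bdd_borel_mult: "bdd_borel B f \<Longrightarrow> bdd_borel C g \<Longrightarrow> bdd_borel (B * C) (\<lambda>x. f x * g x)"
  unfolding bdd_borel_def by (auto simp: abs_mult intro!: mult_mono dest: order_trans[OF abs_ge_zero])

lemma bdd_borel_const: "bdd_borel \<bar>c\<bar> (\<lambda>_. c)"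
  by (simp add: bdd_borel_def)

text \<open>The kernel is integrated against the translates of the function. In this form two convolutions commute
  by exchanging the order of integration, with no change of variables.\<close>

definition conv :: "('a::euclidean_space \<Rightarrow> real) \<Rightarrow> ('a \<Rightarrow> real) \<Rightarrow> 'a \<Rightarrow> real" where
  "conv K f x = (LINT z|lborel. K z * f (x - z))"

lemma conv_measurable [measurable]:
  assumes [measurable]: "K \<in> borel_measurable borel" "f \<in> borel_measurable borel"
  shows "conv K f \<in> borel_measurable borel"
  unfolding conv_def by measurable

lemma integrable_mult_bdd:
  assumes "integrable lborel K" "bdd_borel B f"
  shows "integrable lborel (\<lambda>z. K z * f z)"
proof (rule Bochner_Integration.integrable_bound)
  show "integrable lborel (\<lambda>z. B * \<bar>K z\<bar>)" using assms by auto
  show "(\<lambda>z. K z * f z) \<in> borel_measurable lborel"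
    using assms by (auto simp: bdd_borel_def)
  show "AE z in lborel. norm (K z * f z) \<le> norm (B * \<bar>K z\<bar>)"
    using assms bdd_borel_nonneg[OF assms(2)]
    by (intro AE_I2) (simp add: abs_mult bdd_borel_def mult.commute[of B] mult_left_mono)
qed

lemma bdd_borel_reflect: "bdd_borel B f \<Longrightarrow> bdd_borel B (\<lambda>z. f (x - z))"
  unfolding bdd_borel_def by auto

lemma conv_integrable:
  assumes "integrable lborel K" "bdd_borel B f"
  shows "integrable lborel (\<lambda>z. K z * f (x - z))"
  using integrable_mult_bdd[OF assms(1) bdd_borel_reflect[OF assms(2)]] .

lemma conv_le:
  assumes "integrable lborel K" "bdd_borel B f"
  shows "\<bar>conv K f x\<bar> \<le> (LINT z|lborel. \<bar>K z\<bar>) * B"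
proof -
  have "\<bar>conv K f x\<bar> \<le> (LINT z|lborel. \<bar>K z * f (x - z)\<bar>)"
    unfolding conv_def by (rule integral_abs_bound)
  also have "\<dots> \<le> (LINT z|lborel. \<bar>K z\<bar> * B)"
    using assms integrable_abs[OF conv_integrable[OF assms, of x]]
    by (intro integral_mono) (auto simp: abs_mult bdd_borel_def intro: mult_left_mono)
  finally show ?thesis by simp
qed

lemma bdd_borel_conv:
  assumes "integrable lborel K" "bdd_borel B f"
  shows "bdd_borel ((LINT z|lborel. \<bar>K z\<bar>) * B) (conv K f)"
proof (rule bdd_borelI)
  show "conv K f \<in> borel_measurable borel"
    using assms by (intro conv_measurable) (auto simp: bdd_borel_def)
qed (rule conv_le[OF assms])

lemma conv_flip:
  assumes [measurable]: "K \<in> borel_measurable borel" "f \<in> borel_measurable borel"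
  shows "conv K f x = (LINT y|lborel. K (x - y) * f y)"
  using lborel_integral_reflect[of "\<lambda>z. K z * f (x - z)" x] unfolding conv_def by simp

lemma conv_flip_integrable:
  assumes "integrable lborel K" "bdd_borel B f"
  shows "integrable lborel (\<lambda>y. K (x - y) * f y)"
  using lborel_integrable_reflect[of "\<lambda>z. K z * f (x - z)" x] conv_integrable[OF assms, of x] assms
  by (auto simp: bdd_borel_def)

lemma conv_diff:
  assumes "integrable lborel K" "bdd_borel B f" "bdd_borel C g"
  shows "conv K (\<lambda>x. f x - g x) x = conv K f x - conv K g x"
  using conv_integrable[OF assms(1,2), of x] conv_integrable[OF assms(1,3), of x]
  unfolding conv_def by (simp add: right_diff_distrib)

lemma conv_cmult: "conv K (\<lambda>x. c * f x) x = c * conv K f x"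
  unfolding conv_def by (simp add: mult.left_commute)

lemma conv_mono:
  assumes "integrable lborel K" "\<And>z. 0 \<le> K z" "bdd_borel B f" "bdd_borel C g" "\<And>x. f x \<le> g x"
  shows "conv K f x \<le> conv K g x"
  unfolding conv_def using assms conv_integrable[of K _ f x] conv_integrable[of K _ g x]
  by (intro integral_mono) (auto intro: mult_left_mono)

lemma integrable_tensor:
  fixes K :: "'a::euclidean_space \<Rightarrow> real" and H :: "'b::euclidean_space \<Rightarrow> real"
  assumes K: "integrable lborel K" and H: "integrable lborel H"
  shows "integrable (lborel \<Otimes>\<^sub>M lborel) (\<lambda>(z, w). K z * H w)"
proof -
  have [measurable]: "K \<in> borel_measurable borel" "H \<in> borel_measurable borel"
    using assms by auto
  show ?thesis
    by (rule lborel_pair.Fubini_integrable) (use assms in \<open>auto simp: abs_mult\<close>)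
qed

lemma conv_commute:
  assumes K: "integrable lborel K" and H: "integrable lborel H" and f: "bdd_borel B f"
  shows "conv K (conv H f) x = conv H (conv K f) x"
proof -
  have [measurable]: "K \<in> borel_measurable borel" "H \<in> borel_measurable borel" "f \<in> borel_measurable borel"
    using assms by (auto simp: bdd_borel_def)
  have KH: "integrable (lborel \<Otimes>\<^sub>M lborel) (\<lambda>(z, w). K z * H w)"
    using K H by (rule integrable_tensor) 
  have int: "integrable (lborel \<Otimes>\<^sub>M lborel) (\<lambda>(z, w). K z * H w * f (x - z - w))"
  proof (rule Bochner_Integration.integrable_bound)
    show "integrable (lborel \<Otimes>\<^sub>M lborel) (\<lambda>p. B * \<bar>case p of (z, w) \<Rightarrow> K z * H w\<bar>)"
      using KH by auto
    show "AE p in lborel \<Otimes>\<^sub>M lborel. norm (case p of (z, w) \<Rightarrow> K z * H w * f (x - z - w))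
        \<le> norm (B * \<bar>case p of (z, w) \<Rightarrow> K z * H w\<bar>)"
      using f bdd_borel_nonneg[OF f]
      by (intro AE_I2) (auto simp: abs_mult bdd_borel_def mult.commute[of B] intro!: mult_left_mono)
  qed measurable
  have "conv K (conv H f) x = (LINT z|lborel. (LINT w|lborel. K z * H w * f (x - z - w)))"
    unfolding conv_def by (simp add: mult.assoc)
  also have "\<dots> = (LINT w|lborel. (LINT z|lborel. K z * H w * f (x - z - w)))"
    using lborel_pair.Fubini_integral[OF int] by simp
  also have "\<dots> = (LINT w|lborel. (LINT z|lborel. H w * (K z * f (x - w - z))))"
    by (simp add: algebra_simps)
  also have "\<dots> = conv H (conv K f) x"
    unfolding conv_def by simp
  finally show ?thesis .
qed

text \<open>Two Gaussian convolutions are merged into one through this lemma; the iterated integral converges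
  absolutely because the total masses multiply.\<close>

lemma conv_assoc:
  assumes K: "integrable lborel K" and H: "integrable lborel H" and f: "bdd_borel B f"
  shows "conv K (conv H f) x = conv (conv K H) f x"
proof -
  have [measurable]: "K \<in> borel_measurable borel" "H \<in> borel_measurable borel" "f \<in> borel_measurable borel"
    using assms by (auto simp: bdd_borel_def)
  have KH: "integrable (lborel \<Otimes>\<^sub>M lborel) (\<lambda>(z, w). K z * H w)"
    using K H by (rule integrable_tensor)
  have *: "integrable lborel (\<lambda>w. H (w - z))" "(LINT w|lborel. \<bar>H (w - z)\<bar>) = (LINT w|lborel. \<bar>H w\<bar>)" for z
    using lborel_integrable_translate[of H "-z"] lborel_integral_translate[of "\<lambda>w. \<bar>H w\<bar>" "-z"] H
    by auto
  have int: "integrable (lborel \<Otimes>\<^sub>M lborel) (\<lambda>(z, w). K z * H (w - z) * f (x - w))"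
  proof (rule lborel_pair.Fubini_integrable)
    have eq: "(LINT w|lborel. norm (case (z, w) of (z, w) \<Rightarrow> K z * H (w - z) * f (x - w)))
       \<le> \<bar>K z\<bar> * ((LINT w|lborel. \<bar>H w\<bar>) * B)" for z
    proof -
      have "(LINT w|lborel. norm (case (z, w) of (z, w) \<Rightarrow> K z * H (w - z) * f (x - w)))
         = (LINT w|lborel. \<bar>K z\<bar> * (\<bar>H (w - z)\<bar> * \<bar>f (x - w)\<bar>))"
        by (simp add: abs_mult mult.assoc)
      also have "\<dots> = \<bar>K z\<bar> * (LINT w|lborel. (\<bar>H (w - z)\<bar> * \<bar>f (x - w)\<bar>))"
        by simp
      also have "(LINT w|lborel. (\<bar>H (w - z)\<bar> * \<bar>f (x - w)\<bar>)) \<le> (LINT w|lborel. \<bar>H (w - z)\<bar> * B)"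
        using *(1)[of z] bdd_borel_le[OF f]
          integrable_abs[OF integrable_mult_bdd[OF *(1)[of z] bdd_borel_reflect[OF f]]]
        by (intro integral_mono) (auto simp: abs_mult intro!: mult_left_mono)
      also have "\<dots> = (LINT w|lborel. \<bar>H w\<bar>) * B"
        using * by simp
      finally show ?thesis by (simp add: mult_left_mono)
    qed
    show "integrable lborel (\<lambda>z. LINT w|lborel. norm (case (z, w) of (z, w) \<Rightarrow> K z * H (w - z) * f (x - w)))"
    proof (rule Bochner_Integration.integrable_bound)
      show "integrable lborel (\<lambda>z. \<bar>K z\<bar> * ((LINT w|lborel. \<bar>H w\<bar>) * B))" using K by auto
      show "AE z in lborel. norm (LINT w|lborel. norm (case (z, w) of (z, w) \<Rightarrow> K z * H (w - z) * f (x - w)))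
        \<le> norm (\<bar>K z\<bar> * ((LINT w|lborel. \<bar>H w\<bar>) * B))"
        using eq by (intro AE_I2) (simp add: abs_of_nonneg, meson abs_ge_self order_trans)
    qed measurable
    show "AE z in lborel. integrable lborel (\<lambda>w. case (z, w) of (z, w) \<Rightarrow> K z * H (w - z) * f (x - w))"
      using integrable_mult_bdd[OF *(1) bdd_borel_reflect[OF f]] by (auto simp: mult.assoc)
  qed measurable
  have "conv K (conv H f) x = (LINT z|lborel. K z * (LINT w|lborel. H (w - z) * f (x - w)))"
  proof -
    have "conv H f (x - z) = (LINT w|lborel. H (w - z) * f (x - w))" for z
      using lborel_integral_translate[of "\<lambda>w. H w * f (x - z - w)" "-z"] unfolding conv_def
      by (simp add: algebra_simps)
    then show ?thesis by (simp add: conv_def[of K])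
  qed
  also have "\<dots> = (LINT z|lborel. (LINT w|lborel. K z * H (w - z) * f (x - w)))"
    by (simp add: mult.assoc)
  also have "\<dots> = (LINT w|lborel. (LINT z|lborel. K z * H (w - z) * f (x - w)))"
    using lborel_pair.Fubini_integral[OF int] by simp
  also have "\<dots> = conv (conv K H) f x"
    unfolding conv_def by simp
  finally show ?thesis .
qed

text \<open>Convolution passes through a normally convergent series. The Poisson sum of convolution powers is such
  a series.\<close>

lemma conv_suminf:
  assumes K: "integrable lborel K" and f: "\<And>n. bdd_borel (b n) (f n)" and b: "summable b"
  shows "conv K (\<lambda>x. \<Sum>n. f n x) x = (\<Sum>n. conv K (f n) x)"
    and "summable (\<lambda>n. f n x)" "bdd_borel (\<Sum>n. b n) (\<lambda>x. \<Sum>n. f n x)"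
proof -
  have [measurable]: "K \<in> borel_measurable borel" "f n \<in> borel_measurable borel" for n
    using assms by (auto simp: bdd_borel_def)
  have sa: "summable (\<lambda>n. \<bar>f n x\<bar>)" for x
    by (rule summable_comparison_test'[OF b]) (use f in \<open>auto simp: bdd_borel_def\<close>)
  then show s: "summable (\<lambda>n. f n x)" for x by (rule summable_rabs_cancel)
  have le: "\<bar>\<Sum>n. f n x\<bar> \<le> (\<Sum>n. b n)" for x
  proof -
    have "\<bar>\<Sum>n. f n x\<bar> \<le> (\<Sum>n. \<bar>f n x\<bar>)" by (rule summable_rabs[OF sa])
    also have "\<dots> \<le> (\<Sum>n. b n)" by (rule suminf_le) (use sa b f in \<open>auto simp: bdd_borel_def\<close>)
    finally show ?thesis .
  qed
  show bb: "bdd_borel (\<Sum>n. b n) (\<lambda>x. \<Sum>n. f n x)"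
    by (rule bdd_borelI[OF _ le]) measurable
  have "(LINT z|lborel. (\<Sum>n. K z * f n (x - z))) = (\<Sum>n. LINT z|lborel. K z * f n (x - z))"
  proof (rule integral_suminf)
    show "integrable lborel (\<lambda>z. K z * f n (x - z))" for n by (rule conv_integrable[OF K f])
    show "AE z in lborel. summable (\<lambda>n. norm (K z * f n (x - z)))"
      using sa by (auto simp: abs_mult intro: summable_mult)
    show "summable (\<lambda>n. LINT z|lborel. norm (K z * f n (x - z)))"
    proof (rule summable_comparison_test')
      show "summable (\<lambda>n. (LINT z|lborel. \<bar>K z\<bar>) * b n)" using b by (rule summable_mult)
      fix n :: nat
      have "(LINT z|lborel. norm (K z * f n (x - z))) \<le> (LINT z|lborel. \<bar>K z\<bar> * b n)"
        using K integrable_abs[OF conv_integrable[OF K f[of n], of x]] f[of n]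
        by (intro integral_mono) (auto simp: abs_mult bdd_borel_def intro: mult_left_mono)
      then show "norm (LINT z|lborel. norm (K z * f n (x - z))) \<le> (LINT z|lborel. \<bar>K z\<bar>) * b n"
        by simp
    qed
  qed
  then show "conv K (\<lambda>x. \<Sum>n. f n x) x = (\<Sum>n. conv K (f n) x)"
    unfolding conv_def using suminf_mult[OF s] by simp
qed

lemma bdd_borel_conv_prob:
  assumes "integrable lborel K" "\<And>z. 0 \<le> K z" "(LINT z|lborel. K z) = 1" "bdd_borel B f"
  shows "bdd_borel B (conv K f)"
  using bdd_borel_conv[OF assms(1,4)] assms(2,3) by simp

lemma bdd_borel_conv_power:
  assumes "integrable lborel K" "\<And>z. 0 \<le> K z" "(LINT z|lborel. K z) = 1" "bdd_borel B f"
  shows "bdd_borel B ((conv K ^^ n) f)"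
  by (induction n) (auto intro: assms bdd_borel_conv_prob)

lemma conv_power_commute:
  assumes "integrable lborel K" "\<And>z. 0 \<le> K z" "(LINT z|lborel. K z) = 1" 
     "integrable lborel H" "bdd_borel B f"
  shows "(conv K ^^ n) (conv H f) = conv H ((conv K ^^ n) f)"
proof (induction n)
  case (Suc n)
  have "conv K (conv H ((conv K ^^ n) f)) = conv H (conv K ((conv K ^^ n) f))"
    using conv_commute[OF assms(1,4) bdd_borel_conv_power[OF assms(1-3,5)]] by blast
  with Suc show ?case by simp
qed simp

section \<open>Kernels with Gaussian decay and finite Fisher information\<close>

lemma nn_integral_gaussian_real:
  assumes "0 < (c::real)"
  shows "(\<integral>\<^sup>+x. ennreal (exp (- c * x\<^sup>2)) \<partial>lborel) = ennreal (sqrt (pi / c))"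
proof -
  define \<sigma> where "\<sigma> = sqrt (1 / (2 * c))"
  have \<sigma>: "\<sigma> > 0" "\<sigma>\<^sup>2 = 1 / (2 * c)" using assms by (auto simp: \<sigma>_def)
  have "exp (- c * x\<^sup>2) = sqrt (pi / c) * normal_density 0 \<sigma> x" for x
    using assms by (simp add: normal_density_def \<sigma>(2) field_simps)
  then have "(\<integral>\<^sup>+x. ennreal (exp (- c * x\<^sup>2)) \<partial>lborel)
     = ennreal (sqrt (pi / c)) * (\<integral>\<^sup>+x. ennreal (normal_density 0 \<sigma> x) \<partial>lborel)"
    using assms by (subst nn_integral_cmult[symmetric]) (auto simp: ennreal_mult')
  also have "(\<integral>\<^sup>+x. ennreal (normal_density 0 \<sigma> x) \<partial>lborel) = 1"
    using \<sigma> by (subst nn_integral_eq_integral) (auto simp: integral_normal_density)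
  finally show ?thesis by simp
qed

text \<open>A Gaussian is a product over the coordinates.\<close>

lemma nn_integral_gaussian:
  assumes "0 < (c::real)"
  shows "(\<integral>\<^sup>+x. ennreal (exp (- c * (norm x)\<^sup>2)) \<partial>(lborel :: 'a::euclidean_space measure))
     = ennreal ((pi / c) powr (DIM('a) / 2))"
proof -
  have eq: "ennreal (exp (- c * (norm x)\<^sup>2)) = (\<Prod>b\<in>Basis. ennreal (exp (- c * (x \<bullet> b)\<^sup>2)))" for x :: 'a
  proof -
    have "(norm x)\<^sup>2 = (\<Sum>b\<in>Basis. (x \<bullet> b)\<^sup>2)"
      by (subst power2_norm_eq_inner, subst euclidean_inner) (simp add: power2_eq_square)
    then have "exp (- c * (norm x)\<^sup>2) = exp (\<Sum>b\<in>Basis. - c * (x \<bullet> b)\<^sup>2)"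
      by (simp add: sum_distrib_left sum_negf)
    then show ?thesis by (simp add: exp_sum prod_ennreal)
  qed
  have "(\<integral>\<^sup>+x. ennreal (exp (- c * (norm x)\<^sup>2)) \<partial>(lborel :: 'a measure))
     = (\<Prod>b\<in>(Basis::'a set). \<integral>\<^sup>+x. ennreal (exp (- c * x\<^sup>2)) \<partial>lborel)"
    unfolding eq by (rule nn_integral_lborel_prod) auto
  also have "\<dots> = ennreal (sqrt (pi / c)) ^ DIM('a)"
    by (simp only: nn_integral_gaussian_real[OF assms]) simp
  also have "\<dots> = ennreal ((pi / c) powr (DIM('a) / 2))"
    using assms by (simp add: ennreal_power powr_half_sqrt[symmetric] powr_realpow[symmetric] powr_powr)
  finally show ?thesis .
qed

lemma integrable_gaussian:
  assumes "0 < (c::real)"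
  shows "integrable (lborel :: 'a::euclidean_space measure) (\<lambda>x. exp (- c * (norm x)\<^sup>2))"
  by (rule integrableI_nonneg) (use nn_integral_gaussian[OF assms, where 'a='a] in auto)

lemma integral_gaussian:
  assumes "0 < (c::real)"
  shows "(LINT x|(lborel :: 'a::euclidean_space measure). exp (- c * (norm x)\<^sup>2)) = (pi / c) powr (DIM('a) / 2)"
  by (rule integral_eq_nn_integral[THEN trans]) (use nn_integral_gaussian[OF assms, where 'a='a] in auto)

text \<open>All moments of a function with Gaussian decay are controlled by halving the exponent.\<close>

lemma power_gaussian_bound:
  assumes "0 < (c::real)"
  shows "\<exists>M>0. \<forall>r\<ge>0. r ^ k * exp (- c * r\<^sup>2) \<le> M * exp (- (c / 2) * r\<^sup>2)"
proof (intro exI conjI allI impI)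
  fix r :: real assume r: "0 \<le> r"
  define y where "y = c / 2 * r\<^sup>2"
  have y: "0 \<le> y" using assms by (simp add: y_def)
  have "y ^ k / fact k \<le> exp y"
  proof -
    have "(\<Sum>n\<in>{k}. y ^ n / fact n) \<le> (\<Sum>n. y ^ n / fact n)"
      using summable_exp[of y] y by (intro sum_le_suminf) (auto simp: divide_inverse mult.commute)
    then show ?thesis by (simp add: exp_def divide_inverse mult.commute)
  qed
  then have "(2 / c) ^ k * y ^ k \<le> (2 / c) ^ k * fact k * exp y"
    using assms by (simp add: field_simps)
  moreover have "(2 / c) ^ k * y ^ k = r ^ (2 * k)"
    using assms by (simp add: y_def power_mult_distrib[symmetric] power_mult)
  moreover have "r ^ k \<le> 1 + r ^ (2 * k)"
  proof (cases "r \<le> 1")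
    case True then have "r ^ k \<le> 1" using r by (rule power_le_one[rotated])
    moreover have "0 \<le> r ^ (2 * k)" using r by simp
    ultimately show ?thesis by linarith
  next
    case False then have "r ^ k \<le> r ^ (2 * k)" by (intro power_increasing) auto
    then show ?thesis by simp
  qed
  moreover have "1 \<le> exp y" using y by simp
  ultimately have "r ^ k \<le> exp y + (2 / c) ^ k * fact k * exp y" by linarith
  then have "r ^ k \<le> (1 + (2 / c) ^ k * fact k) * exp y" by (simp add: algebra_simps)
  then have "r ^ k * exp (- c * r\<^sup>2) \<le> (1 + (2 / c) ^ k * fact k) * exp y * exp (- c * r\<^sup>2)"
    by (rule mult_right_mono) simp
  also have "\<dots> = (1 + (2 / c) ^ k * fact k) * exp (- (c / 2) * r\<^sup>2)"
    by (simp add: exp_add[symmetric] mult.assoc y_def)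
  finally show "r ^ k * exp (- c * r\<^sup>2) \<le> (1 + (2 / c) ^ k * fact k) * exp (- (c / 2) * r\<^sup>2)" .
qed (use assms in \<open>auto intro!: add_pos_nonneg\<close>)

lemma integrable_power_gaussian_decay:
  fixes F :: "'a::euclidean_space \<Rightarrow> real"
  assumes "0 < (c::real)" and [measurable]: "F \<in> borel_measurable borel"
    and F: "\<And>z. \<bar>F z\<bar> \<le> C * norm z ^ k * exp (- c * (norm z)\<^sup>2)"
  shows "integrable lborel F"
proof -
  obtain M where M: "M > 0" "\<And>r. r \<ge> 0 \<Longrightarrow> r ^ k * exp (- c * r\<^sup>2) \<le> M * exp (- (c / 2) * r\<^sup>2)"
    using power_gaussian_bound[OF assms(1), of k] by blast
  show ?thesis
  proof (rule Bochner_Integration.integrable_bound)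
    show "integrable lborel (\<lambda>z::'a. \<bar>C\<bar> * (M * exp (- (c / 2) * (norm z)\<^sup>2)))"
      using integrable_gaussian[of "c / 2", where 'a='a] assms by auto
    show "AE z in lborel. norm (F z) \<le> norm (\<bar>C\<bar> * (M * exp (- (c / 2) * (norm z)\<^sup>2)))"
    proof (rule AE_I2)
      fix z :: 'a
      have "\<bar>F z\<bar> \<le> \<bar>C\<bar> * (norm z ^ k * exp (- c * (norm z)\<^sup>2))"
        using F[of z] by (smt (verit) mult.assoc mult_right_mono zero_le_mult_iff exp_ge_zero norm_ge_zero zero_le_power)
      also have "\<dots> \<le> \<bar>C\<bar> * (M * exp (- (c / 2) * (norm z)\<^sup>2))"
        by (rule mult_left_mono[OF M(2)]) auto
      finally show "norm (F z) \<le> norm (\<bar>C\<bar> * (M * exp (- (c / 2) * (norm z)\<^sup>2)))"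
        using M(1) by (simp add: abs_mult)
    qed
  qed simp
qed

text \<open>Both the jump kernel and the Gaussian belong to this class. The last condition bounds the square of the
  derivative by the kernel itself times an integrable weight; it says that the Fisher information
  \<open>\<integral> (dK v)\<^sup>2 / K\<close> is finite, but is stated without dividing by a kernel that may
  vanish. Compactly supported nonnegative functions with two continuous derivatives satisfy it, and
  it is what makes iterated convolutions smoothing at the diffusive rate.\<close>

locale smooth_kernel =
  fixes K :: "'a::euclidean_space \<Rightarrow> real" and dK :: "'a \<Rightarrow> 'a \<Rightarrow> real" and C c :: real
  assumes nonneg: "0 \<le> K z"
    and deriv: "(K has_derivative (\<lambda>v. dK v z)) (at z)"
    and dmeas [measurable]: "dK v \<in> borel_measurable borel"
    and mass: "(LINT z|lborel. K z) = 1"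
    and c: "0 < c"
    and decay: "K z \<le> C * exp (- c * (norm z)\<^sup>2)"
    and fisher: "(dK v z)\<^sup>2 \<le> C * (norm v)\<^sup>2 * exp (- c * (norm z)\<^sup>2) * K z"
begin

lemma C_nonneg: "0 \<le> C"
  using decay[of 0] nonneg[of 0] by simp

lemma meas [measurable]: "K \<in> borel_measurable borel"
  by (intro borel_measurable_continuous_onI continuous_at_imp_continuous_on ballI has_derivative_continuous[OF deriv])

lemma int: "integrable lborel K"
  by (rule integrable_power_gaussian_decay[OF c, where C=C and k=0]) (use decay nonneg in \<open>auto simp: abs_of_nonneg\<close>)

lemma dK_le: "\<bar>dK v z\<bar> \<le> C * norm v * exp (- c * (norm z)\<^sup>2)"
proof -
  have "(dK v z)\<^sup>2 \<le> C * (norm v)\<^sup>2 * exp (- c * (norm z)\<^sup>2) * (C * exp (- c * (norm z)\<^sup>2))"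
    using fisher[of v z] mult_left_mono[OF decay[of z], of "C * (norm v)\<^sup>2 * exp (- c * (norm z)\<^sup>2)"] C_nonneg
    by (simp add: mult.assoc)
  also have "\<dots> = (C * norm v * exp (- c * (norm z)\<^sup>2))\<^sup>2"
    by (simp add: power2_eq_square algebra_simps)
  finally show ?thesis
    using C_nonneg by (intro power2_le_imp_le[of "\<bar>dK v z\<bar>"]) auto
qed

lemma dint: "integrable lborel (dK v)"
  by (rule integrable_power_gaussian_decay[OF c, where C="C * norm v" and k=0]) (use dK_le in auto)

lemma dK_scale: "dK (r *\<^sub>R v) z = r * dK v z"
  using linear_cmul[OF has_derivative_linear[OF deriv[of z]], of r v] by simp

lemma dK_sum: "dK (\<Sum>i\<in>I. r i *\<^sub>R v i) z = (\<Sum>i\<in>I. r i * dK (v i) z)"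
proof -
  interpret linear "\<lambda>v. dK v z" by (rule has_derivative_linear[OF deriv[of z]])
  show ?thesis by (simp add: sum scale)
qed

lemma deriv_line: "((\<lambda>s. K (w + s *\<^sub>R v)) has_real_derivative dK v (w + s *\<^sub>R v)) (at s)"
proof -
  have "((\<lambda>s. K (w + s *\<^sub>R v)) has_derivative (\<lambda>h. dK (h *\<^sub>R v) (w + s *\<^sub>R v))) (at s)"
    by (rule has_derivative_compose[OF _ deriv]) (auto intro!: derivative_eq_intros)
  then show ?thesis by (simp add: has_field_derivative_def dK_scale mult.commute[of _ "dK _ _"])
qed

lemma bdd_conv: "bdd_borel B f \<Longrightarrow> bdd_borel B (conv K f)"
  by (rule bdd_borel_conv_prob[OF int nonneg mass])

lemma bdd_conv_power: "bdd_borel B f \<Longrightarrow> bdd_borel B ((conv K ^^ n) f)"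
  by (rule bdd_borel_conv_power[OF int nonneg mass])

lemma bdd_dconv: "bdd_borel B f \<Longrightarrow> bdd_borel ((LINT z|lborel. \<bar>dK v z\<bar>) * B) (conv (dK v) f)"
  by (rule bdd_borel_conv[OF dint])

text \<open>Differentiation under the integral. The difference quotients of the kernel are dominated by a Gaussian of
  half the exponent, since a shift by at most \<open>v\<close> costs only a constant factor.\<close>

lemma conv_has_derivative_aux:
  assumes f: "bdd_borel B f"
  shows "((\<lambda>s. conv K f (x + s *\<^sub>R v)) has_real_derivative conv (dK v) f x) (at 0)"
  unfolding DERIV_def tendsto_at_iff_sequentially comp_def
proof (intro allI impI)
  fix h :: "nat \<Rightarrow> real" assume h: "\<forall>i. h i \<in> UNIV - {0}" "h \<longlonglongrightarrow> 0"
  have [measurable]: "f \<in> borel_measurable borel" using f by (rule bdd_borel_meas)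
  obtain n0 where n0: "\<And>n. n \<ge> n0 \<Longrightarrow> \<bar>h n\<bar> \<le> 1"
    using LIMSEQ_D[OF h(2), of 1] by (force simp: less_imp_le)
  define q where "q n y = (K (x + h (n + n0) *\<^sub>R v - y) - K (x - y)) / h (n + n0) * f y" for n y
  have nz: "h n \<noteq> 0" for n using h(1) by auto
  let ?w = "\<lambda>y. C * norm v * exp (c * (norm v)\<^sup>2) * B * exp (- (c/2) * (norm (x - y))\<^sup>2)"
  have bound: "\<bar>q n y\<bar> \<le> ?w y" for n y
  proof -
    let ?h = "h (n + n0)"
    have quot: "\<bar>K (x - y + ?h *\<^sub>R v) - K (x - y)\<bar> \<le> C * norm v * exp (c * (norm v)\<^sup>2) * exp (- (c/2) * (norm (x - y))\<^sup>2) * \<bar>?h\<bar>"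
    proof -
      have "norm (K (x - y + ?h *\<^sub>R v) - K (x - y + 0 *\<^sub>R v))
         \<le> C * norm v * exp (c * (norm v)\<^sup>2) * exp (- (c/2) * (norm (x - y))\<^sup>2) * norm (?h - 0)"
      proof (rule field_differentiable_bound[where S="{-1..1}" and f'="\<lambda>s. dK v (x - y + s *\<^sub>R v)"])
        fix s :: real assume s: "s \<in> {-1..1}"
        show "((\<lambda>s. K (x - y + s *\<^sub>R v)) has_field_derivative dK v (x - y + s *\<^sub>R v)) (at s within {- 1..1})"
          by (rule has_field_derivative_at_within[OF deriv_line])
        have "norm (x - y) \<le> norm (x - y + s *\<^sub>R v) + norm (s *\<^sub>R v)"
          by (metis add_diff_cancel norm_triangle_ineq4)
        also have "\<dots> \<le> norm (x - y + s *\<^sub>R v) + norm v"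
          using s by (simp add: abs_le_iff mult_left_le_one_le)
        finally have "(norm (x - y))\<^sup>2 \<le> (norm (x - y + s *\<^sub>R v) + norm v)\<^sup>2"
          by (rule power_mono) simp
        also have "\<dots> \<le> 2 * (norm (x - y + s *\<^sub>R v))\<^sup>2 + 2 * (norm v)\<^sup>2"
          using sum_squares_bound[of "norm (x - y + s *\<^sub>R v)" "norm v"] by (simp add: power2_sum)
        finally have "c * (norm (x - y))\<^sup>2 \<le> c * (2 * (norm (x - y + s *\<^sub>R v))\<^sup>2 + 2 * (norm v)\<^sup>2)"
          using c by (intro mult_left_mono) auto
        then have "exp (- c * (norm (x - y + s *\<^sub>R v))\<^sup>2) \<le> exp (c * (norm v)\<^sup>2 + (- (c/2) * (norm (x - y))\<^sup>2))"
          by (simp add: algebra_simps)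
        then have "C * norm v * exp (- c * (norm (x - y + s *\<^sub>R v))\<^sup>2) \<le> C * norm v * exp (c * (norm v)\<^sup>2 + (- (c/2) * (norm (x - y))\<^sup>2))"
          using C_nonneg by (intro mult_left_mono) auto
        then show "norm (dK v (x - y + s *\<^sub>R v)) \<le> C * norm v * exp (c * (norm v)\<^sup>2) * exp (- (c/2) * (norm (x - y))\<^sup>2)"
          using dK_le[of v "x - y + s *\<^sub>R v"] by (simp only: exp_add mult.assoc real_norm_def)
      qed (use n0[of "n + n0"] in \<open>auto simp: abs_le_iff\<close>)
      then show ?thesis by simp
    qed
    have "x + ?h *\<^sub>R v - y = x - y + ?h *\<^sub>R v" by simp
    then have "\<bar>q n y\<bar> = \<bar>K (x - y + ?h *\<^sub>R v) - K (x - y)\<bar> / \<bar>?h\<bar> * \<bar>f y\<bar>"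
      unfolding q_def abs_mult abs_divide by (simp only:)
    also have "\<dots> \<le> C * norm v * exp (c * (norm v)\<^sup>2) * exp (- (c/2) * (norm (x - y))\<^sup>2) * B"
      using quot nz[of "n + n0"] bdd_borel_le[OF f, of y] C_nonneg
      by (intro mult_mono) (auto simp: divide_le_eq)
    finally show ?thesis by (simp add: mult_ac)
  qed
  have "(\<lambda>n. (LINT y|lborel. q n y)) \<longlonglongrightarrow> (LINT y|lborel. dK v (x - y) * f y)"
  proof (rule integral_dominated_convergence[where w="?w"])
    show "integrable lborel ?w"
      using lborel_integrable_reflect[of "\<lambda>z. exp (- (c/2) * (norm z)\<^sup>2)" x] integrable_gaussian[of "c/2", where 'a='a] c
      by auto
    show "AE y in lborel. (\<lambda>n. q n y) \<longlonglongrightarrow> dK v (x - y) * f y"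
    proof (rule AE_I2)
      fix y
      have "((\<lambda>k. (K (x - y + (0 + k) *\<^sub>R v) - K (x - y + 0 *\<^sub>R v)) / k) \<longlongrightarrow> dK v (x - y)) (at 0)"
        using deriv_line[of "x - y" v 0] unfolding DERIV_def by simp
      moreover have "(\<lambda>n. h (n + n0)) \<longlonglongrightarrow> 0" using h(2) by (rule LIMSEQ_ignore_initial_segment)
      ultimately have "(\<lambda>n. (K (x - y + (0 + h (n + n0)) *\<^sub>R v) - K (x - y + 0 *\<^sub>R v)) / h (n + n0)) \<longlonglongrightarrow> dK v (x - y)"
        unfolding tendsto_at_iff_sequentially comp_def using nz by fastforce
      then show "(\<lambda>n. q n y) \<longlonglongrightarrow> dK v (x - y) * f y"
        unfolding q_def by (intro tendsto_mult tendsto_const) (simp add: algebra_simps)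
    qed
    show "AE y in lborel. norm (q n y) \<le> ?w y" for n using bound by auto
    show "q n \<in> borel_measurable lborel" for n unfolding q_def by measurable
  qed measurable
  moreover have "(LINT y|lborel. q n y) = (conv K f (x + (0 + h (n + n0)) *\<^sub>R v) - conv K f (x + 0 *\<^sub>R v)) / h (n + n0)" for n
  proof -
    have "(LINT y|lborel. q n y) = (LINT y|lborel. (K (x + h (n + n0) *\<^sub>R v - y) * f y - K (x - y) * f y)) / h (n + n0)"
      unfolding q_def by (subst integral_divide_zero[symmetric]) (auto simp: field_simps intro!: Bochner_Integration.integral_cong)
    then show ?thesis
      using conv_flip_integrable[OF int f] by (simp add: conv_flip)
  qed
  ultimately have "(\<lambda>n. (conv K f (x + (0 + h (n + n0)) *\<^sub>R v) - conv K f (x + 0 *\<^sub>R v)) / h (n + n0)) \<longlonglongrightarrow> conv (dK v) f x"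
    by (simp add: conv_flip)
  then show "(\<lambda>n. (conv K f (x + (0 + h n) *\<^sub>R v) - conv K f (x + 0 *\<^sub>R v)) / h n) \<longlonglongrightarrow> conv (dK v) f x"
    by (rule LIMSEQ_offset)
qed

lemma conv_has_derivative:
  assumes f: "bdd_borel B f"
  shows "((\<lambda>s. conv K f (x + s *\<^sub>R v)) has_real_derivative conv (dK v) f (x + s *\<^sub>R v)) (at s)"
proof -
  have "((\<lambda>h. conv K f (x + s *\<^sub>R v + h *\<^sub>R v)) has_real_derivative conv (dK v) f (x + s *\<^sub>R v)) (at 0)"
    by (rule conv_has_derivative_aux[OF f])
  then show ?thesis
    using DERIV_shift[of "\<lambda>s. conv K f (x + s *\<^sub>R v)" _ 0 s] by (simp add: scaleR_add_left add_ac)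
qed

text \<open>The convolution of a constant is constant.\<close>

lemma dK_mass: "(LINT z|lborel. dK v z) = 0"
proof -
  have "((\<lambda>s::real. 1) has_real_derivative conv (dK v) (\<lambda>_. 1) 0) (at 0)"
    using conv_has_derivative_aux[OF bdd_borel_const[of 1], of 0 v] by (simp add: conv_def mass)
  then have "conv (dK v) (\<lambda>_. 1) 0 = 0"
    using DERIV_unique DERIV_const by blast
  then show ?thesis by (simp add: conv_def)
qed

text \<open>An upper bound for the Fisher information in a unit direction.\<close>

definition information :: real where
  "information = C * (pi / c) powr (DIM('a) / 2)"

lemma information_nonneg: "0 \<le> information"
  using C_nonneg by (simp add: information_def)

lemma conv_variance:
  assumes f: "bdd_borel B f"
  shows "conv K (\<lambda>y. (f y)\<^sup>2) x - (conv K f x)\<^sup>2 = (LINT z|lborel. K z * (f (x - z) - conv K f x)\<^sup>2)"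
    and "integrable lborel (\<lambda>z. K z * (f (x - z) - conv K f x)\<^sup>2)"
proof -
  let ?m = "conv K f x"
  have f2: "bdd_borel (B * B) (\<lambda>y. (f y)\<^sup>2)"
    using bdd_borel_mult[OF f f] by (simp add: power2_eq_square)
  have i: "integrable lborel (\<lambda>z. K z * (f (x - z))\<^sup>2)" "integrable lborel (\<lambda>z. K z * f (x - z))"
    by (rule conv_integrable[OF int f2], rule conv_integrable[OF int f])
  have eq: "K z * (f (x - z) - ?m)\<^sup>2 = K z * (f (x - z))\<^sup>2 - (2 * ?m) * (K z * f (x - z)) + ?m\<^sup>2 * K z" for z
    by (simp add: power2_diff algebra_simps)
  show "integrable lborel (\<lambda>z. K z * (f (x - z) - ?m)\<^sup>2)"
    unfolding eq using i int by auto
  have "(LINT z|lborel. K z * (f (x - z) - ?m)\<^sup>2)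
      = conv K (\<lambda>y. (f y)\<^sup>2) x - 2 * ?m * ?m + ?m\<^sup>2"
    unfolding eq using i int by (simp add: mass) (simp add: conv_def)
  then show "conv K (\<lambda>y. (f y)\<^sup>2) x - ?m\<^sup>2 = (LINT z|lborel. K z * (f (x - z) - ?m)\<^sup>2)"
    by (simp add: power2_eq_square)
qed

lemma conv_square_le:
  assumes f: "bdd_borel B f"
  shows "(conv K f x)\<^sup>2 \<le> conv K (\<lambda>y. (f y)\<^sup>2) x"
proof -
  have "0 \<le> (LINT z|lborel. K z * (f (x - z) - conv K f x)\<^sup>2)"
    by (rule Bochner_Integration.integral_nonneg) (simp add: nonneg)
  then show ?thesis using conv_variance(1)[OF f, of x] by simp
qed

text \<open>The derivative of a convolution is a covariance of \<open>f\<close> with the score \<open>dK v / K\<close>,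
  so the Cauchy-Schwarz inequality bounds its square by the Fisher information times the local variance of
  \<open>f\<close> under the kernel.\<close>

lemma dconv_square_le_variance:
  assumes f: "bdd_borel B f"
  shows "(conv (dK v) f x)\<^sup>2 \<le> information * (norm v)\<^sup>2 * (conv K (\<lambda>y. (f y)\<^sup>2) x - (conv K f x)\<^sup>2)"
proof -
  define m where "m = conv K f x"
  define D where "D = conv (dK v) f x"
  define V where "V = conv K (\<lambda>y. (f y)\<^sup>2) x - (conv K f x)\<^sup>2"
  define W where "W = information * (norm v)\<^sup>2"
  let ?E = "\<lambda>z::'a. exp (- c * (norm z)\<^sup>2)"
  have iD: "integrable lborel (\<lambda>z. dK v z * f (x - z))" by (rule conv_integrable[OF dint f])
  \<comment> \<open>Subtracting the mean is possible as the derivative of the kernel has total mass 0.\<close>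
  have D: "D = (LINT z|lborel. dK v z * (f (x - z) - m))"
    unfolding D_def conv_def[of "dK v"] right_diff_distrib using iD dint by (simp add: dK_mass)
  have iDm: "integrable lborel (\<lambda>z. dK v z * (f (x - z) - m))"
    unfolding right_diff_distrib using iD dint by simp
  have V: "V = (LINT z|lborel. K z * (f (x - z) - m)\<^sup>2)" "integrable lborel (\<lambda>z. K z * (f (x - z) - m)\<^sup>2)"
    using conv_variance[OF f, of x] by (simp_all add: V_def m_def)
  have V0: "0 \<le> V" and W0: "0 \<le> W"
    using conv_square_le[OF f] information_nonneg by (simp_all add: V_def W_def)
  \<comment> \<open>Young's inequality with a free parameter; optimising it gives the Cauchy-Schwarz bound.\<close>
  have young: "2 * \<bar>D\<bar> \<le> l * V + W / l" if l: "l > 0" for l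
  proof -
    have pt: "2 * \<bar>dK v z * h\<bar> \<le> l * (K z * h\<^sup>2) + (C * (norm v)\<^sup>2 / l) * ?E z" for z h
    proof -
      let ?a = "sqrt (K z) * \<bar>h\<bar>" and ?b = "sqrt (C * (norm v)\<^sup>2 * ?E z)"
      have "\<bar>dK v z\<bar> \<le> sqrt (C * (norm v)\<^sup>2 * ?E z * K z)"
        using real_sqrt_le_mono[OF fisher[of v z]] by simp
      then have "\<bar>dK v z * h\<bar> \<le> ?b * ?a"
        by (simp add: abs_mult real_sqrt_mult mult.assoc[symmetric] mult_right_mono)
      moreover have "2 * (?b * ?a) \<le> l * ?a\<^sup>2 + ?b\<^sup>2 / l"
      proof -
        have "0 \<le> (l * ?a - ?b)\<^sup>2 / l" using l by simp
        also have "\<dots> = l * ?a\<^sup>2 + ?b\<^sup>2 / l - 2 * (?b * ?a)"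
          using l by (simp add: power2_eq_square field_simps)
        finally show ?thesis by simp
      qed
      moreover have "?a\<^sup>2 = K z * h\<^sup>2" "?b\<^sup>2 = C * (norm v)\<^sup>2 * ?E z"
        using nonneg[of z] C_nonneg by (simp_all add: power_mult_distrib)
      ultimately have "2 * \<bar>dK v z * h\<bar> \<le> l * (K z * h\<^sup>2) + (C * (norm v)\<^sup>2 * ?E z) / l"
        by (simp only:)
      then show ?thesis by simp
    qed
    have "2 * \<bar>D\<bar> \<le> (LINT z|lborel. 2 * \<bar>dK v z * (f (x - z) - m)\<bar>)"
      unfolding D by simp
    also have "\<dots> \<le> (LINT z|lborel. l * (K z * (f (x - z) - m)\<^sup>2) + (C * (norm v)\<^sup>2 / l) * ?E z)"
      using iDm V(2) integrable_gaussian[OF c, where 'a='a] by (intro integral_mono pt) auto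
    also have "\<dots> = l * V + W / l"
      using V integrable_gaussian[OF c, where 'a='a] integral_gaussian[OF c, where 'a='a]
      by (simp add: W_def information_def mult_ac)
    finally show ?thesis .
  qed
  have "D\<^sup>2 \<le> W * V"
  proof (cases "D = 0")
    case False
    show ?thesis
    proof (cases "V = 0")
      case True
      have "2 * \<bar>D\<bar> \<le> W / (W / \<bar>D\<bar> + 1)"
        using young[of "W / \<bar>D\<bar> + 1"] True W0 by (simp add: add_nonneg_pos)
      also have "\<dots> \<le> \<bar>D\<bar>"
        using W0 False by (simp add: divide_le_eq field_simps add_pos_nonneg)
      finally show ?thesis using False by simp
    next
      case VF: False
      then have "2 * \<bar>D\<bar> \<le> \<bar>D\<bar> + W / (\<bar>D\<bar> / V)"
        using young[of "\<bar>D\<bar> / V"] False V0 by simp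
      then have "\<bar>D\<bar> \<le> W * V / \<bar>D\<bar>" by simp
      then have "\<bar>D\<bar> * \<bar>D\<bar> \<le> W * V" using False by (simp add: le_divide_eq)
      then show ?thesis by (simp add: power2_eq_square)
    qed
  qed (use V0 W0 in simp)
  then show ?thesis by (simp add: D_def V_def W_def)
qed

text \<open>A discrete version of the Bakry-Emery argument. Along the iteration, the variance of \<open>f\<close> under the
  convolution power is the sum of the one-step variances of the intermediate functions, averaged over the
  remaining steps. By the preceding lemma each of these dominates a squared derivative, and by Jensen's
  inequality together with the commutation of all convolutions each of them dominates the same quantity, the
  squared derivative after all steps. This gives the factor \<open>Suc n\<close> on the left.\<close>

lemma dconv_power_square_le:
  assumes f: "bdd_borel B f"
  shows "real (Suc n) * (conv (dK v) ((conv K ^^ n) f) x)\<^sup>2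
    \<le> information * (norm v)\<^sup>2 * ((conv K ^^ Suc n) (\<lambda>y. (f y)\<^sup>2) x - ((conv K ^^ Suc n) f x)\<^sup>2)"
proof (induction n arbitrary: x)
  case 0
  then show ?case using dconv_square_le_variance[OF f, of v x] by simp
next
  case (Suc n)
  let ?T = "conv K ^^ Suc n" and ?w = "information * (norm v)\<^sup>2"
  define g where "g = conv (dK v) ((conv K ^^ n) f)"
  have f2: "bdd_borel (B * B) (\<lambda>y. (f y)\<^sup>2)"
    using bdd_borel_mult[OF f f] by (simp add: power2_eq_square)
  obtain B1 where g: "bdd_borel B1 g" using bdd_dconv[OF bdd_conv_power[OF f]] by (auto simp: g_def)
  have g2: "bdd_borel (B1 * B1) (\<lambda>y. (g y)\<^sup>2)"
    using bdd_borel_mult[OF g g] by (simp add: power2_eq_square)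
  have Tf: "bdd_borel B (?T f)" by (rule bdd_conv_power[OF f])
  have Tf2: "bdd_borel (B * B) (\<lambda>y. (?T f y)\<^sup>2)"
    using bdd_borel_mult[OF Tf Tf] by (simp add: power2_eq_square)
  have T2: "bdd_borel (B * B) (?T (\<lambda>y. (f y)\<^sup>2))" by (rule bdd_conv_power[OF f2])
  have "real (Suc n) * (conv (dK v) (?T f) x)\<^sup>2 = real (Suc n) * (conv K g x)\<^sup>2"
    using conv_commute[OF dint int bdd_conv_power[OF f]] by (simp add: g_def)
  also have "\<dots> \<le> real (Suc n) * conv K (\<lambda>y. (g y)\<^sup>2) x"
    using conv_square_le[OF g] by (intro mult_left_mono) auto
  also have "\<dots> = conv K (\<lambda>y. real (Suc n) * (g y)\<^sup>2) x"
    by (simp only: conv_cmult)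
  also have "\<dots> \<le> conv K (\<lambda>y. ?w * (?T (\<lambda>y. (f y)\<^sup>2) y - (?T f y)\<^sup>2)) x"
    by (rule conv_mono[OF int nonneg bdd_borel_cmult[OF g2] bdd_borel_cmult[OF bdd_borel_diff[OF T2 Tf2]]])
       (use Suc in \<open>simp add: g_def\<close>)
  also have "\<dots> = ?w * (conv K (?T (\<lambda>y. (f y)\<^sup>2)) x - conv K (\<lambda>y. (?T f y)\<^sup>2) x)"
    by (simp only: conv_cmult conv_diff[OF int T2 Tf2])
  finally have "real (Suc n) * (conv (dK v) (?T f) x)\<^sup>2 \<le> \<dots>" .
  moreover have "(conv (dK v) (?T f) x)\<^sup>2 \<le> ?w * (conv K (\<lambda>y. (?T f y)\<^sup>2) x - (conv K (?T f) x)\<^sup>2)"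
    by (rule dconv_square_le_variance[OF Tf])
  ultimately have "real (Suc n) * (conv (dK v) (?T f) x)\<^sup>2 + (conv (dK v) (?T f) x)\<^sup>2
     \<le> ?w * (conv K (?T (\<lambda>y. (f y)\<^sup>2)) x - (conv K (?T f) x)\<^sup>2)"
    by (simp only: right_diff_distrib)
  then show ?case by (simp add: algebra_simps)
qed

text \<open>Gradient estimate: \<open>n\<close> convolutions reduce derivatives of a bounded function by the factor
  \<open>n powr - (1 / 2)\<close>.\<close>

lemma bdd_dconv_power:
  assumes f: "bdd_borel B f"
  shows "bdd_borel (sqrt (information / real (Suc n)) * norm v * B) (conv (dK v) ((conv K ^^ n) f))"
proof (rule bdd_borelI)
  show "conv (dK v) ((conv K ^^ n) f) \<in> borel_measurable borel"
    using bdd_dconv[OF bdd_conv_power[OF f]] by (rule bdd_borel_meas)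
  fix x
  have f2: "bdd_borel (B * B) (\<lambda>y. (f y)\<^sup>2)"
    using bdd_borel_mult[OF f f] by (simp add: power2_eq_square)
  have "(conv K ^^ Suc n) (\<lambda>y. (f y)\<^sup>2) x - ((conv K ^^ Suc n) f x)\<^sup>2 \<le> B * B"
    using bdd_borel_le[OF bdd_conv_power[OF f2, of "Suc n"], of x]
    by (smt (verit) zero_le_power2)
  then have "information * (norm v)\<^sup>2 * ((conv K ^^ Suc n) (\<lambda>y. (f y)\<^sup>2) x - ((conv K ^^ Suc n) f x)\<^sup>2)
     \<le> information * (norm v)\<^sup>2 * (B * B)"
    using information_nonneg by (intro mult_left_mono) auto
  then have "real (Suc n) * (conv (dK v) ((conv K ^^ n) f) x)\<^sup>2 \<le> information * (norm v)\<^sup>2 * (B * B)"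
    using dconv_power_square_le[OF f, of n v x] by linarith
  then have "(conv (dK v) ((conv K ^^ n) f) x)\<^sup>2 \<le> information * (norm v)\<^sup>2 * (B * B) / real (Suc n)"
    by (simp add: le_divide_eq mult.commute)
  also have "\<dots> = (sqrt (information / real (Suc n)) * norm v * B)\<^sup>2"
    using information_nonneg by (simp add: power_mult_distrib) (simp add: power2_eq_square)
  finally show "\<bar>conv (dK v) ((conv K ^^ n) f) x\<bar> \<le> sqrt (information / real (Suc n)) * norm v * B"
    using information_nonneg bdd_borel_nonneg[OF f] by (intro power2_le_imp_le[of "\<bar>_\<bar>"]) auto
qed

end

section \<open>The Lindeberg comparison\<close>

context smooth_kernel
begin

lemma dconv_sum:
  assumes f: "bdd_borel B f" and "finite I"
  shows "conv (dK (\<Sum>i\<in>I. r i *\<^sub>R v i)) f x = (\<Sum>i\<in>I. r i * conv (dK (v i)) f x)"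
proof -
  have "conv (dK (\<Sum>i\<in>I. r i *\<^sub>R v i)) f x = (LINT z|lborel. (\<Sum>i\<in>I. r i * (dK (v i) z * f (x - z))))"
    unfolding conv_def dK_sum sum_distrib_right by (simp add: mult.assoc)
  also have "\<dots> = (\<Sum>i\<in>I. LINT z|lborel. r i * (dK (v i) z * f (x - z)))"
    using conv_integrable[OF dint f] by (intro Bochner_Integration.integral_sum) auto
  finally show ?thesis by (simp add: conv_def)
qed

lemma dconv_basis:
  assumes f: "bdd_borel B f"
  shows "conv (dK (- z)) f x = (\<Sum>b\<in>Basis. (z \<bullet> b) * (- conv (dK b) f x))"
proof -
  have "- z = (\<Sum>b\<in>Basis. (- (z \<bullet> b)) *\<^sub>R b)"
    using euclidean_representation[of z] by (simp add: sum_negf scaleR_left.minus)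
  then show ?thesis
    using dconv_sum[OF f finite_Basis, of "\<lambda>b. - (z \<bullet> b)" "\<lambda>b. b" x] by simp
qed

text \<open>Third order Taylor expansion after many convolutions. Three of the copies of \<open>K\<close> carry one derivative
  each, and the remaining \<open>3 * j\<close> copies are shared equally between the three derivatives, so that each of
  them is controlled by the gradient estimate.\<close>

lemma conv_power_taylor:
  fixes j :: nat
  assumes \<psi>: "bdd_borel B \<psi>"
  defines "F \<equiv> (conv K ^^ (3 * j + 3)) \<psi>"
  shows "\<exists>l q. \<forall>z. \<bar>F (x - z) - F x - (\<Sum>b\<in>Basis. (z \<bullet> b) * l b)
      - (\<Sum>b\<in>Basis. \<Sum>b'\<in>Basis. (z \<bullet> b) * (z \<bullet> b') * q b b')\<bar>
     \<le> (sqrt (information / real (Suc j))) ^ 3 * B * norm z ^ 3"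
proof -
  define g where "g = (conv K ^^ (3 * j)) \<psi>"
  let ?T = "conv K" and ?D = "\<lambda>v. conv (dK v)"
  have F: "F = ?T (?T (?T g))" by (simp add: F_def g_def numeral_3_eq_3)
  have g: "bdd_borel B g" unfolding g_def by (rule bdd_conv_power[OF \<psi>])
  have comm: "?D v (?T f) = ?T (?D v f)" if "bdd_borel B' f" for v f B'
    using conv_commute[OF dint int that] by blast
  define l where "l b = - ?D b (?T (?T g)) x" for b
  define q where "q b b' = ?D b' (?D b (?T g)) x / 2" for b b'
  have D1: "?D (- z) (?T (?T g)) x = (\<Sum>b\<in>Basis. (z \<bullet> b) * l b)" for z
    unfolding l_def by (rule dconv_basis[OF bdd_conv[OF bdd_conv[OF g]]])
  have D2: "?D (- z) (?D (- z) (?T g)) x / 2 = (\<Sum>b\<in>Basis. \<Sum>b'\<in>Basis. (z \<bullet> b) * (z \<bullet> b') * q b b')" for z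
  proof -
    have "?D (- z) (?D (- z) (?T g)) x = (\<Sum>b'\<in>Basis. (z \<bullet> b') * (- ?D b' (?D (- z) (?T g)) x))"
      by (rule dconv_basis[OF bdd_dconv[OF bdd_conv[OF g]]])
    also have "\<dots> = (\<Sum>b'\<in>Basis. (z \<bullet> b') * (- ?D (- z) (?D b' (?T g)) x))"
      using conv_commute[OF dint dint bdd_conv[OF g]] by simp
    also have "\<dots> = (\<Sum>b'\<in>Basis. (z \<bullet> b') * (- (\<Sum>b\<in>Basis. (z \<bullet> b) * (- ?D b (?D b' (?T g)) x))))"
      by (simp only: dconv_basis[OF bdd_dconv[OF bdd_conv[OF g]], where z=z])
    also have "\<dots> = (\<Sum>b'\<in>Basis. \<Sum>b\<in>Basis. (z \<bullet> b') * (z \<bullet> b) * (2 * q b' b))"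
      by (simp add: q_def sum_negf sum_distrib_left mult.assoc)
    finally show ?thesis by (simp add: sum_divide_distrib mult.assoc)
  qed
  show ?thesis
  proof (intro exI allI)
    fix z :: 'a
    let ?v = "- z"
    let ?\<rho> = "sqrt (information / real (Suc j)) * norm z"
    define diff where "diff m s = (if m = 0 then F (x + s *\<^sub>R ?v) else if m = 1 then ?D ?v (?T (?T g)) (x + s *\<^sub>R ?v)
       else if m = 2 then ?D ?v (?D ?v (?T g)) (x + s *\<^sub>R ?v) else ?D ?v (?D ?v (?D ?v g)) (x + s *\<^sub>R ?v))" for m :: nat and s :: real
    have "\<exists>t. 0 < t \<and> t \<le> 1 \<and> diff 0 1 = (\<Sum>m<3. diff m 0 / fact m * 1 ^ m) + diff 3 t / fact 3 * 1 ^ 3"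
    proof (rule Maclaurin2)
      show "\<forall>m t. m < 3 \<and> 0 \<le> t \<and> t \<le> 1 \<longrightarrow> (diff m has_real_derivative diff (Suc m) t) (at t)"
      proof (intro allI impI)
        fix m :: nat and t :: real assume "m < 3 \<and> 0 \<le> t \<and> t \<le> 1"
        then consider "m = 0" | "m = 1" | "m = 2" by linarith
        then show "(diff m has_real_derivative diff (Suc m) t) (at t)"
        proof cases
          case 1
          then show ?thesis
            using conv_has_derivative[OF bdd_conv[OF bdd_conv[OF g]], where x=x and v="?v" and s=t] by (simp add: diff_def[abs_def] F)
        next
          case 2
          have "?D ?v (?T (?T g)) = ?T (?D ?v (?T g))" by (rule comm[OF bdd_conv[OF g]])
          then show ?thesis
            using conv_has_derivative[OF bdd_dconv[OF bdd_conv[OF g]], where x=x and v="?v" and s=t] 2 by (simp add: diff_def[abs_def])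
        next
          case 3
          have "?D ?v (?D ?v (?T g)) = ?T (?D ?v (?D ?v g))"
            by (simp only: comm[OF g] comm[OF bdd_dconv[OF g]])
          then show ?thesis
            using conv_has_derivative[OF bdd_dconv[OF bdd_dconv[OF g]], where x=x and v="?v" and s=t] 3 by (simp add: diff_def[abs_def])
        qed
      qed
    qed auto
    then obtain t where t: "diff 0 1 = (\<Sum>m<3. diff m 0 / fact m) + diff 3 t / 6"
      by (auto simp: numeral_3_eq_3)
    have bound: "\<bar>diff 3 t\<bar> \<le> ?\<rho> * (?\<rho> * (?\<rho> * B))"
    proof -
      let ?R = "conv K ^^ j"
      have comR: "?D ?v (?R f) = ?R (?D ?v f)" if "bdd_borel B' f" for f B'
        using conv_power_commute[OF int nonneg mass dint that] by simp
      have "3 * j = j + (j + j)" by simp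
      then have "g = ?R (?R (?R \<psi>))" by (simp only: g_def funpow_add comp_apply)
      then have "?D ?v g = ?R (?R (?D ?v (?R \<psi>)))"
        by (simp only: comR[OF bdd_conv_power[OF bdd_conv_power[OF \<psi>]]] comR[OF bdd_conv_power[OF \<psi>]])
      then have "?D ?v (?D ?v (?D ?v g)) = ?D ?v (?R (?D ?v (?R (?D ?v (?R \<psi>)))))"
        by (simp only: comR[OF bdd_conv_power[OF bdd_dconv[OF bdd_conv_power[OF \<psi>]]]])
      moreover have "bdd_borel (?\<rho> * (?\<rho> * (?\<rho> * B))) (?D ?v (?R (?D ?v (?R (?D ?v (?R \<psi>))))))"
        using bdd_dconv_power[OF bdd_dconv_power[OF bdd_dconv_power[OF \<psi>]], of j ?v j ?v j ?v] by simp
      ultimately show ?thesis by (simp add: diff_def bdd_borel_def)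
    qed
    have "F (x - z) - F x - (\<Sum>b\<in>Basis. (z \<bullet> b) * l b)
      - (\<Sum>b\<in>Basis. \<Sum>b'\<in>Basis. (z \<bullet> b) * (z \<bullet> b') * q b b') = diff 3 t / 6"
      using t unfolding D1[symmetric] D2[symmetric] by (simp add: diff_def numeral_3_eq_3)
    then have "\<bar>F (x - z) - F x - (\<Sum>b\<in>Basis. (z \<bullet> b) * l b)
      - (\<Sum>b\<in>Basis. \<Sum>b'\<in>Basis. (z \<bullet> b) * (z \<bullet> b') * q b b')\<bar> \<le> \<bar>diff 3 t\<bar>" by simp
    also have "\<dots> \<le> (sqrt (information / real (Suc j))) ^ 3 * B * norm z ^ 3"
      using bound by (simp add: power3_eq_cube mult_ac)
    finally show "\<bar>F (x - z) - F x - (\<Sum>b\<in>Basis. (z \<bullet> b) * l b)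
      - (\<Sum>b\<in>Basis. \<Sum>b'\<in>Basis. (z \<bullet> b) * (z \<bullet> b') * q b b')\<bar>
     \<le> (sqrt (information / real (Suc j))) ^ 3 * B * norm z ^ 3" .
  qed
qed

text \<open>Integrated against a kernel whose moments up to order two vanish, the Taylor polynomial disappears and
  only the remainder survives.\<close>

lemma conv_vanishing_moments_le:
  fixes H :: "'a \<Rightarrow> real"
  assumes \<psi>: "bdd_borel B \<psi>"
    and [measurable]: "H \<in> borel_measurable borel"
    and H: "0 < a" "\<And>z. \<bar>H z\<bar> \<le> A * exp (- a * (norm z)\<^sup>2)"
    and m0: "(LINT z|lborel. H z) = 0"
    and m1: "\<And>b. b \<in> Basis \<Longrightarrow> (LINT z|lborel. H z * (z \<bullet> b)) = 0"
    and m2: "\<And>b b'. b \<in> Basis \<Longrightarrow> b' \<in> Basis \<Longrightarrow> (LINT z|lborel. H z * ((z \<bullet> b) * (z \<bullet> b'))) = 0"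
  shows "\<bar>conv H ((conv K ^^ (3 * j + 3)) \<psi>) x\<bar>
     \<le> (sqrt (information / real (Suc j))) ^ 3 * B * (LINT z|lborel. \<bar>H z\<bar> * norm z ^ 3)"
proof -
  define F where "F = (conv K ^^ (3 * j + 3)) \<psi>"
  have F: "bdd_borel B F" unfolding F_def by (rule bdd_conv_power[OF \<psi>])
  obtain l q where lq: "\<And>z. \<bar>F (x - z) - F x - (\<Sum>b\<in>Basis. (z \<bullet> b) * l b)
      - (\<Sum>b\<in>Basis. \<Sum>b'\<in>Basis. (z \<bullet> b) * (z \<bullet> b') * q b b')\<bar>
     \<le> (sqrt (information / real (Suc j))) ^ 3 * B * norm z ^ 3"
    using conv_power_taylor[OF \<psi>, of j x] unfolding F_def by blast
  let ?P = "\<lambda>z. F x + (\<Sum>b\<in>Basis. (z \<bullet> b) * l b) + (\<Sum>b\<in>Basis. \<Sum>b'\<in>Basis. (z \<bullet> b) * (z \<bullet> b') * q b b')"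
  let ?S = "(sqrt (information / real (Suc j))) ^ 3 * B"
  have A0: "0 \<le> A" using H(2)[of 0] by simp
  have i0: "integrable lborel H"
    by (rule integrable_power_gaussian_decay[OF H(1), where C=A and k=0]) (use H in auto)
  have i1: "integrable lborel (\<lambda>z. H z * (z \<bullet> b))" if "b \<in> Basis" for b
  proof (rule integrable_power_gaussian_decay[OF H(1), where C=A and k=1])
    fix z
    show "\<bar>H z * (z \<bullet> b)\<bar> \<le> A * norm z ^ 1 * exp (- a * (norm z)\<^sup>2)"
      using mult_mono[OF H(2)[of z] Basis_le_norm[OF that, of z]] A0 by (simp add: abs_mult mult_ac)
  qed measurable
  have i2: "integrable lborel (\<lambda>z. H z * ((z \<bullet> b) * (z \<bullet> b')))" if "b \<in> Basis" "b' \<in> Basis" for b b'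
  proof (rule integrable_power_gaussian_decay[OF H(1), where C=A and k=2])
    fix z
    have "\<bar>z \<bullet> b\<bar> * \<bar>z \<bullet> b'\<bar> \<le> norm z * norm z"
      by (intro mult_mono Basis_le_norm that) auto
    then show "\<bar>H z * ((z \<bullet> b) * (z \<bullet> b'))\<bar> \<le> A * norm z ^ 2 * exp (- a * (norm z)\<^sup>2)"
      using mult_mono[OF H(2)[of z], of "\<bar>z \<bullet> b\<bar> * \<bar>z \<bullet> b'\<bar>" "norm z * norm z"] A0
      by (simp add: abs_mult power2_eq_square mult_ac)
  qed measurable
  have i3: "integrable lborel (\<lambda>z. \<bar>H z\<bar> * norm z ^ 3)"
  proof (rule integrable_power_gaussian_decay[OF H(1), where C=A and k=3])
    fix z
    show "\<bar>\<bar>H z\<bar> * norm z ^ 3\<bar> \<le> A * norm z ^ 3 * exp (- a * (norm z)\<^sup>2)"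
      using mult_right_mono[OF H(2)[of z], of "norm z ^ 3"] by (simp add: abs_mult mult_ac)
  qed measurable
  have HP: "H z * ?P z = F x * H z + (\<Sum>b\<in>Basis. l b * (H z * (z \<bullet> b)))
      + (\<Sum>b\<in>Basis. \<Sum>b'\<in>Basis. q b b' * (H z * ((z \<bullet> b) * (z \<bullet> b'))))" for z
    by (simp add: distrib_left sum_distrib_left mult_ac)
  have iP: "integrable lborel (\<lambda>z. H z * ?P z)" 
    unfolding HP by (intro Bochner_Integration.integrable_add Bochner_Integration.integrable_sum integrable_mult_right i0 i1 i2)
  have P0: "(LINT z|lborel. H z * ?P z) = 0"
    unfolding HP using i0 i1 i2 m0 m1 m2
    by (simp add: Bochner_Integration.integral_sum)
  have iF: "integrable lborel (\<lambda>z. H z * F (x - z))" by (rule conv_integrable[OF i0 F])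
  have "conv H F x = (LINT z|lborel. H z * F (x - z) - H z * ?P z)"
    unfolding conv_def using iF iP P0 by (simp only: Bochner_Integration.integral_diff)
  then have "\<bar>conv H F x\<bar> \<le> (LINT z|lborel. \<bar>H z * F (x - z) - H z * ?P z\<bar>)"
    by (simp only: integral_abs_bound)
  also have "\<dots> \<le> (LINT z|lborel. ?S * (\<bar>H z\<bar> * norm z ^ 3))"
  proof (rule integral_mono)
    fix z
    have "\<bar>H z * F (x - z) - H z * ?P z\<bar> = \<bar>H z\<bar> * \<bar>F (x - z) - ?P z\<bar>"
      by (simp only: right_diff_distrib[symmetric] abs_mult)
    also have "\<dots> \<le> \<bar>H z\<bar> * (?S * norm z ^ 3)"
      using lq[of z] by (intro mult_left_mono) (auto simp: algebra_simps)
    finally show "\<bar>H z * F (x - z) - H z * ?P z\<bar> \<le> ?S * (\<bar>H z\<bar> * norm z ^ 3)" by (simp add: mult_ac)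
  qed (use iF iP i3 in auto)
  finally show ?thesis by (simp add: F_def)
qed

end

text \<open>Two kernels with the same first and second moments: the setting of Lindeberg's replacement argument.\<close>

locale matched_kernels = J: smooth_kernel J dJ CJ cJ + G: smooth_kernel G dG CG cG
  for J G :: "'a::euclidean_space \<Rightarrow> real" and dJ dG CJ cJ CG cG +
  assumes match1: "b \<in> Basis \<Longrightarrow> (LINT z|lborel. (J z - G z) * (z \<bullet> b)) = 0"
    and match2: "b \<in> Basis \<Longrightarrow> b' \<in> Basis \<Longrightarrow> (LINT z|lborel. (J z - G z) * ((z \<bullet> b) * (z \<bullet> b'))) = 0"
begin

definition third_moment :: real where
  "third_moment = (LINT z|lborel. \<bar>J z - G z\<bar> * norm z ^ 3)"

lemma third_moment_nonneg: "0 \<le> third_moment"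
  unfolding third_moment_def by (rule Bochner_Integration.integral_nonneg) simp

lemma difference_decay:
  "\<bar>J z - G z\<bar> \<le> (CJ + CG) * exp (- min cJ cG * (norm z)\<^sup>2)"
proof -
  have "J z \<le> CJ * exp (- min cJ cG * (norm z)\<^sup>2)"
    by (rule order_trans[OF J.decay mult_left_mono]) (use J.C_nonneg in \<open>auto intro!: mult_right_mono\<close>)
  moreover have "G z \<le> CG * exp (- min cJ cG * (norm z)\<^sup>2)"
    by (rule order_trans[OF G.decay mult_left_mono]) (use G.C_nonneg in \<open>auto intro!: mult_right_mono\<close>)
  ultimately show ?thesis
    using J.nonneg[of z] G.nonneg[of z] by (simp add: distrib_right abs_le_iff)
qed

text \<open>The factor 20 only serves to compare the number of available convolutions with \<open>n\<close> in the
  application below.\<close>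

lemma difference_conv_le:
  assumes "smooth_kernel K dK C c" and \<psi>: "bdd_borel B \<psi>"
    and I: "smooth_kernel.information TYPE('a) C c \<le> I" and n: "0 < n" "n \<le> 20 * Suc j"
  shows "\<bar>conv (\<lambda>z. J z - G z) ((conv K ^^ (3 * j + 3)) \<psi>) x\<bar> \<le> (sqrt (20 * I / real n)) ^ 3 * B * third_moment"
proof -
  interpret K: smooth_kernel K dK C c by fact
  have "\<bar>conv (\<lambda>z. J z - G z) ((conv K ^^ (3 * j + 3)) \<psi>) x\<bar> \<le> (sqrt (K.information / real (Suc j))) ^ 3 * B * third_moment"
    unfolding third_moment_def
  proof (rule K.conv_vanishing_moments_le[OF \<psi> _ _ difference_decay])
    show "0 < min cJ cG" using J.c G.c by simp
    show "(LINT z|lborel. J z - G z) = 0" using J.int G.int J.mass G.mass by simp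
  qed (use match1 match2 in auto)
  also have "\<dots> \<le> (sqrt (20 * I / real n)) ^ 3 * B * third_moment"
  proof (intro mult_right_mono power_mono real_sqrt_le_mono)
    have "K.information / real (Suc j) \<le> I / real (Suc j)" using I by (simp add: divide_right_mono)
    also have "\<dots> = 20 * I / (20 * real (Suc j))"
      by (rule mult_divide_mult_cancel_left[symmetric]) simp
    also have "\<dots> \<le> 20 * I / real n"
    proof (rule divide_left_mono)
      show "real n \<le> 20 * real (Suc j)" using of_nat_mono[OF n(2)] by simp
    qed (use n I K.information_nonneg in auto)
    finally show "K.information / real (Suc j) \<le> 20 * I / real n" .
  qed (use bdd_borel_nonneg[OF \<psi>] third_moment_nonneg K.information_nonneg in auto)
  finally show ?thesis .
qed

text \<open>Lindeberg's replacement: the factors of the power are exchanged one at a time.\<close>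

lemma power_difference_telescope:
  assumes \<psi>: "bdd_borel B \<psi>"
  shows "(conv J ^^ n) \<psi> x - (conv G ^^ n) \<psi> x
     = (\<Sum>k<n. conv (\<lambda>z. J z - G z) ((conv J ^^ k) ((conv G ^^ (n - 1 - k)) \<psi>)) x)"
proof -
  have step: "conv (\<lambda>z. J z - G z) f x = conv J f x - conv G f x" if "bdd_borel B f" for f x
    unfolding conv_def left_diff_distrib
    using conv_integrable[OF J.int that] conv_integrable[OF G.int that] by simp
  define a where "a k = (conv J ^^ k) ((conv G ^^ (n - k)) \<psi>) x" for k
  have "conv (\<lambda>z. J z - G z) ((conv J ^^ k) ((conv G ^^ (n - 1 - k)) \<psi>)) x = a (Suc k) - a k" if "k < n" for k
  proof -
    let ?h = "(conv G ^^ (n - 1 - k)) \<psi>"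
    have h: "bdd_borel B ?h" by (rule G.bdd_conv_power[OF \<psi>])
    have "n - k = Suc (n - 1 - k)" using that by simp
    then have "(conv G ^^ (n - k)) \<psi> = conv G ?h" by simp
    then have "a k = conv G ((conv J ^^ k) ?h) x"
      unfolding a_def using conv_power_commute[OF J.int J.nonneg J.mass G.int h] by simp
    moreover have "a (Suc k) = conv J ((conv J ^^ k) ?h) x" by (simp add: a_def)
    ultimately show ?thesis using step[OF J.bdd_conv_power[OF h]] by simp
  qed
  then have "(\<Sum>k<n. conv (\<lambda>z. J z - G z) ((conv J ^^ k) ((conv G ^^ (n - 1 - k)) \<psi>)) x) = (\<Sum>k<n. a (Suc k) - a k)"
    by simp
  also have "\<dots> = a n - a 0" by (rule sum_lessThan_telescope)
  finally show ?thesis by (simp add: a_def)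
qed

text \<open>Each of the \<open>n\<close> terms of the telescoping sum is a convolution with the difference of the kernels of a
  function that was smoothed at least \<open>(n - 1) / 2\<close> times by one of the two kernels. It is therefore
  of order \<open>n powr - (3 / 2)\<close>. This is a Berry-Esseen theorem in total variation.\<close>

theorem power_difference_le:
  "\<exists>C\<ge>0. \<forall>n\<ge>1. \<forall>B \<psi> x. bdd_borel B \<psi> \<longrightarrow>
     \<bar>(conv J ^^ n) \<psi> x - (conv G ^^ n) \<psi> x\<bar> \<le> C / sqrt (real n) * B"
proof -
  define I where "I = max J.information G.information"
  have I0: "0 \<le> I" using J.information_nonneg by (simp add: I_def)
  \<comment> \<open>The summand 6 covers the small powers: there the trivial bound 2 is below 6 / sqrt n.\<close>
  define C where "C = 6 + (sqrt (20 * I)) ^ 3 * third_moment"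
  have C6: "C \<ge> 6" using I0 third_moment_nonneg by (simp add: C_def)
  show ?thesis
  proof (intro exI[of _ C] conjI allI impI)
    fix n :: nat and B and \<psi> :: "'a \<Rightarrow> real" and x assume n: "1 \<le> n" and \<psi>: "bdd_borel B \<psi>"
    have B: "0 \<le> B" by (rule bdd_borel_nonneg[OF \<psi>])
    show "\<bar>(conv J ^^ n) \<psi> x - (conv G ^^ n) \<psi> x\<bar> \<le> C / sqrt (real n) * B"
    proof (cases "n < 7")
      case True
      have "\<bar>(conv J ^^ n) \<psi> x - (conv G ^^ n) \<psi> x\<bar> \<le> 2 * B"
        using bdd_borel_le[OF J.bdd_conv_power[OF \<psi>], of n x] bdd_borel_le[OF G.bdd_conv_power[OF \<psi>], of n x] by linarith
      also have "2 \<le> C / sqrt (real n)"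
      proof -
        have "sqrt (real n) \<le> sqrt 9" using True by (intro real_sqrt_le_mono) auto
        then have "2 * sqrt (real n) \<le> C" using C6 by simp
        then show ?thesis using n by (simp add: le_divide_eq)
      qed
      then have "2 * B \<le> C / sqrt (real n) * B" using B by (rule mult_right_mono)
      finally show ?thesis .
    next
      case False
      let ?H = "conv (\<lambda>z. J z - G z)" and ?e = "(sqrt (20 * I / real n)) ^ 3 * B * third_moment"
      \<comment> \<open>The kernel that occurs at least (n - 1) / 2 times does the smoothing; for n at least 7, a third of that is at least n / 20.\<close>
      have summand: "\<bar>?H ((conv J ^^ k) ((conv G ^^ (n - 1 - k)) \<psi>)) x\<bar> \<le> ?e" if k: "k < n" for k
      proof (cases "2 * k + 1 \<ge> n")
        case big: True
        define j where "j = k div 3 - 1"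
        define r where "r = k mod 3"
        have "3 \<le> k" using big False by linarith
        then have "1 \<le> k div 3" using div_le_mono[of 3 k 3] by simp
        then have 1: "k div 3 = Suc j" by (simp add: j_def)
        have k': "k = 3 * j + 3 + r"
          using mult_div_mod_eq[of 3 k] unfolding 1 r_def[symmetric] by simp
        have "r < 3" by (simp add: r_def)
        then have "n \<le> 20 * j + 20" using big k' by linarith
        then have 2: "n \<le> 20 * Suc j" by simp
        have "(conv J ^^ k) ((conv G ^^ (n - 1 - k)) \<psi>) = (conv J ^^ (3 * j + 3)) ((conv J ^^ r) ((conv G ^^ (n - 1 - k)) \<psi>))"
          unfolding k' by (simp only: funpow_add comp_apply)
        then show ?thesis
          using difference_conv_le[OF J.smooth_kernel_axioms J.bdd_conv_power[OF G.bdd_conv_power[OF \<psi>]] _ _ 2, of I r "n - 1 - k" x] n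
          by (simp add: I_def)
      next
        case small: False
        define m where "m = n - 1 - k"
        define j where "j = m div 3 - 1"
        define r where "r = m mod 3"
        have mn: "2 * m + 1 \<ge> n" using small k by (simp add: m_def)
        have "3 \<le> m" using mn False by linarith
        then have "1 \<le> m div 3" using div_le_mono[of 3 m 3] by simp
        then have 1: "m div 3 = Suc j" by (simp add: j_def)
        have m': "m = 3 * j + 3 + r"
          using mult_div_mod_eq[of 3 m] unfolding 1 r_def[symmetric] by simp
        have "r < 3" by (simp add: r_def)
        then have "n \<le> 20 * j + 20" using mn m' by linarith
        then have 2: "n \<le> 20 * Suc j" by simp
        let ?f = "(conv G ^^ r) ((conv J ^^ k) \<psi>)"
        have swap: "(conv J ^^ k) ((conv G ^^ i) \<psi>) = (conv G ^^ i) ((conv J ^^ k) \<psi>)" for i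
        proof (induction i)
          case (Suc i)
          then show ?case
            using conv_power_commute[OF J.int J.nonneg J.mass G.int G.bdd_conv_power[OF \<psi>], of k i] by simp
        qed simp
        have "(conv J ^^ k) ((conv G ^^ m) \<psi>) = (conv G ^^ (3 * j + 3)) ?f"
          unfolding swap unfolding m' by (simp only: funpow_add comp_apply)
        then show ?thesis
          using difference_conv_le[OF G.smooth_kernel_axioms G.bdd_conv_power[OF J.bdd_conv_power[OF \<psi>]] _ _ 2, of I r k x] n
          by (simp add: I_def m_def)
      qed
      have "\<bar>(conv J ^^ n) \<psi> x - (conv G ^^ n) \<psi> x\<bar> \<le> (\<Sum>k<n. \<bar>?H ((conv J ^^ k) ((conv G ^^ (n - 1 - k)) \<psi>)) x\<bar>)"
        unfolding power_difference_telescope[OF \<psi>] by (rule sum_abs)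
      also have "\<dots> \<le> real n * ?e"
        using sum_bounded_above[of "{..<n}" "\<lambda>k. \<bar>?H ((conv J ^^ k) ((conv G ^^ (n - 1 - k)) \<psi>)) x\<bar>" ?e] summand by simp
      also have "\<dots> = (sqrt (20 * I)) ^ 3 * third_moment / sqrt (real n) * B"
      proof -
        have "(sqrt (20 * I / real n)) ^ 3 = (sqrt (20 * I)) ^ 3 / (real n * sqrt (real n))"
          by (simp only: real_sqrt_divide power_divide) (simp add: power3_eq_cube)
        then show ?thesis using n by simp
      qed
      also have "\<dots> \<le> C / sqrt (real n) * B"
        using B by (intro mult_right_mono divide_right_mono) (auto simp: C_def)
      finally show ?thesis .
    qed
  qed (use C6 in auto)
qed

end

section \<open>The Gaussian kernels\<close>

text \<open>The heat kernel of diffusivity \<open>a\<close> at time \<open>t\<close> is \<open>gauss (1 / (4 * a * t))\<close>. The inverse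
  width is the convenient parameter for completing the square.\<close>

definition gauss :: "real \<Rightarrow> 'a::euclidean_space \<Rightarrow> real" where
  "gauss p x = (p / pi) powr (DIM('a) / 2) * exp (- p * (norm x)\<^sup>2)"

lemma gauss_nonneg [simp]: "0 \<le> gauss p x"
  by (simp add: gauss_def)

lemma gauss_measurable [measurable]: "gauss p \<in> borel_measurable borel"
  unfolding gauss_def[abs_def] by measurable

lemma gauss_le: "0 < p \<Longrightarrow> gauss p (x::'a::euclidean_space) \<le> (p / pi) powr (DIM('a) / 2)"
  by (simp add: gauss_def mult_left_le)

lemma gauss_integrable: "0 < p \<Longrightarrow> integrable lborel (gauss p :: 'a::euclidean_space \<Rightarrow> real)"
  unfolding gauss_def[abs_def] using integrable_gaussian by auto

lemma gauss_integral:
  assumes "0 < p" shows "(LINT x|lborel. gauss p (x::'a::euclidean_space)) = 1"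
proof -
  have "(p / pi) powr (DIM('a) / 2) * (pi / p) powr (DIM('a) / 2) = 1"
    using assms by (simp add: powr_mult[symmetric])
  then show ?thesis
    unfolding gauss_def using integral_gaussian[OF assms, where 'a='a] by simp
qed

text \<open>The derivative brings a factor \<open>z\<close>, whose square is absorbed by halving the exponent.\<close>

lemma gauss_smooth_kernel:
  assumes p: "0 < p"
  shows "\<exists>C. smooth_kernel (gauss p :: 'a::euclidean_space \<Rightarrow> real) (\<lambda>v z. - 2 * p * (z \<bullet> v) * gauss p z) C (p / 2)"
proof -
  define k where "k = (p / pi) powr (DIM('a) / 2)"
  have k: "k > 0" using p by (simp add: k_def)
  obtain M where M: "M > 0" "\<And>r. r \<ge> 0 \<Longrightarrow> r ^ 2 * exp (- p * r\<^sup>2) \<le> M * exp (- (p / 2) * r\<^sup>2)"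
    using power_gaussian_bound[OF p, of 2] by blast
  have gk: "gauss p z = k * exp (- p * (norm z)\<^sup>2)" for z :: 'a by (simp add: gauss_def k_def)
  define C where "C = k + 4 * p\<^sup>2 * M * k"
  show ?thesis
  proof (intro exI[of _ C], unfold_locales)
    fix z v :: 'a
    show "0 \<le> gauss p z" by simp
    show "(gauss p has_derivative (\<lambda>v. - 2 * p * (z \<bullet> v) * gauss p z)) (at z)"
      unfolding gauss_def[abs_def] power2_norm_eq_inner
      by (auto intro!: derivative_eq_intros simp: inner_commute algebra_simps)
    show "(\<lambda>z. - 2 * p * (z \<bullet> v) * gauss p z) \<in> borel_measurable borel" by measurable
    show "(LINT z|lborel. gauss p (z::'a)) = 1" by (rule gauss_integral[OF p])
    show "0 < p / 2" using p by simp
    have "exp (- p * (norm z)\<^sup>2) \<le> exp (- (p / 2) * (norm z)\<^sup>2)" using p by (simp add: mult_right_mono)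
    then have "k * exp (- p * (norm z)\<^sup>2) \<le> C * exp (- (p / 2) * (norm z)\<^sup>2)"
      using k M p by (intro mult_mono) (auto simp: C_def)
    then show "gauss p z \<le> C * exp (- (p / 2) * (norm z)\<^sup>2)" by (simp add: gk)
    have "(z \<bullet> v)\<^sup>2 \<le> (norm z)\<^sup>2 * (norm v)\<^sup>2"
      using power_mono[OF Cauchy_Schwarz_ineq2[of z v], of 2] by (simp add: power_mult_distrib)
    then have "(z \<bullet> v)\<^sup>2 * exp (- p * (norm z)\<^sup>2) \<le> (norm v)\<^sup>2 * ((norm z)\<^sup>2 * exp (- p * (norm z)\<^sup>2))"
      by (simp add: mult.assoc[symmetric] mult.commute[of "(norm v)\<^sup>2"] mult_right_mono)
    also have "\<dots> \<le> (norm v)\<^sup>2 * (M * exp (- (p / 2) * (norm z)\<^sup>2))"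
      by (intro mult_left_mono M(2)) auto
    finally have 1: "(z \<bullet> v)\<^sup>2 * exp (- p * (norm z)\<^sup>2) \<le> (norm v)\<^sup>2 * (M * exp (- (p / 2) * (norm z)\<^sup>2))" .
    have "(- 2 * p * (z \<bullet> v) * gauss p z)\<^sup>2 = (4 * p\<^sup>2 * k) * gauss p z * ((z \<bullet> v)\<^sup>2 * exp (- p * (norm z)\<^sup>2))"
      unfolding gk by (simp add: power2_eq_square)
    also have "\<dots> \<le> (4 * p\<^sup>2 * k) * gauss p z * ((norm v)\<^sup>2 * (M * exp (- (p / 2) * (norm z)\<^sup>2)))"
      using 1 k by (intro mult_left_mono) auto
    also have "\<dots> = (4 * p\<^sup>2 * M * k) * ((norm v)\<^sup>2 * exp (- (p / 2) * (norm z)\<^sup>2) * gauss p z)"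
      by simp
    also have "\<dots> \<le> C * ((norm v)\<^sup>2 * exp (- (p / 2) * (norm z)\<^sup>2) * gauss p z)"
      using k by (intro mult_right_mono) (auto simp: C_def)
    finally show "(- 2 * p * (z \<bullet> v) * gauss p z)\<^sup>2 \<le> C * (norm v)\<^sup>2 * exp (- (p / 2) * (norm z)\<^sup>2) * gauss p z"
      by (simp add: mult.assoc)
  qed
qed

text \<open>Completing the square. For the inverse widths of heat kernels the new parameter is the one of the sum of
  the two times.\<close>

lemma gauss_conv_gauss:
  assumes p: "0 < p" and q: "0 < q"
  shows "conv (gauss p) (gauss q) (x::'a::euclidean_space) = gauss (p * q / (p + q)) x"
proof -
  let ?d = "DIM('a) / 2"
  define y where "y = (q / (p + q)) *\<^sub>R x"
  define r where "r = p * q / (p + q)"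
  have sq: "p * (norm z)\<^sup>2 + q * (norm (x - z))\<^sup>2 = r * (norm x)\<^sup>2 + (p + q) * (norm (- y + z))\<^sup>2" for z
  proof -
    have pq: "p + q \<noteq> 0" using p q by simp
    have "(norm (x - z))\<^sup>2 = x \<bullet> x - 2 * (x \<bullet> z) + z \<bullet> z"
      by (simp add: power2_norm_eq_inner inner_simps inner_commute)
    moreover have "(norm (- y + z))\<^sup>2 = (q / (p + q))\<^sup>2 * (x \<bullet> x) - 2 * (q / (p + q)) * (x \<bullet> z) + z \<bullet> z"
    proof -
      have "(norm (- y + z))\<^sup>2 = y \<bullet> y - 2 * (y \<bullet> z) + z \<bullet> z"
        by (simp add: power2_norm_eq_inner inner_simps inner_commute)
      then show ?thesis by (simp add: y_def power2_eq_square)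
    qed
    moreover have "(p + q) * ((q / (p + q))\<^sup>2 * (x \<bullet> x)) = q * q / (p + q) * (x \<bullet> x)"
      "(p + q) * (2 * (q / (p + q)) * (x \<bullet> z)) = 2 * q * (x \<bullet> z)"
      using pq by (simp_all add: power2_eq_square)
    moreover have "r * (x \<bullet> x) + q * q / (p + q) * (x \<bullet> x) = q * (x \<bullet> x)"
    proof -
      have "r + q * q / (p + q) = (p + q) * q / (p + q)"
        by (simp only: r_def add_divide_distrib[symmetric] distrib_right)
      then have "r + q * q / (p + q) = q" using pq by simp
      then show ?thesis by (simp only: distrib_right[symmetric])
    qed
    ultimately have h: "(norm (x - z))\<^sup>2 = x \<bullet> x - 2 * (x \<bullet> z) + z \<bullet> z"
      "(p + q) * (norm (- y + z))\<^sup>2 = q * q / (p + q) * (x \<bullet> x) - 2 * q * (x \<bullet> z) + (p + q) * (z \<bullet> z)"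
      "r * (x \<bullet> x) + q * q / (p + q) * (x \<bullet> x) = q * (x \<bullet> x)"
      by (simp_all only: right_diff_distrib distrib_left)
    have "p * (z \<bullet> z) + q * (x \<bullet> x - 2 * (x \<bullet> z) + z \<bullet> z) = q * (x \<bullet> x) - 2 * q * (x \<bullet> z) + (p + q) * (z \<bullet> z)"
      by (simp add: algebra_simps)
    then show ?thesis
      unfolding h(1,2) power2_norm_eq_inner[of x] power2_norm_eq_inner[of z] h(3)[symmetric] by linarith
  qed
  have "conv (gauss p) (gauss q) x = (p / pi) powr ?d * (q / pi) powr ?d * exp (- r * (norm x)\<^sup>2)
      * (LINT z|lborel. exp (- (p + q) * (norm (- y + z))\<^sup>2))"
  proof -
    have "gauss p z * gauss q (x - z) = (p / pi) powr ?d * (q / pi) powr ?d * exp (- r * (norm x)\<^sup>2)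
      * exp (- (p + q) * (norm (- y + z))\<^sup>2)" for z
    proof -
      have "exp (- p * (norm z)\<^sup>2) * exp (- q * (norm (x - z))\<^sup>2) = exp (- r * (norm x)\<^sup>2) * exp (- (p + q) * (norm (- y + z))\<^sup>2)"
      proof -
        have "- (p * (norm z)\<^sup>2) + - (q * (norm (x - z))\<^sup>2) = - (r * (norm x)\<^sup>2) + - ((p + q) * (norm (- y + z))\<^sup>2)"
          using sq[of z] by linarith
        then show ?thesis by (simp only: exp_add[symmetric] mult_minus_left)
      qed
      then show ?thesis by (simp add: gauss_def mult_ac)
    qed
    then show ?thesis by (simp add: conv_def)
  qed
  also have "(LINT z|lborel. exp (- (p + q) * (norm (- y + z))\<^sup>2)) = (pi / (p + q)) powr ?d"
    using lborel_integral_translate[of "\<lambda>z. exp (- (p + q) * (norm z)\<^sup>2)" "-y"] integral_gaussian[of "p + q", where 'a='a] p q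
    by simp
  also have "(p / pi) powr ?d * (q / pi) powr ?d * exp (- r * (norm x)\<^sup>2) * (pi / (p + q)) powr ?d = gauss r x"
  proof -
    have "(p / pi) powr ?d * (q / pi) powr ?d * (pi / (p + q)) powr ?d = (r / pi) powr ?d"
    proof -
      have "r / pi = p / pi * (q / pi) * (pi / (p + q))" by (simp add: r_def)
      then show ?thesis using p q by (simp only: powr_mult zero_le_mult_iff zero_le_divide_iff)
    qed
    then show ?thesis by (simp add: gauss_def mult_ac)
  qed
  finally show ?thesis by (simp add: r_def)
qed

text \<open>A wider Gaussian dominates a narrower one up to the ratio of their maximal values. The exponent
  \<open>DIM('a)\<close> instead of its half is a harmless loss that makes the power integral.\<close>

lemma gauss_decrease_le:
  assumes r: "0 < r" "r \<le> p"
  shows "(r / p) ^ DIM('a) * gauss p (x::'a::euclidean_space) \<le> gauss r x"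
proof -
  let ?d = "DIM('a) / 2"
  have rp: "0 < r / p" "r / p \<le> 1" using r by auto
  have "(r / p) ^ DIM('a) = (r / p) powr DIM('a)" using rp by (simp add: powr_realpow)
  also have "\<dots> \<le> (r / p) powr ?d" using rp by (intro powr_mono') auto
  finally have "(r / p) ^ DIM('a) * gauss p x \<le> (r / p) powr ?d * gauss p x" by (rule mult_right_mono) simp
  also have "\<dots> = (r / pi) powr ?d * exp (- p * (norm x)\<^sup>2)"
    using r by (simp add: gauss_def mult.assoc[symmetric] powr_mult[symmetric])
  also have "\<dots> \<le> gauss r x" 
    unfolding gauss_def using r by (intro mult_left_mono) (auto intro!: mult_right_mono)
  finally show ?thesis .
qed

text \<open>Subtracting the dominated multiple of the narrower Gaussian from the wider one leaves a nonnegative kernel,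
  so the distance of the two in total variation is read off from its mass. This replaces any use of the time
  derivative of the heat kernel.\<close>

lemma gauss_conv_difference_le:
  fixes f :: "'a::euclidean_space \<Rightarrow> real"
  assumes r: "0 < r" "r \<le> p" and f: "bdd_borel B f"
  shows "\<bar>conv (gauss p) f x - conv (gauss r) f x\<bar> \<le> 2 * real DIM('a) * (1 - r / p) * B"
proof -
  have p: "0 < p" using r by simp
  define \<theta> where "\<theta> = (r / p) ^ DIM('a)"
  have \<theta>1: "\<theta> \<le> 1" unfolding \<theta>_def using r by (intro power_le_one) auto
  have "1 + real DIM('a) * (r / p - 1) \<le> (1 + (r / p - 1)) ^ DIM('a)"
    using r by (intro Bernoulli_inequality) auto
  then have \<theta>: "1 - \<theta> \<le> real DIM('a) * (1 - r / p)" by (simp add: \<theta>_def algebra_simps)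
  let ?H = "\<lambda>z::'a. gauss r z - \<theta> * gauss p z"
  have H0: "0 \<le> ?H z" for z using gauss_decrease_le[OF r, of z] by (simp add: \<theta>_def)
  have ip: "integrable lborel (gauss p :: 'a \<Rightarrow> real)" "integrable lborel (gauss r :: 'a \<Rightarrow> real)"
    using gauss_integrable p r(1) by auto
  have iH: "integrable lborel ?H" using ip by auto
  have "(LINT z|lborel. \<bar>?H z\<bar>) = 1 - \<theta>"
    using ip gauss_integral[OF p, where 'a='a] gauss_integral[OF r(1), where 'a='a] H0 by simp
  then have "\<bar>conv ?H f x\<bar> \<le> (1 - \<theta>) * B" using conv_le[OF iH f, of x] by simp
  moreover have "conv ?H f x = conv (gauss r) f x - \<theta> * conv (gauss p) f x"
    unfolding conv_def left_diff_distrib mult.assoc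
    using conv_integrable[OF ip(1) f, of x] conv_integrable[OF ip(2) f, of x] by simp
  moreover have "\<bar>conv (gauss p) f x\<bar> \<le> B"
    using bdd_borel_le[OF bdd_borel_conv_prob[OF ip(1) gauss_nonneg gauss_integral[OF p] f]] .
  then have "\<bar>(1 - \<theta>) * conv (gauss p) f x\<bar> \<le> (1 - \<theta>) * B"
    using \<theta>1 by (simp add: abs_mult mult_left_mono)
  moreover have "(1 - \<theta>) * conv (gauss p) f x = conv (gauss p) f x - \<theta> * conv (gauss p) f x" by (simp add: algebra_simps)
  ultimately have "\<bar>conv (gauss p) f x - conv (gauss r) f x\<bar> \<le> 2 * (1 - \<theta>) * B" by (simp add: algebra_simps)
  also have "\<dots> \<le> 2 * (real DIM('a) * (1 - r / p)) * B"
    using \<theta> bdd_borel_nonneg[OF f] by (intro mult_right_mono) auto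
  finally show ?thesis by (simp add: mult.assoc)
qed

section \<open>Second moments of radial kernels\<close>

lemma nn_integral_square_gaussian_real:
  assumes "0 < (c::real)"
  shows "(\<integral>\<^sup>+x. ennreal (x\<^sup>2 * exp (- c * x\<^sup>2)) \<partial>lborel) = ennreal (sqrt (pi / c) / (2 * c))"
proof -
  define \<sigma> where "\<sigma> = sqrt (1 / (2 * c))"
  have \<sigma>: "\<sigma> > 0" "\<sigma>\<^sup>2 = 1 / (2 * c)" using assms by (auto simp: \<sigma>_def)
  have eq: "x\<^sup>2 * exp (- c * x\<^sup>2) = sqrt (pi / c) * (normal_density 0 \<sigma> x * x\<^sup>2)" for x
    using assms by (simp add: normal_density_def \<sigma>(2) field_simps)
  have h: "has_bochner_integral lborel (\<lambda>x. normal_density 0 \<sigma> x * x\<^sup>2) (1 / (2 * c))"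
    using normal_moment_even[of \<sigma> 0 1] \<sigma> assms by (simp add: fact_numeral numeral_2_eq_2 power_one_right)
  have "(\<integral>\<^sup>+x. ennreal (normal_density 0 \<sigma> x * x\<^sup>2) \<partial>lborel) = ennreal (1 / (2 * c))"
    using h \<sigma>(1) by (subst nn_integral_eq_integral) (auto simp: has_bochner_integral_iff)
  then have "(\<integral>\<^sup>+x. ennreal (x\<^sup>2 * exp (- c * x\<^sup>2)) \<partial>lborel) = ennreal (sqrt (pi / c)) * ennreal (1 / (2 * c))"
    unfolding eq using assms by (simp add: ennreal_mult' nn_integral_cmult)
  also have "\<dots> = ennreal (sqrt (pi / c) / (2 * c))"
    using assms by (subst ennreal_mult'[symmetric]) auto
  finally show ?thesis .
qed

lemma gauss_second_moment:
  assumes p: "0 < p"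
  shows "(LINT z|lborel. (norm z)\<^sup>2 * gauss p (z::'a::euclidean_space)) = DIM('a) / (2 * p)"
    and "integrable lborel (\<lambda>z. (norm z)\<^sup>2 * gauss p (z::'a::euclidean_space))"
proof -
  let ?d = "DIM('a) / 2"
  have comp: "(\<integral>\<^sup>+z. ennreal ((z \<bullet> b)\<^sup>2 * exp (- p * (norm z)\<^sup>2)) \<partial>lborel) = ennreal ((pi / p) powr ?d / (2 * p))"
    if b: "b \<in> Basis" for b :: 'a
  proof -
    define f where "f b' x = (if b' = b then x\<^sup>2 * exp (- p * x\<^sup>2) else exp (- p * x\<^sup>2))" for b' :: 'a and x :: real
    have eq: "ennreal ((z \<bullet> b)\<^sup>2 * exp (- p * (norm z)\<^sup>2)) = (\<Prod>b'\<in>Basis. ennreal (f b' (z \<bullet> b')))" for z :: 'a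
    proof -
      have "(norm z)\<^sup>2 = (\<Sum>b\<in>Basis. (z \<bullet> b)\<^sup>2)"
        by (subst power2_norm_eq_inner, subst euclidean_inner) (simp add: power2_eq_square)
      then have "exp (- p * (norm z)\<^sup>2) = (\<Prod>b\<in>Basis. exp (- p * (z \<bullet> b)\<^sup>2))"
        by (simp add: sum_distrib_left exp_sum[symmetric] sum_negf)
      also have "\<dots> = exp (- p * (z \<bullet> b)\<^sup>2) * (\<Prod>b'\<in>Basis - {b}. exp (- p * (z \<bullet> b')\<^sup>2))"
        using b by (simp add: prod.remove)
      finally have "(z \<bullet> b)\<^sup>2 * exp (- p * (norm z)\<^sup>2) = f b (z \<bullet> b) * (\<Prod>b'\<in>Basis - {b}. f b' (z \<bullet> b'))"
        by (simp add: f_def mult.assoc)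
      also have "\<dots> = (\<Prod>b'\<in>Basis. f b' (z \<bullet> b'))"
        using b by (simp add: prod.remove)
      finally show ?thesis by (simp add: prod_ennreal f_def)
    qed
    have "(\<integral>\<^sup>+z. ennreal ((z \<bullet> b)\<^sup>2 * exp (- p * (norm z)\<^sup>2)) \<partial>lborel) = (\<Prod>b'\<in>Basis. \<integral>\<^sup>+x. ennreal (f b' x) \<partial>lborel)"
      unfolding eq by (rule nn_integral_lborel_prod) (auto simp: f_def)
    also have "\<dots> = (\<integral>\<^sup>+x. ennreal (f b x) \<partial>lborel) * (\<Prod>b'\<in>Basis - {b}. \<integral>\<^sup>+x. ennreal (f b' x) \<partial>lborel)"
      using b by (simp add: prod.remove)
    also have "\<dots> = ennreal (sqrt (pi / p) / (2 * p)) * ennreal (sqrt (pi / p)) ^ (DIM('a) - 1)"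
      using nn_integral_square_gaussian_real[OF p] nn_integral_gaussian_real[OF p] b
      by (simp add: f_def)
    also have "\<dots> = ennreal (sqrt (pi / p) / (2 * p) * sqrt (pi / p) ^ (DIM('a) - 1))"
      using p by (simp add: ennreal_power ennreal_mult'[symmetric])
    also have "sqrt (pi / p) / (2 * p) * sqrt (pi / p) ^ (DIM('a) - 1) = sqrt (pi / p) ^ DIM('a) / (2 * p)"
      using DIM_positive[where 'a='a] by (cases "DIM('a)") auto
    also have "sqrt (pi / p) ^ DIM('a) = (pi / p) powr ?d"
      using p by (simp add: powr_half_sqrt[symmetric] powr_realpow[symmetric] powr_powr)
    finally show ?thesis .
  qed
  have nn: "(\<integral>\<^sup>+z. ennreal ((norm z)\<^sup>2 * gauss p (z::'a)) \<partial>lborel) = ennreal (DIM('a) / (2 * p))"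
  proof -
    have "ennreal ((norm z)\<^sup>2 * gauss p z) = ennreal ((p / pi) powr ?d) * (\<Sum>b\<in>(Basis::'a set). ennreal ((z \<bullet> b)\<^sup>2 * exp (- p * (norm z)\<^sup>2)))" for z :: 'a
    proof -
      have "(norm z)\<^sup>2 = (\<Sum>b\<in>Basis. (z \<bullet> b)\<^sup>2)"
        by (subst power2_norm_eq_inner, subst euclidean_inner) (simp add: power2_eq_square)
      then show ?thesis
        by (simp add: gauss_def sum_ennreal ennreal_mult'[symmetric] sum_distrib_right[symmetric] mult_ac)
    qed
    then have "(\<integral>\<^sup>+z. ennreal ((norm z)\<^sup>2 * gauss p (z::'a)) \<partial>lborel)
      = ennreal ((p / pi) powr ?d) * (\<Sum>b\<in>(Basis::'a set). \<integral>\<^sup>+z. ennreal ((z \<bullet> b)\<^sup>2 * exp (- p * (norm z)\<^sup>2)) \<partial>lborel)"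
      by (simp only:) (subst nn_integral_cmult, measurable, subst nn_integral_sum, auto)
    also have "\<dots> = ennreal ((p / pi) powr ?d) * (\<Sum>b\<in>(Basis::'a set). ennreal ((pi / p) powr ?d / (2 * p)))"
      by (simp only: comp cong: sum.cong)
    also have "\<dots> = ennreal ((p / pi) powr ?d * (\<Sum>b\<in>(Basis::'a set). (pi / p) powr ?d / (2 * p)))"
      using p by (subst sum_ennreal) (simp, rule ennreal_mult'[symmetric], simp)
    also have "(p / pi) powr ?d * (\<Sum>b\<in>(Basis::'a set). (pi / p) powr ?d / (2 * p)) = DIM('a) / (2 * p) * ((p / pi) powr ?d * (pi / p) powr ?d)"
      by simp
    also have "(p / pi) powr ?d * (pi / p) powr ?d = 1" using p by (simp add: powr_mult[symmetric])
    finally show ?thesis by simp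
  qed
  show "integrable lborel (\<lambda>z. (norm z)\<^sup>2 * gauss p (z::'a::euclidean_space))"
    by (rule integrableI_nonneg) (auto simp: nn)
  show "(LINT z|lborel. (norm z)\<^sup>2 * gauss p (z::'a::euclidean_space)) = DIM('a) / (2 * p)"
    using p by (subst integral_eq_nn_integral) (auto simp: nn)
qed

lemma lborel_distr_flip:
  fixes b :: "'a::euclidean_space"
  shows "distr lborel borel (\<lambda>z. \<Sum>j\<in>Basis. ((if j = b then -1 else 1) * (z \<bullet> j)) *\<^sub>R j) = lborel"
proof -
  have "lborel = density (distr lborel borel (\<lambda>z. 0 + (\<Sum>j\<in>Basis. ((if j = b then -1 else 1) * (z \<bullet> j)) *\<^sub>R j)))
     (\<lambda>_. (\<Prod>j\<in>(Basis::'a set). \<bar>if j = b then -1 else 1 :: real\<bar>))"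
    by (rule lborel_affine_euclidean) simp
  moreover have "(\<Prod>j\<in>(Basis::'a set). \<bar>if j = b then -1 else 1 :: real\<bar>) = 1" by (intro prod.neutral) auto
  ultimately show ?thesis by (simp add: density_1)
qed

text \<open>Together with the reflections of single coordinates, the permutations of the coordinates are all the
  symmetries needed to compute second moments of radial functions.\<close>

lemma lborel_distr_permute:
  fixes \<pi> :: "'a::euclidean_space \<Rightarrow> 'a"
  assumes \<pi>: "bij_betw \<pi> Basis Basis"
  shows "distr lborel borel (\<lambda>z::'a. \<Sum>j\<in>Basis. (z \<bullet> \<pi> j) *\<^sub>R j) = lborel"
proof (rule lborel_eqI[symmetric])
  let ?T = "\<lambda>z::'a. \<Sum>j\<in>Basis. (z \<bullet> \<pi> j) *\<^sub>R j"
  fix l u :: 'a assume le: "\<And>b. b \<in> Basis \<Longrightarrow> l \<bullet> b \<le> u \<bullet> b"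
  define \<rho> where "\<rho> = the_inv_into Basis \<pi>"
  have \<rho>: "\<rho> b \<in> Basis" "\<pi> (\<rho> b) = b" if "b \<in> Basis" for b
    using \<pi> that unfolding \<rho>_def bij_betw_def
    by (auto intro: the_inv_into_into f_the_inv_into_f)
  have \<rho>': "\<pi> b \<in> Basis" "\<rho> (\<pi> b) = b" if "b \<in> Basis" for b
    using \<pi> that unfolding \<rho>_def bij_betw_def by (auto intro: the_inv_into_f_f)
  let ?S = "\<lambda>z::'a. \<Sum>j\<in>Basis. (z \<bullet> \<rho> j) *\<^sub>R j"
  have S: "?S z \<bullet> b = z \<bullet> \<rho> b" if "b \<in> Basis" for b z
    using that by simp
  have vim: "?T -` box l u = box (?S l) (?S u)"
  proof (intro set_eqI iffI)
    fix z assume "z \<in> ?T -` box l u"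
    then have *: "l \<bullet> j < z \<bullet> \<pi> j \<and> z \<bullet> \<pi> j < u \<bullet> j" if "j \<in> Basis" for j
      using that by (auto simp: box_def)
    then show "z \<in> box (?S l) (?S u)"
      using *[OF \<rho>(1)] \<rho>(2) by (simp add: box_def)
  next
    fix z assume "z \<in> box (?S l) (?S u)"
    then have *: "l \<bullet> \<rho> j < z \<bullet> j \<and> z \<bullet> j < u \<bullet> \<rho> j" if "j \<in> Basis" for j
      using that by (auto simp: box_def)
    then show "z \<in> ?T -` box l u"
      using *[OF \<rho>'(1)] \<rho>'(2) by (simp add: box_def)
  qed
  have "emeasure (distr lborel borel ?T) (box l u) = emeasure lborel (box (?S l) (?S u))"
    by (subst emeasure_distr) (auto simp: vim)
  also have "\<dots> = (\<Prod>b\<in>Basis. (?S u - ?S l) \<bullet> b)"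
    by (rule emeasure_lborel_box) (use le \<rho>(1) in auto)
  also have "(\<Prod>b\<in>Basis. (?S u - ?S l) \<bullet> b) = (\<Prod>b\<in>Basis. (u - l) \<bullet> \<rho> b)"
    by (intro prod.cong) (auto simp: inner_diff_left)
  also have "\<dots> = (\<Prod>b\<in>Basis. (u - l) \<bullet> b)"
    by (rule prod.reindex_bij_witness[where i=\<pi> and j=\<rho>]) (use \<rho> \<rho>' in auto)
  finally show "emeasure (distr lborel borel ?T) (box l u) = ennreal (\<Prod>b\<in>Basis. (u - l) \<bullet> b)" .
qed simp

lemma radial_first_moment:
  fixes H :: "'a::euclidean_space \<Rightarrow> real"
  assumes [measurable]: "H \<in> borel_measurable borel" and H: "radially_symmetric H"
  shows "(LINT z|lborel. H z * (z \<bullet> b)) = 0"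
proof -
  have "H (0 - z) = H z" for z
    using H unfolding radially_symmetric_def by (metis diff_0 norm_minus_cancel)
  then have "(LINT z|lborel. H z * ((0 - z) \<bullet> b)) = (LINT z|lborel. H z * (z \<bullet> b))"
    using lborel_integral_reflect[of "\<lambda>z. H z * (z \<bullet> b)" 0] by (simp only:) measurable
  then show ?thesis by simp
qed

lemma radial_mixed_moment:
  fixes H :: "'a::euclidean_space \<Rightarrow> real"
  assumes [measurable]: "H \<in> borel_measurable borel" and H: "radially_symmetric H"
    and b: "b \<in> Basis" "b' \<in> Basis" "b \<noteq> b'"
  shows "(LINT z|lborel. H z * ((z \<bullet> b) * (z \<bullet> b'))) = 0"
proof -
  let ?T = "\<lambda>z::'a. \<Sum>j\<in>Basis. ((if j = b then -1 else 1) * (z \<bullet> j)) *\<^sub>R j"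
  have T: "?T z \<bullet> j = (if j = b then -1 else 1) * (z \<bullet> j)" if "j \<in> Basis" for z j
    using that by simp
  have "norm (?T z) = norm z" for z
    unfolding norm_eq_sqrt_inner euclidean_inner[of "?T z" "?T z"] euclidean_inner[of z z]
    by (intro arg_cong[where f=sqrt] sum.cong) (simp_all only: T, auto)
  then have HT: "H (?T z) = H z" for z using H unfolding radially_symmetric_def by blast
  have "(LINT z|lborel. H z * ((z \<bullet> b) * (z \<bullet> b'))) = (LINT z|distr lborel borel ?T. H z * ((z \<bullet> b) * (z \<bullet> b')))"
    by (simp only: lborel_distr_flip)
  also have "\<dots> = (LINT z|lborel. H (?T z) * ((?T z \<bullet> b) * (?T z \<bullet> b')))"
    by (rule integral_distr) measurable
  also have "\<dots> = (LINT z|lborel. - (H z * ((z \<bullet> b) * (z \<bullet> b'))))"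
    using b unfolding HT T[OF b(1)] T[OF b(2)] by simp
  finally show ?thesis by simp
qed

lemma radial_second_moment:
  fixes H :: "'a::euclidean_space \<Rightarrow> real"
  assumes [measurable]: "H \<in> borel_measurable borel" and H: "radially_symmetric H"
    and int: "integrable lborel (\<lambda>z. (norm z)\<^sup>2 * H z)"
    and b: "b \<in> Basis"
  shows "DIM('a) * (LINT z|lborel. H z * ((z \<bullet> b) * (z \<bullet> b))) = (LINT z|lborel. (norm z)\<^sup>2 * H z)"
proof -
  have i: "integrable lborel (\<lambda>z. H z * ((z \<bullet> j) * (z \<bullet> j)))" if "j \<in> Basis" for j
  proof (rule Bochner_Integration.integrable_bound[OF int])
    show "AE z in lborel. norm (H z * ((z \<bullet> j) * (z \<bullet> j))) \<le> norm ((norm z)\<^sup>2 * H z)"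
    proof (rule AE_I2)
      fix z
      have "\<bar>z \<bullet> j\<bar> * \<bar>z \<bullet> j\<bar> \<le> norm z * norm z"
        by (intro mult_mono Basis_le_norm that) auto
      then show "norm (H z * ((z \<bullet> j) * (z \<bullet> j))) \<le> norm ((norm z)\<^sup>2 * H z)"
        by (simp add: abs_mult power2_eq_square mult.commute[of "\<bar>H z\<bar>"] mult_right_mono)
    qed
  qed measurable
  have eq: "(LINT z|lborel. H z * ((z \<bullet> j) * (z \<bullet> j))) = (LINT z|lborel. H z * ((z \<bullet> b) * (z \<bullet> b)))" if j: "j \<in> Basis" for j
  proof -
    define \<pi> where "\<pi> k = (if k = b then j else if k = j then b else k)" for k
    have \<pi>: "bij_betw \<pi> Basis Basis"
      by (rule bij_betw_byWitness[where f'=\<pi>]) (use b j in \<open>auto simp: \<pi>_def\<close>)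
    let ?T = "\<lambda>z::'a. \<Sum>k\<in>Basis. (z \<bullet> \<pi> k) *\<^sub>R k"
    have T: "?T z \<bullet> k = z \<bullet> \<pi> k" if "k \<in> Basis" for z k using that by simp
    have "norm (?T z) = norm z" for z
    proof -
      have "?T z \<bullet> ?T z = (\<Sum>k\<in>Basis. (z \<bullet> \<pi> k) * (z \<bullet> \<pi> k))"
        unfolding euclidean_inner[of "?T z" "?T z"] by (intro sum.cong) (simp_all only: T)
      also have "\<dots> = (\<Sum>k\<in>Basis. (z \<bullet> k) * (z \<bullet> k))"
        by (rule sum.reindex_bij_betw[OF \<pi>])
      finally show ?thesis by (simp add: norm_eq_sqrt_inner euclidean_inner[of z z])
    qed
    then have HT: "H (?T z) = H z" for z using H unfolding radially_symmetric_def by blast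
    have "(LINT z|lborel. H z * ((z \<bullet> b) * (z \<bullet> b))) = (LINT z|distr lborel borel ?T. H z * ((z \<bullet> b) * (z \<bullet> b)))"
      by (simp only: lborel_distr_permute[OF \<pi>])
    also have "\<dots> = (LINT z|lborel. H (?T z) * ((?T z \<bullet> b) * (?T z \<bullet> b)))"
      by (rule integral_distr) measurable
    also have "\<dots> = (LINT z|lborel. H z * ((z \<bullet> j) * (z \<bullet> j)))"
      unfolding HT T[OF b] by (simp add: \<pi>_def)
    finally show ?thesis by simp
  qed
  have "(LINT z|lborel. (norm z)\<^sup>2 * H z) = (LINT z|lborel. (\<Sum>j\<in>Basis. H z * ((z \<bullet> j) * (z \<bullet> j))))"
  proof (rule Bochner_Integration.integral_cong)
    fix z :: 'a
    have "(norm z)\<^sup>2 = (\<Sum>b\<in>Basis. (z \<bullet> b) * (z \<bullet> b))"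
      by (subst power2_norm_eq_inner, subst euclidean_inner) simp
    then show "(norm z)\<^sup>2 * H z = (\<Sum>j\<in>Basis. H z * ((z \<bullet> j) * (z \<bullet> j)))"
      by (simp add: sum_distrib_left mult.commute)
  qed simp
  also have "\<dots> = (\<Sum>j\<in>Basis. LINT z|lborel. H z * ((z \<bullet> j) * (z \<bullet> j)))"
    using i by (rule Bochner_Integration.integral_sum)
  also have "\<dots> = (\<Sum>j\<in>(Basis::'a set). LINT z|lborel. H z * ((z \<bullet> b) * (z \<bullet> b)))"
    by (intro sum.cong eq) auto
  finally show ?thesis by simp
qed

section \<open>Admissible convolution kernels\<close>

lemma frechet_derivative_zero_outside:
  fixes g :: "'a::euclidean_space \<Rightarrow> real"
  assumes S: "closed S" and g: "\<And>x. x \<notin> S \<Longrightarrow> g x = 0" and x: "x \<notin> S"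
  shows "frechet_derivative g (at x) v = 0"
proof -
  have "(g has_derivative (\<lambda>_. 0)) (at x)"
    by (rule has_derivative_transform_within_open[of "\<lambda>_. 0" _ _ _ "- S"]) (use assms in auto)
  then show ?thesis using frechet_derivative_at by metis
qed

text \<open>A nonnegative function with bounded second derivative cannot have a large slope where it is small, since
  the tangent parabola would become negative at its minimum.\<close>

lemma square_derivative_le:
  fixes h :: "real \<Rightarrow> real"
  assumes h: "\<And>s. (h has_real_derivative h' s) (at s)" "\<And>s. (h' has_real_derivative h'' s) (at s)"
    and nonneg: "\<And>s. 0 \<le> h s" and M: "0 < M" "\<And>s. \<bar>h'' s\<bar> \<le> M"
  shows "(h' 0)\<^sup>2 \<le> 2 * M * h 0"
proof -
  \<comment> \<open>The minimum of the parabola with the given tangent and second derivative M.\<close>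
  define s where "s = - h' 0 / M"
  define diff where "diff m = (if m = 0 then h else if m = 1 then h' else h'')" for m :: nat
  have "\<exists>t. \<bar>t\<bar> \<le> \<bar>s\<bar> \<and> h s = (\<Sum>m<2. diff m 0 / fact m * s ^ m) + diff 2 t / fact 2 * s ^ 2"
  proof (rule Maclaurin_bi_le)
    show "\<forall>m t. m < 2 \<and> \<bar>t\<bar> \<le> \<bar>s\<bar> \<longrightarrow> (diff m has_real_derivative diff (Suc m) t) (at t)"
      using h by (auto simp: diff_def less_2_cases_iff)
  qed (simp add: diff_def)
  then obtain t where t: "h s = h 0 + h' 0 * s + h'' t / 2 * s\<^sup>2"
    by (auto simp: diff_def numeral_2_eq_2)
  also have "\<dots> \<le> h 0 + h' 0 * s + M / 2 * s\<^sup>2"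
    using M(2)[of t] by (intro add_left_mono mult_right_mono) auto
  also have "\<dots> = h 0 - (h' 0)\<^sup>2 / (2 * M)"
    using M(1) by (simp add: s_def power2_eq_square)
  finally have "(h' 0)\<^sup>2 / (2 * M) \<le> h 0" using nonneg[of s] by linarith
  then show ?thesis using M(1) by (simp add: divide_le_eq mult.commute)
qed

text \<open>The square of the gradient is bounded by a multiple of the function, which gives the finite Fisher
  information; on the compact support any Gaussian weight is bounded below.\<close>

lemma smooth_compact_kernel:
  fixes J :: "'a::euclidean_space \<Rightarrow> real"
  assumes smooth: "smooth J" and supp: "compactly_supported J" and nonneg: "\<And>x. 0 \<le> J x"
    and mass: "(LINT z|lborel. J z) = 1"
  shows "\<exists>C. smooth_kernel J (\<lambda>v z. frechet_derivative J (at z) v) C 1"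
proof -
  define S where "S = closure {x. J x \<noteq> 0}"
  have S: "closed S" "compact S" using supp by (simp_all add: S_def compactly_supported_def)
  have J0: "J x = 0" if "x \<notin> S" for x using that closure_subset[of "{x. J x \<noteq> 0}"] by (auto simp: S_def)
  define dJ where "dJ v z = frechet_derivative J (at z) v" for v z
  define ddJ where "ddJ v z = frechet_derivative (dJ v) (at z) v" for v z
  have "Ck (Suc (Suc 0)) J" using smooth unfolding smooth_def by blast
  then have Jd: "J differentiable (at x)" and dJd: "dJ v differentiable (at x)" and ddJc: "continuous_on UNIV (ddJ v)" for x v
    unfolding ddJ_def[abs_def] dJ_def[abs_def] by auto
  have dJ0: "dJ v x = 0" if "x \<notin> S" for x v
    unfolding dJ_def by (rule frechet_derivative_zero_outside[OF S(1) J0 that])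
  have ddJ0: "ddJ v x = 0" if "x \<notin> S" for x v
    unfolding ddJ_def by (rule frechet_derivative_zero_outside[OF S(1) dJ0 that])
  have Jder: "(J has_derivative (\<lambda>v. dJ v z)) (at z)" for z
    using Jd frechet_derivative_works unfolding dJ_def by blast
  have dJder: "(dJ v has_derivative frechet_derivative (dJ v) (at z)) (at z)" for v z
    using dJd frechet_derivative_works by blast
  have Jcont: "continuous_on UNIV J"
    using Jder has_derivative_continuous by (blast intro: continuous_at_imp_continuous_on)
  have dJcont: "continuous_on UNIV (dJ v)" for v
    using dJder has_derivative_continuous by (blast intro: continuous_at_imp_continuous_on)
  have bdd: "\<exists>M. \<forall>x. \<bar>g x\<bar> \<le> M" if g: "continuous_on UNIV g" "\<And>x. x \<notin> S \<Longrightarrow> g x = 0" for g :: "'a \<Rightarrow> real"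
  proof -
    have "bounded (g ` S)"
      using g(1) S(2) by (intro compact_imp_bounded compact_continuous_image) (auto intro: continuous_on_subset)
    then obtain M where "\<And>x. x \<in> S \<Longrightarrow> \<bar>g x\<bar> \<le> M" unfolding bounded_iff by auto
    then have "\<bar>g x\<bar> \<le> max 0 M" for x using g(2)[of x] by (cases "x \<in> S") (auto intro: max.coboundedI2)
    then show ?thesis by blast
  qed
  obtain MJ where MJ: "\<And>x. \<bar>J x\<bar> \<le> MJ" using bdd[OF Jcont J0] by blast
  obtain M where M: "\<And>b x. \<bar>ddJ b x\<bar> \<le> M b" using bdd[OF ddJc ddJ0] by metis
  obtain R where R: "\<And>x. x \<in> S \<Longrightarrow> norm x \<le> R" using compact_imp_bounded[OF S(2)] unfolding bounded_iff by blast
  \<comment> \<open>Raises the Gaussian weight above 1 on the support, which lies in the ball of radius R.\<close>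
  define E where "E = exp (R\<^sup>2)"
  have Eg: "1 \<le> E * exp (- 1 * (norm z)\<^sup>2)" if "z \<in> S" for z
  proof -
    have "(norm z)\<^sup>2 \<le> R\<^sup>2" using R[OF that] by (intro power_mono) auto
    then show ?thesis by (simp add: E_def exp_add[symmetric])
  qed
  have direction: "(dJ b z)\<^sup>2 \<le> 2 * (\<bar>M b\<bar> + 1) * J z" for b z
  proof -
    have 1: "((\<lambda>s. J (z + s *\<^sub>R b)) has_real_derivative dJ b (z + s *\<^sub>R b)) (at s)" for s
    proof -
      have "((\<lambda>s. J (z + s *\<^sub>R b)) has_derivative (\<lambda>h. dJ (h *\<^sub>R b) (z + s *\<^sub>R b))) (at s)"
        by (rule has_derivative_compose[OF _ Jder]) (auto intro!: derivative_eq_intros)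
      moreover have "dJ (h *\<^sub>R b) w = h * dJ b w" for h w
        using linear_cmul[OF has_derivative_linear[OF Jder[of w]], of h b] by simp
      ultimately show ?thesis by (simp add: has_field_derivative_def mult.commute[of _ "dJ _ _"])
    qed
    have 2: "((\<lambda>s. dJ b (z + s *\<^sub>R b)) has_real_derivative ddJ b (z + s *\<^sub>R b)) (at s)" for s
    proof -
      have "((\<lambda>s. dJ b (z + s *\<^sub>R b)) has_derivative (\<lambda>h. frechet_derivative (dJ b) (at (z + s *\<^sub>R b)) (h *\<^sub>R b))) (at s)"
        by (rule has_derivative_compose[OF _ dJder]) (auto intro!: derivative_eq_intros)
      moreover have "frechet_derivative (dJ b) (at w) (h *\<^sub>R b) = h * ddJ b w" for h w
        using linear_cmul[OF has_derivative_linear[OF dJder[of b w]], of h b] by (simp add: ddJ_def)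
      ultimately show ?thesis by (simp add: has_field_derivative_def mult.commute[of _ "ddJ _ _"])
    qed
    have Mb: "\<bar>ddJ b w\<bar> \<le> \<bar>M b\<bar> + 1" for w using M[of b w] by linarith
    show ?thesis
      using square_derivative_le[OF 1 2, of "\<bar>M b\<bar> + 1"] nonneg Mb by (simp add: add_nonneg_pos)
  qed
  define A where "A = (\<Sum>b\<in>(Basis::'a set). 2 * (\<bar>M b\<bar> + 1))"
  have A0: "0 \<le> A" by (auto simp: A_def intro!: sum_nonneg)
  have grad: "(dJ v z)\<^sup>2 \<le> A * (norm v)\<^sup>2 * J z" for v z
  proof -
    interpret linear "\<lambda>v. dJ v z" by (rule has_derivative_linear[OF Jder])
    have "dJ v z = dJ (\<Sum>b\<in>Basis. (v \<bullet> b) *\<^sub>R b) z" by (simp add: euclidean_representation)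
    also have "\<dots> = (\<Sum>b\<in>Basis. (v \<bullet> b) * dJ b z)" by (simp only: sum scale real_scaleR_def)
    finally have "(dJ v z)\<^sup>2 \<le> (\<Sum>b\<in>Basis. (v \<bullet> b)\<^sup>2) * (\<Sum>b\<in>Basis. (dJ b z)\<^sup>2)"
      using Cauchy_Schwarz_ineq_sum by metis
    also have "\<dots> \<le> (\<Sum>b\<in>Basis. (v \<bullet> b)\<^sup>2) * (\<Sum>b\<in>(Basis::'a set). 2 * (\<bar>M b\<bar> + 1) * J z)"
      by (intro mult_left_mono sum_mono direction sum_nonneg) auto
    also have "(\<Sum>b\<in>Basis. (v \<bullet> b)\<^sup>2) = (norm v)\<^sup>2"
      by (subst power2_norm_eq_inner, subst euclidean_inner) (simp add: power2_eq_square)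
    also have "(norm v)\<^sup>2 * (\<Sum>b\<in>(Basis::'a set). 2 * (\<bar>M b\<bar> + 1) * J z) = A * (norm v)\<^sup>2 * J z"
      by (simp only: A_def sum_distrib_right[symmetric]) simp
    finally show ?thesis .
  qed
  define C where "C = (MJ + A) * E"
  have MJ0: "0 \<le> MJ" using MJ[of 0] by linarith
  show ?thesis unfolding dJ_def[symmetric]
  proof (intro exI[of _ C], unfold_locales)
    fix z v
    show "0 \<le> J z" by (rule nonneg)
    show "(J has_derivative (\<lambda>v. dJ v z)) (at z)" by (rule Jder)
    show "dJ v \<in> borel_measurable borel" by (rule borel_measurable_continuous_onI[OF dJcont])
    show "(LINT z|lborel. J z) = 1" by (rule mass)
    show "0 < (1::real)" by simp
    show "J z \<le> C * exp (- 1 * (norm z)\<^sup>2)"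
    proof (cases "z \<in> S")
      case True
      have "J z \<le> (MJ + A) * 1" using MJ[of z] A0 by simp
      also have "\<dots> \<le> (MJ + A) * (E * exp (- 1 * (norm z)\<^sup>2))"
        using Eg[OF True] MJ0 A0 by (intro mult_left_mono) auto
      finally show ?thesis by (simp add: C_def mult.assoc)
    qed (use J0 MJ0 A0 in \<open>simp add: C_def E_def\<close>)
    show "(dJ v z)\<^sup>2 \<le> C * (norm v)\<^sup>2 * exp (- 1 * (norm z)\<^sup>2) * J z"
    proof (cases "z \<in> S")
      case True
      have "(dJ v z)\<^sup>2 \<le> (MJ + A) * (norm v)\<^sup>2 * J z"
        using grad[of v z] mult_right_mono[of A "MJ + A" "(norm v)\<^sup>2 * J z"] MJ0 nonneg[of z] by (simp add: mult.assoc)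
      also have "\<dots> \<le> (MJ + A) * (norm v)\<^sup>2 * J z * (E * exp (- 1 * (norm z)\<^sup>2))"
        using mult_left_mono[OF Eg[OF True], of "(MJ + A) * (norm v)\<^sup>2 * J z"] MJ0 A0 nonneg[of z] by simp
      finally show ?thesis by (simp add: C_def mult_ac)
    qed (use J0 dJ0 in simp)
  qed
qed

lemma diffusivity_lborel:
  fixes J :: "real^'n \<Rightarrow> real"
  assumes "J \<in> borel_measurable borel"
  shows "diffusivity J = 1 / (2 * real CARD('n)) * (LINT z|lborel. (norm z)\<^sup>2 * J z)"
  unfolding diffusivity_def using assms by (subst integral_completion) auto

lemma diffusivity_pos:
  fixes J :: "real^'n \<Rightarrow> real"
  assumes [measurable]: "J \<in> borel_measurable borel" and nonneg: "\<And>z. 0 \<le> J z"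
    and mass: "(LINT z|lborel. J z) = 1" and int: "integrable lborel (\<lambda>z. (norm z)\<^sup>2 * J z)"
  shows "0 < diffusivity J"
proof -
  have "(LINT z|lborel. (norm z)\<^sup>2 * J z) \<noteq> 0"
  proof
    assume "(LINT z|lborel. (norm z)\<^sup>2 * J z) = 0"
    then have "AE z in lborel. (norm z)\<^sup>2 * J z = 0"
      using integral_nonneg_eq_0_iff_AE[OF int] nonneg by simp
    then have "AE z in lborel. J z = 0"
      using AE_lborel_singleton[of "0 :: real^'n"] by eventually_elim auto
    then have "(LINT z|lborel. J z) = (LINT z|(lborel :: (real^'n) measure). 0)" by (intro integral_cong_AE) auto
    then show False using mass by simp
  qed
  moreover have "0 \<le> (LINT z|lborel. (norm z)\<^sup>2 * J z)"
    by (rule Bochner_Integration.integral_nonneg) (simp add: nonneg)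
  ultimately show ?thesis
    unfolding diffusivity_lborel[OF assms(1)] by (simp add: zero_less_divide_iff)
qed

lemma gauss_conv_power:
  fixes f :: "'a::euclidean_space \<Rightarrow> real"
  assumes p: "0 < p" and f: "bdd_borel B f"
  shows "(conv (gauss p) ^^ Suc n) f = conv (gauss (p / real (Suc n))) f"
proof (induction n)
  case (Suc n)
  have q: "0 < p / real (Suc n)" using p by simp
  have "(conv (gauss p) ^^ Suc (Suc n)) f = conv (gauss p) (conv (gauss (p / real (Suc n))) f)"
    using Suc by simp
  also have "\<dots> = conv (conv (gauss p) (gauss (p / real (Suc n)))) f"
    using conv_assoc[OF gauss_integrable[OF p] gauss_integrable[OF q] f] by blast
  also have "conv (gauss p) (gauss (p / real (Suc n))) = (gauss (p / real (Suc (Suc n))) :: 'a \<Rightarrow> real)"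
  proof -
    have "p * (p / real (Suc n)) / (p + p / real (Suc n)) = p / real (Suc (Suc n))"
    proof -
      define m where "m = real (Suc n)"
      have m: "0 < m" by (simp add: m_def)
      have "p + p / m = p * ((m + 1) / m)" using m by (simp add: field_simps)
      then have "p * (p / m) / (p + p / m) = p / (m + 1)" using m p by simp
      then show ?thesis by (simp add: m_def add.commute)
    qed
    then show ?thesis by (intro ext) (simp only: gauss_conv_gauss[OF p q])
  qed
  finally show ?case .
qed simp

text \<open>The diffusivity is defined exactly so that the second moments of the jump kernel agree with those of the
  heat kernel at time 1; the remaining second moments agree since both kernels are radial.\<close>

theorem conv_power_gauss_difference:
  fixes J :: "real^'n \<Rightarrow> real"
  assumes J: "convolution_kernel J"
  defines "a \<equiv> diffusivity J"
  shows "0 < a" and "J \<in> borel_measurable borel" and "integrable lborel J"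
    and "\<And>z. 0 \<le> J z" and "(LINT z|lborel. J z) = 1"
    and "\<exists>C\<ge>0. \<forall>n\<ge>1. \<forall>B \<psi> x. bdd_borel B \<psi> \<longrightarrow>
     \<bar>(conv J ^^ n) \<psi> x - conv (gauss (1 / (4 * a * real n))) \<psi> x\<bar> \<le> C / sqrt (real n) * B"
proof -
  have smooth: "smooth J" and supp: "compactly_supported J" and radial: "radially_symmetric J"
    and nonneg: "\<And>x. 0 \<le> J x" and leb: "integral\<^sup>L lebesgue J = 1"
    using J by (auto simp: convolution_kernel_def)
  have "Ck 0 J" using smooth unfolding smooth_def by blast
  then have meas [measurable]: "J \<in> borel_measurable borel"
    by (auto intro: borel_measurable_continuous_onI)
  have mass: "(LINT z|lborel. J z) = 1" using leb by (simp add: integral_completion)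
  obtain C where "smooth_kernel J (\<lambda>v z. frechet_derivative J (at z) v) C 1"
    using smooth_compact_kernel[OF smooth supp nonneg mass] by blast
  then interpret J: smooth_kernel J "\<lambda>v z. frechet_derivative J (at z) v" C 1 .
  have int2: "integrable lborel (\<lambda>z. (norm z)\<^sup>2 * J z)"
  proof (rule integrable_power_gaussian_decay[OF J.c, where C=C and k=2])
    fix z
    show "\<bar>(norm z)\<^sup>2 * J z\<bar> \<le> C * norm z ^ 2 * exp (- 1 * (norm z)\<^sup>2)"
    proof -
      have "\<bar>(norm z)\<^sup>2 * J z\<bar> = (norm z)\<^sup>2 * J z" by (rule abs_of_nonneg) (simp add: nonneg)
      also have "\<dots> \<le> (norm z)\<^sup>2 * (C * exp (- 1 * (norm z)\<^sup>2))"
        by (rule mult_left_mono[OF J.decay]) simp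
      finally show ?thesis by (simp only: mult.left_commute mult.assoc)
    qed
  qed measurable
  show a: "0 < a" unfolding a_def by (rule diffusivity_pos[OF meas nonneg mass int2])
  show "J \<in> borel_measurable borel" "integrable lborel J" "\<And>z. 0 \<le> J z" "(LINT z|lborel. J z) = 1"
    by (rule meas J.int nonneg mass)+
  define p where "p = 1 / (4 * a)"
  have p: "0 < p" using a by (simp add: p_def)
  obtain CG where "smooth_kernel (gauss p :: real^'n \<Rightarrow> real) (\<lambda>v z. - 2 * p * (z \<bullet> v) * gauss p z) CG (p / 2)"
    using gauss_smooth_kernel[OF p] by blast
  then interpret G: smooth_kernel "gauss p" "\<lambda>v (z::real^'n). - 2 * p * (z \<bullet> v) * gauss p z" CG "p / 2" .
  let ?H = "\<lambda>z. J z - gauss p z"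
  have Hr: "radially_symmetric ?H"
    unfolding radially_symmetric_def gauss_def
  proof (intro allI impI)
    fix x y :: "real^'n" assume xy: "norm x = norm y"
    then have "J x = J y" using radial unfolding radially_symmetric_def by blast
    with xy show "J x - (p / pi) powr (DIM(real^'n) / 2) * exp (- p * (norm x)\<^sup>2)
      = J y - (p / pi) powr (DIM(real^'n) / 2) * exp (- p * (norm y)\<^sup>2)" by (simp only:)
  qed
  have Hm: "?H \<in> borel_measurable borel" by measurable
  have Hi: "integrable lborel (\<lambda>z. (norm z)\<^sup>2 * ?H z)"
    using int2 gauss_second_moment(2)[OF p, where 'a="real^'n"] by (simp add: right_diff_distrib)
  have H2: "(LINT z|lborel. (norm z)\<^sup>2 * ?H z) = 0"
  proof -
    have "(LINT z|lborel. (norm z)\<^sup>2 * J z) = 2 * real CARD('n) * a"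
      unfolding a_def diffusivity_lborel[OF meas] by simp
    moreover have "(LINT z|lborel. (norm z)\<^sup>2 * gauss p (z::real^'n)) = 2 * real CARD('n) * a"
      unfolding gauss_second_moment(1)[OF p] using a by (simp add: p_def)
    ultimately show ?thesis
      using int2 gauss_second_moment(2)[OF p, where 'a="real^'n"] by (simp add: right_diff_distrib)
  qed
  interpret matched_kernels J "gauss p" "\<lambda>v z. frechet_derivative J (at z) v" "\<lambda>v z. - 2 * p * (z \<bullet> v) * gauss p z" C 1 CG "p / 2"
  proof
    fix b b' :: "real^'n" assume b: "b \<in> Basis"
    show "(LINT z|lborel. ?H z * (z \<bullet> b)) = 0" by (rule radial_first_moment[OF Hm Hr])
    assume b': "b' \<in> Basis"
    show "(LINT z|lborel. ?H z * ((z \<bullet> b) * (z \<bullet> b'))) = 0"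
    proof (cases "b = b'")
      case True
      then show ?thesis using radial_second_moment[OF Hm Hr Hi b] H2 by simp
    next
      case False
      then show ?thesis by (rule radial_mixed_moment[OF Hm Hr b b'])
    qed
  qed
  obtain D where D: "0 \<le> D" and le: "\<And>n B \<psi> x. 1 \<le> n \<Longrightarrow> bdd_borel B \<psi> \<Longrightarrow>
     \<bar>(conv J ^^ n) \<psi> x - (conv (gauss p) ^^ n) \<psi> x\<bar> \<le> D / sqrt (real n) * B"
    using power_difference_le by blast
  show "\<exists>C\<ge>0. \<forall>n\<ge>1. \<forall>B \<psi> x. bdd_borel B \<psi> \<longrightarrow>
     \<bar>(conv J ^^ n) \<psi> x - conv (gauss (1 / (4 * a * real n))) \<psi> x\<bar> \<le> C / sqrt (real n) * B"
  proof (intro exI[of _ D] conjI D allI impI)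
    fix n :: nat and B and \<psi> :: "real^'n \<Rightarrow> real" and x assume n: "1 \<le> n" and \<psi>: "bdd_borel B \<psi>"
    obtain m where m: "n = Suc m" using n by (cases n) auto
    have "(conv (gauss p) ^^ n) \<psi> = conv (gauss (1 / (4 * a * real n))) \<psi>"
      using gauss_conv_power[OF p \<psi>, of m] by (simp add: m p_def)
    then show "\<bar>(conv J ^^ n) \<psi> x - conv (gauss (1 / (4 * a * real n))) \<psi> x\<bar> \<le> D / sqrt (real n) * B"
      using le[OF n \<psi>, of x] by simp
  qed
qed

section \<open>The semigroup of the jump process\<close>

definition poisson_weight :: "real \<Rightarrow> nat \<Rightarrow> real" where
  "poisson_weight t n = exp (- t) * t ^ n / fact n"

lemma poisson_weight_nonneg [simp]: "0 \<le> t \<Longrightarrow> 0 \<le> poisson_weight t n"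
  by (simp add: poisson_weight_def)

lemma exp_sums: "(\<lambda>n. (t::real) ^ n / fact n) sums exp t"
  using exp_converges[of t] by (simp add: divide_inverse mult.commute)

lemma poisson_weight_sums: "poisson_weight t sums 1"
proof -
  have "(\<lambda>n. exp (- t) * (t ^ n / fact n)) sums (exp (- t) * exp t)"
    by (rule sums_mult[OF exp_sums])
  then show ?thesis by (simp add: poisson_weight_def[abs_def] exp_add[symmetric])
qed

lemma poisson_weight_summable: "summable (poisson_weight t)"
  using poisson_weight_sums by (rule sums_summable)

lemma poisson_weight_Suc: "real (Suc n) * poisson_weight t (Suc n) = t * poisson_weight t n"
  by (simp add: poisson_weight_def field_simps del: of_nat_Suc)

lemma poisson_weight_0: "poisson_weight t 0 = exp (- t)"
  by (simp add: poisson_weight_def)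

lemma poisson_mean_sums: "(\<lambda>n. real n * poisson_weight t n) sums t"
proof -
  have "(\<lambda>n. real (Suc n) * poisson_weight t (Suc n)) sums (t * 1)"
    unfolding poisson_weight_Suc by (rule sums_mult[OF poisson_weight_sums])
  then show ?thesis by (subst (asm) sums_Suc_iff) simp
qed

lemma poisson_square_sums: "(\<lambda>n. (real n)\<^sup>2 * poisson_weight t n) sums (t\<^sup>2 + t)"
proof -
  have "(real (Suc n))\<^sup>2 * poisson_weight t (Suc n) = t * (real n * poisson_weight t n) + t * poisson_weight t n" for n
  proof -
    have "(real (Suc n))\<^sup>2 * poisson_weight t (Suc n) = real (Suc n) * (real (Suc n) * poisson_weight t (Suc n))"
      by (simp add: power2_eq_square)
    also have "\<dots> = real (Suc n) * (t * poisson_weight t n)" by (simp only: poisson_weight_Suc)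
    finally show ?thesis by (simp add: algebra_simps)
  qed
  moreover have "(\<lambda>n. t * (real n * poisson_weight t n) + t * poisson_weight t n) sums (t * t + t * 1)"
    by (intro sums_add sums_mult poisson_mean_sums poisson_weight_sums)
  ultimately have "(\<lambda>n. (real (Suc n))\<^sup>2 * poisson_weight t (Suc n)) sums (t * t + t)" by simp
  then show ?thesis by (subst (asm) sums_Suc_iff) (simp add: power2_eq_square)
qed

lemma poisson_variance_sums: "(\<lambda>n. (real n - t)\<^sup>2 * poisson_weight t n) sums t"
proof -
  have "(\<lambda>n. (real n)\<^sup>2 * poisson_weight t n - (2 * t) * (real n * poisson_weight t n) + t\<^sup>2 * poisson_weight t n)
     sums ((t\<^sup>2 + t) - (2 * t) * t + t\<^sup>2 * 1)"
    by (intro sums_add sums_diff sums_mult poisson_mean_sums poisson_weight_sums poisson_square_sums)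
  moreover have "(real n - t)\<^sup>2 * poisson_weight t n = (real n)\<^sup>2 * poisson_weight t n - (2 * t) * (real n * poisson_weight t n) + t\<^sup>2 * poisson_weight t n" for n
    by (simp add: power2_diff algebra_simps)
  ultimately show ?thesis by (simp add: power2_eq_square)
qed

lemma poisson_inverse_moment:
  assumes t: "0 < t"
  shows "summable (\<lambda>n. poisson_weight t n / real (Suc n))" "(\<Sum>n. poisson_weight t n / real (Suc n)) \<le> 1 / t"
proof -
  have eq: "poisson_weight t n / real (Suc n) = poisson_weight t (Suc n) / t" for n
    using poisson_weight_Suc[of n t] t by (simp add: frac_eq_eq mult.commute del: of_nat_Suc)
  have "(\<lambda>n. poisson_weight t (Suc n) / t) sums ((1 - poisson_weight t 0) / t)"
    using poisson_weight_sums[of t] by (intro sums_divide) (simp add: sums_Suc_iff)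
  then have s: "(\<lambda>n. poisson_weight t n / real (Suc n)) sums ((1 - poisson_weight t 0) / t)" by (simp only: eq)
  then show "summable (\<lambda>n. poisson_weight t n / real (Suc n))" by (rule sums_summable)
  show "(\<Sum>n. poisson_weight t n / real (Suc n)) \<le> 1 / t"
  proof -
    have "(1 - poisson_weight t 0) / t \<le> 1 / t"
      using t by (intro divide_right_mono) (auto simp: poisson_weight_0)
    then show ?thesis using sums_unique[OF s] by simp
  qed
qed

lemma poisson_weight_add: "(\<Sum>i\<le>k. poisson_weight s i * poisson_weight t (k - i)) = poisson_weight (s + t) k"
proof -
  have "poisson_weight (s + t) k = exp (- (s + t)) * (\<Sum>i\<le>k. real (k choose i) * s ^ i * t ^ (k - i)) / fact k"
    by (simp add: poisson_weight_def binomial_ring)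
  also have "\<dots> = (\<Sum>i\<le>k. exp (- (s + t)) * (real (k choose i) * s ^ i * t ^ (k - i)) / fact k)"
    by (simp add: sum_distrib_left sum_divide_distrib)
  also have "\<dots> = (\<Sum>i\<le>k. poisson_weight s i * poisson_weight t (k - i))"
  proof (rule sum.cong)
    fix i assume "i \<in> {..k}"
    then have "real (k choose i) / fact k = 1 / (fact i * fact (k - i))"
      by (simp add: binomial_fact)
    moreover have "exp (- (s + t)) * (real (k choose i) * s ^ i * t ^ (k - i)) / fact k
      = exp (- (s + t)) * (s ^ i * t ^ (k - i)) * (real (k choose i) / fact k)" by simp
    ultimately have "exp (- (s + t)) * (real (k choose i) * s ^ i * t ^ (k - i)) / fact k
      = exp (- (s + t)) * (s ^ i * t ^ (k - i)) * (1 / (fact i * fact (k - i)))" by (simp only:)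
    moreover have "exp (- (s + t)) = exp (- s) * exp (- t)" by (simp add: exp_add[symmetric])
    ultimately show "exp (- (s + t)) * (real (k choose i) * s ^ i * t ^ (k - i)) / fact k = poisson_weight s i * poisson_weight t (k - i)"
      by (simp only: poisson_weight_def) simp
  qed simp
  finally show ?thesis by simp
qed

text \<open>The sum of independent Poisson variables is Poisson, tested against a bounded function of the sum.\<close>

lemma poisson_double_sum:
  fixes g :: "nat \<Rightarrow> real"
  assumes s: "0 \<le> s" and t: "0 \<le> t" and g: "\<And>n. \<bar>g n\<bar> \<le> B"
  shows "(\<Sum>m. poisson_weight s m * (\<Sum>n. poisson_weight t n * g (m + n))) = (\<Sum>k. poisson_weight (s + t) k * g k)"
proof -
  let ?p = poisson_weight
  have hs: "(?p t has_sum 1) UNIV" if "0 \<le> t" for t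
    using sums_nonneg_imp_has_sum[OF poisson_weight_sums] that by simp
  define f where "f = (\<lambda>(m, n). ?p s m * ?p t n * g (m + n))"
  have "(\<lambda>x. norm (case x of (m, n) \<Rightarrow> ?p s m * ?p t n)) summable_on (UNIV \<times> UNIV)"
  proof (subst Infinite_Sum.abs_summable_on_Sigma_iff, intro conjI ballI)
    fix m :: nat
    show "(\<lambda>n. norm (case (m, n) of (m, n) \<Rightarrow> ?p s m * ?p t n)) summable_on UNIV"
      using summable_on_cmult_right[OF has_sum_imp_summable[OF hs[OF t]], of "\<bar>?p s m\<bar>"] t by (simp add: abs_mult)
  next
    have "infsum (\<lambda>n. norm (case (m, n) of (m, n) \<Rightarrow> ?p s m * ?p t n)) UNIV = ?p s m" for m
      using infsum_cmult_right'[of "?p s m" "?p t" UNIV] infsumI[OF hs[OF t]] s t by (simp add: abs_mult)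
    then show "(\<lambda>m. norm (infsum (\<lambda>n. norm (case (m, n) of (m, n) \<Rightarrow> ?p s m * ?p t n)) UNIV)) summable_on UNIV"
      using has_sum_imp_summable[OF hs[OF s]] s by simp
  qed
  then have prod: "(\<lambda>(m, n). ?p s m * ?p t n) summable_on (UNIV \<times> UNIV)"
    using s t by (simp add: case_prod_beta' abs_mult)
  have fs: "(\<lambda>x. norm (f x)) summable_on (UNIV \<times> UNIV)"
  proof (rule summable_on_comparison_test)
    show "(\<lambda>x. (case x of (m, n) \<Rightarrow> ?p s m * ?p t n) * \<bar>B\<bar>) summable_on (UNIV \<times> UNIV)"
      by (rule summable_on_cmult_left[OF prod])
    fix x :: "nat \<times> nat" 
    obtain m n where x: "x = (m, n)" by (cases x)
    have "\<bar>?p s m * ?p t n * g (m + n)\<bar> = ?p s m * ?p t n * \<bar>g (m + n)\<bar>"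
      using s t by (simp add: abs_mult)
    also have "\<dots> \<le> ?p s m * ?p t n * \<bar>B\<bar>"
      using g[of "m + n"] s t by (intro mult_left_mono) auto
    finally show "norm (f x) \<le> (case x of (m, n) \<Rightarrow> ?p s m * ?p t n) * \<bar>B\<bar>" by (simp add: x f_def)
  qed simp
  then have fs': "f summable_on (UNIV \<times> UNIV)" by (rule Infinite_Sum.abs_summable_summable)
  have inner: "infsum (\<lambda>n. f (m, n)) UNIV = ?p s m * (\<Sum>n. ?p t n * g (m + n))" for m
  proof -
    have "(\<lambda>n. f (m, n)) summable_on UNIV"
      using fs by (subst (asm) Infinite_Sum.abs_summable_on_Sigma_iff) (auto intro: Infinite_Sum.abs_summable_summable)
    then have "(\<lambda>n. f (m, n)) sums infsum (\<lambda>n. f (m, n)) UNIV"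
      by (intro has_sum_imp_sums has_sum_infsum)
    moreover have "summable (\<lambda>n. ?p t n * g (m + n))"
    proof (rule summable_comparison_test'[where N=0])
      show "summable (\<lambda>n. ?p t n * B)" by (rule summable_mult2[OF poisson_weight_summable])
      show "norm (?p t n * g (m + n)) \<le> ?p t n * B" for n using g[of "m + n"] t by (simp add: abs_mult mult_left_mono)
    qed
    then have "(\<lambda>n. f (m, n)) sums (?p s m * (\<Sum>n. ?p t n * g (m + n)))"
      unfolding f_def by (auto simp: mult.assoc intro: sums_mult summable_sums)
    ultimately show ?thesis by (rule sums_unique2)
  qed
  have "(\<lambda>m. infsum (\<lambda>n. f (m, n)) UNIV) summable_on UNIV"
    using summable_on_Sigma_banach[of "\<lambda>m n. f (m, n)" UNIV "\<lambda>_. UNIV"] fs' by simp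
  then have "(\<lambda>m. infsum (\<lambda>n. f (m, n)) UNIV) sums infsum (\<lambda>m. infsum (\<lambda>n. f (m, n)) UNIV) UNIV"
    by (intro has_sum_imp_sums has_sum_infsum)
  moreover have "infsum (\<lambda>m. infsum (\<lambda>n. f (m, n)) UNIV) UNIV = infsum f (UNIV \<times> UNIV)"
    using infsum_Sigma_banach[OF fs'] by simp
  ultimately have lhs: "(\<lambda>m. ?p s m * (\<Sum>n. ?p t n * g (m + n))) sums infsum f (UNIV \<times> UNIV)"
    by (simp add: inner)
  define h where "h = (\<lambda>(k, i). f (i, k - i))"
  define D where "D = (SIGMA k:(UNIV::nat set). {..k})"
  have bij: "bij_betw (\<lambda>(k, i). (i, k - i)) D (UNIV \<times> UNIV)"
    by (rule bij_betw_byWitness[where f'="\<lambda>(m, n). (m + n, m)"]) (auto simp: D_def)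
  have hs1: "h summable_on D"
    using summable_on_reindex_bij_betw[OF bij, of f] fs' by (simp add: h_def case_prod_beta')
  have hi: "infsum h D = infsum f (UNIV \<times> UNIV)"
    using infsum_reindex_bij_betw[OF bij, of f] by (simp add: h_def case_prod_beta')
  have hk: "infsum (\<lambda>i. h (k, i)) {..k} = ?p (s + t) k * g k" for k
  proof -
    have "infsum (\<lambda>i. h (k, i)) {..k} = (\<Sum>i\<le>k. ?p s i * ?p t (k - i) * g k)"
      by (simp add: h_def f_def)
    then show ?thesis by (simp add: sum_distrib_right[symmetric] poisson_weight_add)
  qed
  have "(\<lambda>k. infsum (\<lambda>i. h (k, i)) {..k}) summable_on UNIV"
    using summable_on_Sigma_banach[of "\<lambda>k i. h (k, i)" UNIV "\<lambda>k. {..k}"] hs1 by (simp add: D_def)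
  then have "(\<lambda>k. infsum (\<lambda>i. h (k, i)) {..k}) sums infsum (\<lambda>k. infsum (\<lambda>i. h (k, i)) {..k}) UNIV"
    by (intro has_sum_imp_sums has_sum_infsum)
  moreover have "infsum (\<lambda>k. infsum (\<lambda>i. h (k, i)) {..k}) UNIV = infsum h D"
    using infsum_Sigma_banach[of h UNIV "\<lambda>k. {..k}"] hs1 by (simp add: D_def)
  ultimately have "(\<lambda>k. ?p (s + t) k * g k) sums infsum f (UNIV \<times> UNIV)"
    by (simp add: hk hi)
  from sums_unique[OF lhs] sums_unique[OF this] show ?thesis by simp
qed

text \<open>The semigroup with generator \<open>conv K - id\<close>, as the exponential series: a random walk with step
  distribution \<open>K\<close> observed after a Poisson number of steps.\<close>

definition jump_semigroup :: "('a::euclidean_space \<Rightarrow> real) \<Rightarrow> real \<Rightarrow> ('a \<Rightarrow> real) \<Rightarrow> 'a \<Rightarrow> real" where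
  "jump_semigroup K t f x = (\<Sum>n. poisson_weight t n * (conv K ^^ n) f x)"

locale prob_kernel =
  fixes K :: "'a::euclidean_space \<Rightarrow> real"
  assumes int: "integrable lborel K" and nonneg: "\<And>z. 0 \<le> K z" and mass: "(LINT z|lborel. K z) = 1"
begin

lemma summand_bdd:
  assumes "bdd_borel B f" "0 \<le> t"
  shows "bdd_borel (poisson_weight t n * B) (\<lambda>x. poisson_weight t n * (conv K ^^ n) f x)"
  using bdd_borel_cmult[OF bdd_borel_conv_power[OF int nonneg mass assms(1)], of "poisson_weight t n" n] assms(2) by simp

lemma bdd_jump_semigroup:
  assumes f: "bdd_borel B f" and t: "0 \<le> t"
  shows "bdd_borel B (jump_semigroup K t f)"
proof -
  have "(\<Sum>n. poisson_weight t n * B) = B"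
    using sums_unique[OF sums_mult2[OF poisson_weight_sums[of t], of B]] by simp
  then show ?thesis
    using conv_suminf(3)[OF int summand_bdd[OF f t] summable_mult2[OF poisson_weight_summable]]
    by (simp add: jump_semigroup_def[abs_def])
qed

lemma summable_jump_semigroup:
  assumes f: "bdd_borel B f" and t: "0 \<le> t"
  shows "summable (\<lambda>n. poisson_weight t n * (conv K ^^ n) f x)"
  using conv_suminf(2)[OF int summand_bdd[OF f t] summable_mult2[OF poisson_weight_summable]] .

lemma conv_jump_semigroup:
  assumes f: "bdd_borel B f" and t: "0 \<le> t" and H: "integrable lborel H"
  shows "conv H (jump_semigroup K t f) = jump_semigroup K t (conv H f)"
proof
  fix x
  have "conv H (jump_semigroup K t f) x = (\<Sum>n. conv H (\<lambda>x. poisson_weight t n * (conv K ^^ n) f x) x)"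
    using conv_suminf(1)[OF H summand_bdd[OF f t] summable_mult2[OF poisson_weight_summable]]
    by (simp add: jump_semigroup_def[abs_def])
  also have "\<dots> = (\<Sum>n. poisson_weight t n * (conv K ^^ n) (conv H f) x)"
    by (simp only: conv_cmult conv_power_commute[OF int nonneg mass H f])
  finally show "conv H (jump_semigroup K t f) x = jump_semigroup K t (conv H f) x"
    by (simp add: jump_semigroup_def)
qed

lemma conv_power_jump_semigroup:
  assumes f: "bdd_borel B f" and t: "0 \<le> t"
  shows "(conv K ^^ m) (jump_semigroup K t f) = jump_semigroup K t ((conv K ^^ m) f)"
proof (induction m)
  case (Suc m)
  then show ?case
    using conv_jump_semigroup[OF bdd_borel_conv_power[OF int nonneg mass f] t int] by simp
qed simp

lemma jump_semigroup_add:
  assumes f: "bdd_borel B f" and s: "0 \<le> s" and t: "0 \<le> t"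
  shows "jump_semigroup K s (jump_semigroup K t f) = jump_semigroup K (s + t) f"
proof
  fix x
  have pow: "(conv K ^^ n) ((conv K ^^ m) f) = (conv K ^^ (m + n)) f" for m n
    by (simp only: add.commute[of m n] funpow_add comp_apply)
  have "jump_semigroup K s (jump_semigroup K t f) x
     = (\<Sum>m. poisson_weight s m * (\<Sum>n. poisson_weight t n * (conv K ^^ (m + n)) f x))"
    unfolding jump_semigroup_def[of K s] conv_power_jump_semigroup[OF f t]
    unfolding jump_semigroup_def[of K t]
    by (simp only: pow)
  also have "\<dots> = jump_semigroup K (s + t) f x"
    unfolding jump_semigroup_def
    using poisson_double_sum[OF s t, of "\<lambda>k. (conv K ^^ k) f x" B] bdd_borel_le[OF bdd_borel_conv_power[OF int nonneg mass f]]
    by simp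
  finally show "jump_semigroup K s (jump_semigroup K t f) x = jump_semigroup K (s + t) f x" .
qed

end

text \<open>Given the number \<open>n\<close> of steps, the walk is close to the heat kernel at time \<open>n\<close>, and this is
  close to the heat kernel at time \<open>t\<close> up to \<open>\<bar>n - t\<bar> / t\<close>. Both errors are averaged over the Poisson law, where
  \<open>n\<close> fluctuates around \<open>t\<close> by the square root of \<open>t\<close>.\<close>

theorem jump_gauss_difference:
  fixes J :: "real^'n \<Rightarrow> real"
  assumes J: "convolution_kernel J"
  defines "a \<equiv> diffusivity J"
  shows "\<exists>C\<ge>0. \<forall>t>0. \<forall>B \<psi> x. bdd_borel B \<psi> \<longrightarrow>
     \<bar>jump_semigroup J t \<psi> x - conv (gauss (1 / (4 * a * t))) \<psi> x\<bar> \<le> C / sqrt t * B"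
proof -
  have a: "0 < a" unfolding a_def by (rule conv_power_gauss_difference(1)[OF J])
  interpret prob_kernel J
    by unfold_locales (rule conv_power_gauss_difference(3-5)[OF J])+
  obtain D where D: "0 \<le> D" and Dle: "\<And>n B \<psi> x. 1 \<le> n \<Longrightarrow> bdd_borel B \<psi> \<Longrightarrow>
     \<bar>(conv J ^^ n) \<psi> x - conv (gauss (1 / (4 * a * real n))) \<psi> x\<bar> \<le> D / sqrt (real n) * B"
    using conv_power_gauss_difference(6)[OF J] unfolding a_def by blast
  let ?d = "real DIM(real^'n)"
  have d1: "1 \<le> ?d" using DIM_positive[where 'a="real^'n"] by linarith
  have time: "\<bar>conv (gauss (1 / (4 * a * s))) \<psi> x - conv (gauss (1 / (4 * a * t))) \<psi> x\<bar> \<le> 2 * ?d * (\<bar>s - t\<bar> / t) * B"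
    if s: "0 < s" and t: "0 < t" and \<psi>: "bdd_borel B \<psi>" for s t B x and \<psi> :: "real^'n \<Rightarrow> real"
  proof (cases "s \<le> t")
    case True
    have "1 - 1 / (4 * a * t) / (1 / (4 * a * s)) = \<bar>s - t\<bar> / t"
      using a s t True by (simp add: field_simps)
    then show ?thesis
      using gauss_conv_difference_le[of "1 / (4 * a * t)" "1 / (4 * a * s)" B \<psi> x] a s t True \<psi>
      by (simp add: divide_simps)
  next
    case False
    have "1 - 1 / (4 * a * s) / (1 / (4 * a * t)) = \<bar>s - t\<bar> / s"
      using a s t False by (simp add: field_simps)
    moreover have "\<bar>s - t\<bar> / s \<le> \<bar>s - t\<bar> / t" using False s t by (intro divide_left_mono) auto
    ultimately have "1 - 1 / (4 * a * s) / (1 / (4 * a * t)) \<le> \<bar>s - t\<bar> / t" by simp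
    then have "2 * ?d * (1 - 1 / (4 * a * s) / (1 / (4 * a * t))) * B \<le> 2 * ?d * (\<bar>s - t\<bar> / t) * B"
      using bdd_borel_nonneg[OF \<psi>] by (intro mult_right_mono mult_left_mono) auto
    moreover have "\<bar>conv (gauss (1 / (4 * a * t))) \<psi> x - conv (gauss (1 / (4 * a * s))) \<psi> x\<bar>
       \<le> 2 * ?d * (1 - 1 / (4 * a * s) / (1 / (4 * a * t))) * B"
      by (rule gauss_conv_difference_le) (use a s t False \<psi> in \<open>auto simp: divide_simps\<close>)
    ultimately show ?thesis by (simp add: abs_minus_commute)
  qed
  define C where "C = sqrt 2 * D + 2 * ?d"
  show ?thesis
  proof (intro exI[of _ C] conjI allI impI)
    show "0 \<le> C" using D by (simp add: C_def)
    fix t :: real and B and \<psi> :: "real^'n \<Rightarrow> real" and x assume t: "0 < t" and \<psi>: "bdd_borel B \<psi>"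
    have B: "0 \<le> B" by (rule bdd_borel_nonneg[OF \<psi>])
    let ?p = "1 / (4 * a * t)"
    define q where "q = conv (gauss ?p) \<psi> x"
    have p: "0 < ?p" using a t by simp
    have qB: "\<bar>q\<bar> \<le> B"
      unfolding q_def using bdd_borel_le[OF bdd_borel_conv_prob[OF gauss_integrable[OF p] gauss_nonneg gauss_integral[OF p] \<psi>]] .
    define w where "w = poisson_weight t"
    \<comment> \<open>Both errors are turned into linear expressions in 1 / Suc n and (n - t)^2, whose Poisson means are explicit.\<close>
    define b where "b n = (sqrt t / real (Suc n) + 1 / sqrt t) / 2 * (sqrt 2 * D * B) + ((real n - t)\<^sup>2 / sqrt t + sqrt t) / 2 * (2 * ?d * B / t)" for n
    have st: "sqrt t * sqrt t = t" "0 < sqrt t" using t by simp_all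
    have amgm: "\<bar>real n - t\<bar> \<le> ((real n - t)\<^sup>2 / sqrt t + sqrt t) / 2" for n
    proof -
      have "0 \<le> (\<bar>real n - t\<bar> - sqrt t)\<^sup>2 / sqrt t" using st by simp
      also have "\<dots> = (real n - t)\<^sup>2 / sqrt t + sqrt t - 2 * \<bar>real n - t\<bar>"
        using st by (simp add: power2_diff add_divide_distrib diff_divide_distrib real_div_sqrt)
      finally show ?thesis by simp
    qed
    have amgm2: "1 / sqrt (real (Suc n)) \<le> (sqrt t / real (Suc n) + 1 / sqrt t) / 2" for n
    proof -
      let ?m = "sqrt (real (Suc n))"
      have m: "0 < ?m" "?m * ?m = real (Suc n)" by simp_all
      have "0 \<le> (sqrt t / ?m - 1)\<^sup>2 / sqrt t" using st by simp
      also have "\<dots> = sqrt t / (?m * ?m) + 1 / sqrt t - 2 * (1 / ?m)"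
      proof -
        have "(r / m - 1)\<^sup>2 / r = r / (m * m) + 1 / r - 2 * (1 / m)" if "0 < r" "0 < m" for r m :: real
        proof -
          have "(r / m - 1)\<^sup>2 = r * (r / (m * m)) + 1 - r * (2 * (1 / m))"
            by (simp only: power2_diff) (simp add: power2_eq_square)
          then show ?thesis using that by (simp add: diff_divide_distrib add_divide_distrib)
        qed
        then show ?thesis using st(2) m(1) by blast
      qed
      finally show ?thesis by (simp add: m(2) del: of_nat_Suc)
    qed
    have le: "\<bar>(conv J ^^ n) \<psi> x - q\<bar> \<le> b n" for n
    proof -
      have "\<bar>(conv J ^^ n) \<psi> x - q\<bar> \<le> 1 / sqrt (real (Suc n)) * (sqrt 2 * D * B) + \<bar>real n - t\<bar> * (2 * ?d * B / t)"
      proof (cases "n = 0")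
        case True
        have "\<bar>(conv J ^^ n) \<psi> x - q\<bar> \<le> 2 * B"
          using True qB bdd_borel_le[OF \<psi>, of x] by simp
        also have "\<dots> \<le> 2 * ?d * B" using mult_right_mono[OF d1 B] by simp
        also have "\<dots> = \<bar>real n - t\<bar> * (2 * ?d * B / t)" using True t by simp
        also have "\<dots> \<le> 1 / sqrt (real (Suc n)) * (sqrt 2 * D * B) + \<dots>" using D B by simp
        finally show ?thesis .
      next
        case False
        then have n: "1 \<le> n" "0 < real n" by auto
        have "\<bar>(conv J ^^ n) \<psi> x - q\<bar> \<le> D / sqrt (real n) * B + 2 * ?d * (\<bar>real n - t\<bar> / t) * B"
          using Dle[OF n(1) \<psi>, of x] time[OF n(2) t \<psi>, of x] unfolding q_def by linarith
        also have "D / sqrt (real n) * B \<le> D * (sqrt 2 / sqrt (real (Suc n))) * B"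
        proof -
          have "sqrt (real (Suc n)) \<le> sqrt (2 * real n)" using n by (intro real_sqrt_le_mono) simp
          then have "1 / sqrt (real n) \<le> sqrt 2 / sqrt (real (Suc n))"
            using n by (simp add: divide_simps real_sqrt_mult del: of_nat_Suc)
          then have "D * (1 / sqrt (real n)) * B \<le> D * (sqrt 2 / sqrt (real (Suc n))) * B"
            using D B by (intro mult_right_mono mult_left_mono) auto
          then show ?thesis by simp
        qed
        finally show ?thesis by (simp add: mult_ac)
      qed
      also have "\<dots> \<le> b n"
        unfolding b_def using amgm amgm2 D B t by (intro add_mono mult_right_mono) auto
      finally show ?thesis .
    qed
    have inv: "(\<lambda>n. w n / real (Suc n)) sums (\<Sum>n. w n / real (Suc n))"
      unfolding w_def by (rule summable_sums[OF poisson_inverse_moment(1)[OF t]])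
    define I where "I = (\<Sum>n. w n / real (Suc n))"
    have I: "I \<le> 1 / t" unfolding I_def w_def by (rule poisson_inverse_moment(2)[OF t])
    have "(\<lambda>n. (sqrt t * (w n / real (Suc n)) + 1 / sqrt t * w n) / 2 * (sqrt 2 * D * B)
         + (1 / sqrt t * ((real n - t)\<^sup>2 * w n) + sqrt t * w n) / 2 * (2 * ?d * B / t))
       sums ((sqrt t * I + 1 / sqrt t * 1) / 2 * (sqrt 2 * D * B) + (1 / sqrt t * t + sqrt t * 1) / 2 * (2 * ?d * B / t))"
      unfolding I_def using inv poisson_weight_sums[of t] poisson_variance_sums[of t] unfolding w_def
      by (intro sums_add sums_mult sums_mult2 sums_divide) auto
    moreover have "w n * b n = (sqrt t * (w n / real (Suc n)) + 1 / sqrt t * w n) / 2 * (sqrt 2 * D * B)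
         + (1 / sqrt t * ((real n - t)\<^sup>2 * w n) + sqrt t * w n) / 2 * (2 * ?d * B / t)" for n
      by (simp add: b_def algebra_simps add_divide_distrib)
    ultimately have bs: "(\<lambda>n. w n * b n) sums ((sqrt t * I + 1 / sqrt t) / 2 * (sqrt 2 * D * B) + (1 / sqrt t * t + sqrt t) / 2 * (2 * ?d * B / t))"
      by simp
    have tot: "(sqrt t * I + 1 / sqrt t) / 2 * (sqrt 2 * D * B) + (1 / sqrt t * t + sqrt t) / 2 * (2 * ?d * B / t) \<le> C / sqrt t * B"
    proof -
      have "sqrt t * I \<le> sqrt t * (1 / t)" using I t by (intro mult_left_mono) auto
      also have "\<dots> = 1 / sqrt t" using t st by (simp add: divide_simps)
      finally have "(sqrt t * I + 1 / sqrt t) / 2 \<le> 1 / sqrt t" by simp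
      then have "(sqrt t * I + 1 / sqrt t) / 2 * (sqrt 2 * D * B) \<le> 1 / sqrt t * (sqrt 2 * D * B)"
        using D B by (intro mult_right_mono) auto
      moreover have "(1 / sqrt t * t + sqrt t) / 2 * (2 * ?d * B / t) = 1 / sqrt t * (2 * ?d * B)"
      proof -
        have 1: "1 / sqrt t * t = sqrt t" and 2: "sqrt t / t = 1 / sqrt t"
          using st t by (simp_all add: real_div_sqrt divide_eq_eq eq_divide_eq)
        have "(1 / sqrt t * t + sqrt t) / 2 * (2 * ?d * B / t) = sqrt t / t * (2 * ?d * B)"
          unfolding 1 by simp
        then show ?thesis unfolding 2 .
      qed
      ultimately show ?thesis by (simp add: C_def distrib_right add_divide_distrib)
    qed
    have sd: "(\<lambda>n. w n * ((conv J ^^ n) \<psi> x - q)) sums (jump_semigroup J t \<psi> x - q)"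
    proof -
      have "(\<lambda>n. w n * (conv J ^^ n) \<psi> x) sums jump_semigroup J t \<psi> x"
        unfolding w_def jump_semigroup_def by (rule summable_sums[OF summable_jump_semigroup[OF \<psi>]]) (use t in simp)
      moreover have "(\<lambda>n. w n * q) sums (1 * q)" unfolding w_def by (rule sums_mult2[OF poisson_weight_sums])
      ultimately show ?thesis using sums_diff by (fastforce simp: right_diff_distrib)
    qed
    have w0: "0 \<le> w n" for n using t by (simp add: w_def)
    have abss: "summable (\<lambda>n. \<bar>w n * ((conv J ^^ n) \<psi> x - q)\<bar>)"
      by (rule summable_comparison_test'[OF sums_summable[OF bs], where N=0])
         (use le w0 in \<open>auto simp: abs_mult intro!: mult_left_mono\<close>)
    have "\<bar>jump_semigroup J t \<psi> x - q\<bar> \<le> (\<Sum>n. \<bar>w n * ((conv J ^^ n) \<psi> x - q)\<bar>)"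
      using summable_rabs[OF abss] sums_unique[OF sd] by simp
    also have "\<dots> \<le> (\<Sum>n. w n * b n)"
      by (rule suminf_le[OF _ abss sums_summable[OF bs]]) (use le w0 in \<open>auto simp: abs_mult intro!: mult_left_mono\<close>)
    also have "\<dots> \<le> C / sqrt t * B" using sums_unique[OF bs] tot by simp
    finally show "\<bar>jump_semigroup J t \<psi> x - conv (gauss ?p) \<psi> x\<bar> \<le> C / sqrt t * B" by (simp add: q_def)
  qed
qed

section \<open>Bounded solutions of the nonlocal equation\<close>

lemma AE_lborel_ex_in_interval:
  fixes a b :: real
  assumes "AE t in lborel. P t" "a < b"
  shows "\<exists>t. a < t \<and> t < b \<and> P t"
proof (rule ccontr)
  assume "\<not> (\<exists>t. a < t \<and> t < b \<and> P t)"
  then have "AE t in lborel. t \<notin> {a<..<b}"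
    using assms(1) by (auto elim!: eventually_mono)
  then have "emeasure lborel {a<..<b} = 0"
    by (subst (asm) AE_iff_measurable[OF _ refl]) (auto simp: greaterThanLessThan_def greaterThan_def lessThan_def Int_def)
  then show False using assms(2) by simp
qed

lemma AE_swap_lborel:
  fixes P :: "'a::euclidean_space \<Rightarrow> real \<Rightarrow> bool"
  assumes "AE p in lborel. P (fst p) (snd p)"
  shows "AE t in lborel. AE x in lborel. P x t"
proof -
  have "AE p in (lborel \<Otimes>\<^sub>M lborel). P (fst p) (snd p)" using assms unfolding lborel_prod[symmetric] .
  then obtain N where N: "N \<in> sets (lborel \<Otimes>\<^sub>M lborel)" "emeasure (lborel \<Otimes>\<^sub>M lborel) N = 0"
     "{p \<in> space (lborel \<Otimes>\<^sub>M lborel). \<not> P (fst p) (snd p)} \<subseteq> N"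
    unfolding eventually_ae_filter null_sets_def by blast
  have N0: "AE p in (lborel \<Otimes>\<^sub>M lborel). p \<notin> N" using N(1,2) by (intro AE_not_in) auto
  then have "AE x in lborel. AE t in lborel. (x, t) \<notin> N" by (rule lborel_pair.AE_pair)
  moreover have "{p \<in> space (lborel \<Otimes>\<^sub>M lborel). (fst p, snd p) \<notin> N} \<in> sets (lborel \<Otimes>\<^sub>M lborel)"
  proof -
    have "{p \<in> space (lborel \<Otimes>\<^sub>M lborel). (fst p, snd p) \<notin> N} = space (lborel \<Otimes>\<^sub>M lborel) - N" by auto
    then show ?thesis using N(1) by (simp only: sets.compl_sets)
  qed
  ultimately have "AE t in lborel. AE x in lborel. (x, t) \<notin> N"
    using lborel_pair.AE_commute[of "\<lambda>x t. (x, t) \<notin> N"] by blast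
  moreover have "P x t" if "(x, t) \<notin> N" for x t
    using subsetD[OF N(3), of "(x, t)"] that by (auto simp: space_pair_measure)
  ultimately show ?thesis by (auto elim!: eventually_mono)
qed

text \<open>Almost every time slice is measurable by Fubini's theorem, and by continuity in time every slice is a
  pointwise limit of such slices from the right.\<close>

lemma solution_slice_measurable:
  fixes u :: "real^'n \<Rightarrow> real \<Rightarrow> real"
  assumes meas: "(\<lambda>(x, t). u x t) \<in> borel_measurable (lebesgue_on (UNIV \<times> {0..}))"
    and cont: "\<And>x. continuous_on {0..} (u x)" and t: "0 \<le> t"
  shows "(\<lambda>x. u x t) \<in> borel_measurable lebesgue"
proof -
  define v where "v = (\<lambda>p::(real^'n) \<times> real. if p \<in> UNIV \<times> {0..} then (case p of (x, t) \<Rightarrow> u x t) else 0)"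
  have "closed ((UNIV :: (real^'n) set) \<times> {0::real..})" by (intro closed_Times) auto
  then have "(UNIV :: (real^'n) set) \<times> {0::real..} \<in> sets borel" by (rule borel_closed)
  then have "(UNIV :: (real^'n) set) \<times> {0::real..} \<in> sets lebesgue" by simp
  then have "v \<in> borel_measurable lebesgue"
    unfolding v_def using meas by (simp add: borel_measurable_if)
  then obtain v' where v': "v' \<in> borel_measurable lborel" "AE p in lborel. v p = v' p"
    using completion_ex_borel_measurable_real by blast
  have [measurable]: "v' \<in> borel_measurable (borel \<Otimes>\<^sub>M borel)"
    using v'(1) by (simp add: borel_prod)
  have "AE s in lborel. AE x in lborel. v (x, s) = v' (x, s)"
    by (rule AE_swap_lborel) (use v'(2) in simp)
  then have good: "AE s in lborel. s \<ge> 0 \<longrightarrow> (\<lambda>x. u x s) \<in> borel_measurable lebesgue"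
  proof eventually_elim
    fix s assume s: "AE x in lborel. v (x, s) = v' (x, s)"
    show "s \<ge> 0 \<longrightarrow> (\<lambda>x. u x s) \<in> borel_measurable lebesgue"
    proof
      assume "s \<ge> 0"
      show "(\<lambda>x. u x s) \<in> borel_measurable lebesgue"
      proof (rule borel_measurable_AE)
        show "(\<lambda>x. v' (x, s)) \<in> borel_measurable lebesgue"
          by (rule measurable_completion) measurable
        show "AE x in lebesgue. v' (x, s) = u x s"
          using AE_completion[OF s] \<open>s \<ge> 0\<close> by (auto simp: v_def)
      qed
    qed
  qed
  have "\<exists>s. t < s \<and> s < t + 1 / real (Suc n) \<and> (s \<ge> 0 \<longrightarrow> (\<lambda>x. u x s) \<in> borel_measurable lebesgue)" for n
    by (rule AE_lborel_ex_in_interval[OF good]) simp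
  then obtain s where s: "\<And>n. t < s n" "\<And>n. s n < t + 1 / real (Suc n)" "\<And>n. s n \<ge> 0 \<Longrightarrow> (\<lambda>x. u x (s n)) \<in> borel_measurable lebesgue"
    by metis
  have s0: "s n \<ge> 0" for n using s(1)[of n] t by linarith
  have "(\<lambda>n. t + 1 / real (Suc n)) \<longlonglongrightarrow> t + 0"
    by (intro tendsto_add tendsto_const LIMSEQ_Suc[OF lim_1_over_n])
  then have slim: "s \<longlonglongrightarrow> t"
    by (intro real_tendsto_sandwich[of "\<lambda>_. t" s sequentially "\<lambda>n. t + 1 / real (Suc n)" t])
       (use s in \<open>auto intro!: always_eventually less_imp_le\<close>)
  show ?thesis
  proof (rule borel_measurable_LIMSEQ_real[where u="\<lambda>n x. u x (s n)"])
    show "(\<lambda>n. u x (s n)) \<longlonglongrightarrow> u x t" for x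
      using continuous_on_tendsto_compose[OF cont slim] t s0 by (auto intro: always_eventually)
    show "(\<lambda>x. u x (s n)) \<in> borel_measurable lebesgue" for n by (rule s(3)[OF s0])
  qed
qed

text \<open>Convolutions do not see null sets, so a Lebesgue measurable function may be replaced by a Borel
  representative.\<close>

lemma lebesgue_conv_eq:
  fixes K :: "'a::euclidean_space \<Rightarrow> real"
  assumes [measurable]: "K \<in> borel_measurable borel" "\<phi> \<in> borel_measurable borel"
    and f: "f \<in> borel_measurable lebesgue" "AE y in lborel. f y = \<phi> y"
  shows "(LINT y|lebesgue. K (x - y) * f y) = conv K \<phi> x"
proof -
  have "(LINT y|lebesgue. K (x - y) * f y) = (LINT y|lebesgue. K (x - y) * \<phi> y)"
  proof (rule integral_cong_AE)
    show "(\<lambda>y. K (x - y) * f y) \<in> borel_measurable lebesgue"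
      by (rule borel_measurable_times[OF measurable_completion f(1)]) measurable
    show "(\<lambda>y. K (x - y) * \<phi> y) \<in> borel_measurable lebesgue" by (rule measurable_completion) measurable
    show "AE y in lebesgue. K (x - y) * f y = K (x - y) * \<phi> y"
      using AE_completion[OF f(2)] by eventually_elim simp
  qed
  also have "\<dots> = (LINT y|lborel. K (x - y) * \<phi> y)" by (rule integral_completion) measurable
  finally show ?thesis by (simp add: conv_flip)
qed

lemma lebesgue_conv_integrable:
  fixes K :: "'a::euclidean_space \<Rightarrow> real"
  assumes K: "integrable lborel K" and f: "f \<in> borel_measurable lebesgue" "\<And>y. \<bar>f y\<bar> \<le> B"
  shows "integrable lebesgue (\<lambda>y. K (x - y) * f y)"
proof (rule Bochner_Integration.integrable_bound)
  have [measurable]: "K \<in> borel_measurable borel" using K by auto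
  have "integrable lborel (\<lambda>y. K (x - y))" using K by (simp add: lborel_integrable_reflect)
  then show "integrable lebesgue (\<lambda>y. B * \<bar>K (x - y)\<bar>)" by (subst integrable_completion) auto
  show "(\<lambda>y. K (x - y) * f y) \<in> borel_measurable lebesgue"
    by (rule borel_measurable_times[OF measurable_completion f(1)]) measurable
  show "AE y in lebesgue. norm (K (x - y) * f y) \<le> norm (B * \<bar>K (x - y)\<bar>)"
    using f(2) order_trans[OF abs_ge_zero f(2)] by (intro AE_I2) (simp add: abs_mult mult.commute[of B] mult_left_mono)
qed

lemma abs_le_power_integral:
  fixes h :: "real \<Rightarrow> real"
  assumes h0: "h 0 = 0" and cont: "continuous_on {0..t} h" and t: "0 \<le> t"
    and der: "\<And>s. 0 < s \<Longrightarrow> s < t \<Longrightarrow> (h has_real_derivative h' s) (at s)"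
    and le: "\<And>s. 0 < s \<Longrightarrow> s < t \<Longrightarrow> \<bar>h' s\<bar> \<le> L * (s ^ k / fact k)"
  shows "\<bar>h t\<bar> \<le> L * (t ^ Suc k / fact (Suc k))"
proof (cases "t = 0")
  case False
  then have t0: "0 < t" using t by simp
  let ?P = "\<lambda>s. L * (s ^ Suc k / fact (Suc k))"
  have P: "(?P has_real_derivative L * (s ^ k / fact k)) (at s)" for s
  proof -
    have "((\<lambda>s. s ^ Suc k / fact (Suc k)) has_real_derivative (real (Suc k) * s ^ k) / fact (Suc k)) (at s)"
      using DERIV_cdivide[OF DERIV_pow[of "Suc k" s], of "fact (Suc k)"] by (simp del: of_nat_Suc fact_Suc power_Suc)
    moreover have "(real (Suc k) * s ^ k) / fact (Suc k) = s ^ k / fact k"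
      by (simp add: fact_Suc del: of_nat_Suc)
    ultimately show ?thesis by (metis DERIV_cmult)
  qed
  have Pc: "continuous_on {0..t} ?P" by (intro continuous_intros) simp
  have "?P 0 - h 0 \<le> ?P t - h t"
  proof (rule DERIV_nonneg_imp_increasing_open[OF t])
    fix s assume s: "0 < s" "s < t"
    show "\<exists>y. ((\<lambda>s. ?P s - h s) has_real_derivative y) (at s) \<and> 0 \<le> y"
      using DERIV_diff[OF P der[OF s]] le[OF s] by (intro exI conjI) auto
  qed (intro continuous_on_diff Pc cont)
  moreover have "?P 0 + h 0 \<le> ?P t + h t"
  proof (rule DERIV_nonneg_imp_increasing_open[OF t])
    fix s assume s: "0 < s" "s < t"
    show "\<exists>y. ((\<lambda>s. ?P s + h s) has_real_derivative y) (at s) \<and> 0 \<le> y"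
      using DERIV_add[OF P der[OF s]] le[OF s] by (intro exI conjI) auto
  qed (intro continuous_on_add Pc cont)
  ultimately show ?thesis using h0 by (simp add: abs_le_iff)
qed (simp add: h0)

lemma exponential_sum_derivative:
  fixes c :: "nat \<Rightarrow> real"
  shows "((\<lambda>t. \<Sum>n<Suc k. t ^ n / fact n * c n) has_real_derivative (\<Sum>n<k. t ^ n / fact n * c (Suc n))) (at t)"
proof -
  have "((\<lambda>t. \<Sum>n<k. t ^ Suc n / fact (Suc n) * c (Suc n)) has_real_derivative (\<Sum>n<k. t ^ n / fact n * c (Suc n))) (at t)"
  proof (rule DERIV_sum)
    fix n
    have "((\<lambda>s. s ^ Suc n / fact (Suc n)) has_real_derivative (real (Suc n) * t ^ n) / fact (Suc n)) (at t)"
      using DERIV_cdivide[OF DERIV_pow[of "Suc n" t], of "fact (Suc n)"] by (simp del: of_nat_Suc fact_Suc power_Suc)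
    moreover have "(real (Suc n) * t ^ n) / fact (Suc n) = t ^ n / fact n"
      by (simp add: fact_Suc del: of_nat_Suc)
    ultimately show "((\<lambda>t. t ^ Suc n / fact (Suc n) * c (Suc n)) has_real_derivative t ^ n / fact n * c (Suc n)) (at t)"
      by (metis DERIV_cmult_right)
  qed
  from DERIV_add[OF DERIV_const[of "c 0"] this] show ?thesis
    by (simp add: sum.lessThan_Suc_shift del: sum.lessThan_Suc)
qed

text \<open>The function \<open>exp t * u x t\<close>
  has time derivative its own convolution with \<open>J\<close>; after subtracting the partial sums of the
  exponential series, the remainder of order \<open>k + 1\<close> is a time integral of the convolution of the remainder of
  order \<open>k\<close>, hence it is at most of order \<open>t ^ k / fact k\<close> and tends to 0. The term
  with \<open>u0 x - \<phi> x\<close> is the part of the datum on a null set, which is never moved by the jumps.\<close>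

theorem nonlocal_solution_representation:
  fixes J :: "real^'n \<Rightarrow> real"
  assumes J: "convolution_kernel J" and sol: "nonlocal_solution J u0 u"
    and u0: "u0 \<in> borel_measurable lebesgue" "\<And>x. \<bar>u0 x\<bar> \<le> M"
    and \<phi>: "bdd_borel M \<phi>" "AE x in lborel. u0 x = \<phi> x"
    and t: "0 \<le> t"
  shows "u x t = exp (- t) * (u0 x - \<phi> x) + jump_semigroup J t \<phi> x"
proof -
  interpret prob_kernel J
    by unfold_locales (rule conv_power_gauss_difference(3-5)[OF J])+
  have [measurable]: "J \<in> borel_measurable borel" using int by auto
  have [measurable]: "\<phi> \<in> borel_measurable borel" using \<phi>(1) by (rule bdd_borel_meas)
  have smeas: "(\<lambda>(x, t). u x t) \<in> borel_measurable (lebesgue_on (UNIV \<times> {0..}))"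
    and C1: "\<And>x. C1_nonneg (u x)"
    and der: "\<And>x t. 0 < t \<Longrightarrow> (u x has_real_derivative (LINT y|lebesgue. J (x - y) * (u y t - u x t))) (at t)"
    and init: "\<And>x. u x 0 = u0 x"
    using sol by (auto simp: nonlocal_solution_def)
  obtain Mu where Mu: "\<And>x t. 0 \<le> t \<Longrightarrow> \<bar>u x t\<bar> \<le> Mu"
    using sol by (auto simp: nonlocal_solution_def)
  have cont: "continuous_on {0..} (u x)" for x
  proof -
    obtain D where "\<And>t. t \<ge> 0 \<Longrightarrow> (u x has_real_derivative D t) (at t within {0..})"
      using C1[of x] unfolding C1_nonneg_def by blast
    then show ?thesis by (intro DERIV_continuous_on) auto
  qed
  have um: "(\<lambda>x. u x t) \<in> borel_measurable lebesgue" if "0 \<le> t" for t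
    by (rule solution_slice_measurable[OF smeas cont that])
  have J1: "(LINT y|lebesgue. J (x - y)) = 1" and J1i: "integrable lebesgue (\<lambda>y. J (x - y))" for x
  proof -
    show "(LINT y|lebesgue. J (x - y)) = 1"
      using lborel_integral_reflect[of J x] mass by (subst integral_completion) auto
    show "integrable lebesgue (\<lambda>y. J (x - y))"
      using int by (subst integrable_completion) (auto simp: lborel_integrable_reflect)
  qed
  define T where "T n = (conv J ^^ n) \<phi>" for n
  have T: "bdd_borel M (T n)" for n unfolding T_def by (rule bdd_borel_conv_power[OF int nonneg mass \<phi>(1)])
  have Tm [measurable]: "T n \<in> borel_measurable borel" for n by (rule bdd_borel_meas[OF T])
  define S where "S k t x = (\<Sum>n<k. t ^ n / fact n * T n x)" for k t x
  \<comment> \<open>The remainders of the exponential series.\<close>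
  define R where "R k x t = exp t * u x t - (u0 x - \<phi> x) - S k t x" for k x t
  have uint: "integrable lebesgue (\<lambda>y. J (x - y) * u y t)" if "0 \<le> t" for x t
    by (rule lebesgue_conv_integrable[OF int um[OF that]]) (use Mu that in auto)
  have dint: "integrable lebesgue (\<lambda>y. J (x - y) * (u0 y - \<phi> y))" for x
  proof (rule lebesgue_conv_integrable[OF int, where B="M + M"])
    show "(\<lambda>y. u0 y - \<phi> y) \<in> borel_measurable lebesgue"
      by (rule borel_measurable_diff[OF u0(1) measurable_completion]) measurable
    show "\<bar>u0 y - \<phi> y\<bar> \<le> M + M" for y
      using u0(2)[of y] bdd_borel_le[OF \<phi>(1), of y] by linarith
  qed
  have d0: "(LINT y|lebesgue. J (x - y) * (u0 y - \<phi> y)) = 0" for x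
  proof -
    have "(LINT y|lebesgue. J (x - y) * (u0 y - \<phi> y)) = conv J (\<lambda>_. 0) x"
      by (rule lebesgue_conv_eq) (use u0(1) \<phi>(2) in \<open>auto simp: measurable_completion intro!: borel_measurable_diff\<close>)
    then show ?thesis by (simp add: conv_def)
  qed
  have Tint: "integrable lebesgue (\<lambda>y. J (x - y) * T n y)" for x n
    by (rule lebesgue_conv_integrable[OF int, where B=M]) (use T in \<open>auto simp: bdd_borel_def measurable_completion\<close>)
  have TS: "(LINT y|lebesgue. J (x - y) * T n y) = T (Suc n) x" for x n
    using lebesgue_conv_eq[of J "T n" "T n" x] Tm[of n] by (simp add: measurable_completion T_def)
  have ut: "(u x has_real_derivative (LINT y|lebesgue. J (x - y) * u y t) - u x t) (at t)" if "0 < t" for x t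
  proof -
    have "(LINT y|lebesgue. J (x - y) * (u y t - u x t)) = (LINT y|lebesgue. J (x - y) * u y t) - u x t"
      using uint[of t x] J1i[of x] J1[of x] that by (simp add: right_diff_distrib)
    then show ?thesis using der[OF that, of x] by simp
  qed
  have RT: "(LINT y|lebesgue. J (x - y) * R k y t) = exp t * (LINT y|lebesgue. J (x - y) * u y t) - (\<Sum>n<k. t ^ n / fact n * T (Suc n) x)"
    and Rint: "integrable lebesgue (\<lambda>y. J (x - y) * R k y t)" if "0 \<le> t" for x k t
  proof -
    have eq: "J (x - y) * R k y t = exp t * (J (x - y) * u y t) - J (x - y) * (u0 y - \<phi> y) - (\<Sum>n<k. t ^ n / fact n * (J (x - y) * T n y))" for y
      by (simp add: R_def S_def right_diff_distrib sum_distrib_left mult_ac)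
    have si: "integrable lebesgue (\<lambda>y. \<Sum>n<k. t ^ n / fact n * (J (x - y) * T n y))"
      by (intro Bochner_Integration.integrable_sum integrable_mult_right Tint)
    show "integrable lebesgue (\<lambda>y. J (x - y) * R k y t)"
      unfolding eq by (intro Bochner_Integration.integrable_diff integrable_mult_right uint[OF that] dint si)
    have "(LINT y|lebesgue. J (x - y) * R k y t) = exp t * (LINT y|lebesgue. J (x - y) * u y t) - 0 - (\<Sum>n<k. t ^ n / fact n * T (Suc n) x)"
      unfolding eq d0[of x, symmetric] TS[of x, symmetric] using uint[OF that, of x] dint[of x] si Tint[of x]
      by (simp add: Bochner_Integration.integral_sum)
    then show "(LINT y|lebesgue. J (x - y) * R k y t) = exp t * (LINT y|lebesgue. J (x - y) * u y t) - (\<Sum>n<k. t ^ n / fact n * T (Suc n) x)"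
      by simp
  qed
  have Rder: "((\<lambda>t. R (Suc k) x t) has_real_derivative (LINT y|lebesgue. J (x - y) * R k y t)) (at t)" if t: "0 < t" for x k t
  proof -
    have "((\<lambda>t. exp t * u x t) has_real_derivative exp t * (LINT y|lebesgue. J (x - y) * u y t)) (at t)"
      using DERIV_mult[OF DERIV_exp ut[OF t, of x]] by (simp add: algebra_simps)
    from DERIV_diff[OF DERIV_diff[OF this DERIV_const[of "u0 x - \<phi> x"]] exponential_sum_derivative[of "\<lambda>n. T n x" k t]]
    have "((\<lambda>t. R (Suc k) x t) has_real_derivative exp t * (LINT y|lebesgue. J (x - y) * u y t) - (\<Sum>n<k. t ^ n / fact n * T (Suc n) x)) (at t)"
      unfolding R_def S_def by (simp del: sum.lessThan_Suc)
    then show ?thesis by (simp only: RT[OF less_imp_le[OF t]])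
  qed
  define L where "L = exp t * Mu + 2 * M"
  have M0: "0 \<le> M" by (rule bdd_borel_nonneg[OF \<phi>(1)])
  have Rle: "\<bar>R k x s\<bar> \<le> L * (s ^ k / fact k)" if "0 \<le> s" "s \<le> t" for k x s
    using that
  proof (induction k arbitrary: x s)
    case 0
    have "\<bar>R 0 x s\<bar> \<le> \<bar>exp s * u x s\<bar> + \<bar>u0 x\<bar> + \<bar>\<phi> x\<bar>" by (simp add: R_def S_def)
    also have "\<bar>exp s * u x s\<bar> \<le> exp t * Mu"
      unfolding abs_mult using 0 Mu[of s x] by (intro mult_mono) auto
    finally show ?case using u0(2)[of x] bdd_borel_le[OF \<phi>(1), of x] by (simp add: L_def)
  next
    case (Suc k)
    show ?case
    proof (rule abs_le_power_integral[where h="\<lambda>s. R (Suc k) x s" and h'="\<lambda>s. LINT y|lebesgue. J (x - y) * R k y s"])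
      show "R (Suc k) x 0 = 0" by (simp add: R_def S_def init T_def sum.lessThan_Suc_shift del: sum.lessThan_Suc)
      show "continuous_on {0..s} (\<lambda>s. R (Suc k) x s)"
        unfolding R_def S_def by (intro continuous_intros continuous_on_subset[OF cont]) auto
      fix r assume r: "0 < r" "r < s"
      show "((\<lambda>s. R (Suc k) x s) has_real_derivative (LINT y|lebesgue. J (x - y) * R k y r)) (at r)"
        by (rule Rder[OF r(1)])
      have "\<bar>LINT y|lebesgue. J (x - y) * R k y r\<bar> \<le> (LINT y|lebesgue. \<bar>J (x - y) * R k y r\<bar>)"
        by (rule integral_abs_bound)
      also have "\<dots> \<le> (LINT y|lebesgue. J (x - y) * (L * (r ^ k / fact k)))"
      proof (rule integral_mono)
        show "integrable lebesgue (\<lambda>y. \<bar>J (x - y) * R k y r\<bar>)" using Rint[of r x k] r by auto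
        show "integrable lebesgue (\<lambda>y. J (x - y) * (L * (r ^ k / fact k)))" by (rule integrable_mult_left[OF J1i])
        fix y
        show "\<bar>J (x - y) * R k y r\<bar> \<le> J (x - y) * (L * (r ^ k / fact k))"
          unfolding abs_mult abs_of_nonneg[OF nonneg]
          by (rule mult_left_mono[OF Suc.IH nonneg]) (use r Suc.prems in auto)
      qed
      also have "\<dots> = L * (r ^ k / fact k)" by (simp add: J1)
      finally show "\<bar>LINT y|lebesgue. J (x - y) * R k y r\<bar> \<le> L * (r ^ k / fact k)" .
    qed (use Suc.prems in simp)
  qed
  have "(\<lambda>k. L * (t ^ k / fact k)) \<longlonglongrightarrow> L * 0"
    using summable_LIMSEQ_zero[OF sums_summable[OF exp_sums[of t]]] by (intro tendsto_mult tendsto_const)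
  then have lim: "(\<lambda>k. L * (t ^ k / fact k)) \<longlonglongrightarrow> 0" by simp
  have "\<forall>k. norm (R k x t) \<le> L * (t ^ k / fact k)" using Rle[OF t order_refl] by (simp only: real_norm_def) blast
  then have "(\<lambda>k. R k x t) \<longlonglongrightarrow> 0"
    by (rule Lim_null_comparison[OF always_eventually lim])
  then have "(\<lambda>k. (exp t * u x t - (u0 x - \<phi> x)) - R k x t) \<longlonglongrightarrow> (exp t * u x t - (u0 x - \<phi> x)) - 0"
    by (intro tendsto_diff tendsto_const)
  then have "(\<lambda>k. S k t x) \<longlonglongrightarrow> exp t * u x t - (u0 x - \<phi> x)" by (simp add: R_def)
  then have "(\<lambda>n. t ^ n / fact n * T n x) sums (exp t * u x t - (u0 x - \<phi> x))"
    by (simp add: sums_def S_def)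
  then have "(\<lambda>n. exp (- t) * (t ^ n / fact n * T n x)) sums (exp (- t) * (exp t * u x t - (u0 x - \<phi> x)))"
    by (rule sums_mult)
  then have "jump_semigroup J t \<phi> x = exp (- t) * (exp t * u x t - (u0 x - \<phi> x))"
    by (simp add: sums_iff jump_semigroup_def poisson_weight_def T_def mult.assoc[symmetric])
  then show ?thesis by (simp add: right_diff_distrib mult.assoc[symmetric] exp_add[symmetric])
qed

section \<open>Radial integrals\<close>

text \<open>Polar coordinates for radial functions: the image of Lebesgue measure under the norm is determined by the
  volumes of balls.\<close>

lemma distr_norm_lborel:
  "distr (lborel :: 'a::euclidean_space measure) borel norm
     = density lborel (\<lambda>r. ennreal (real DIM('a) * unit_ball_vol (real DIM('a)) * r ^ (DIM('a) - 1)) * indicator {0..} r)"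
  (is "?L = ?R")
proof (rule measure_eqI_generator_eq[where E="range (\<lambda>r::real. {..r})" and \<Omega>=UNIV and A="\<lambda>i. {..real i}"])
  let ?\<omega> = "unit_ball_vol (real DIM('a))"
  have d: "0 < DIM('a)" by simp
  have L: "emeasure ?L {..r} = ennreal (if 0 \<le> r then ?\<omega> * r ^ DIM('a) else 0)" for r
  proof -
    have "emeasure ?L {..r} = emeasure lborel (cball (0::'a) r)"
      by (subst emeasure_distr) (auto simp: cball_def vimage_def intro!: arg_cong[where f="emeasure lborel"])
    then show ?thesis by (cases "0 \<le> r") (simp_all add: emeasure_cball)
  qed
  have R: "emeasure ?R {..r} = ennreal (if 0 \<le> r then ?\<omega> * r ^ DIM('a) else 0)" for r
  proof -
    have "emeasure ?R {..r} = (\<integral>\<^sup>+s. ennreal (real DIM('a) * ?\<omega> * s ^ (DIM('a) - 1)) * indicator {0..r} s \<partial>lborel)"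
      by (subst emeasure_density) (auto intro!: nn_integral_cong split: split_indicator)
    also have "\<dots> = ennreal (if 0 \<le> r then ?\<omega> * r ^ DIM('a) else 0)"
    proof (cases "0 \<le> r")
      case True
      have "(\<integral>\<^sup>+s. ennreal (real DIM('a) * ?\<omega> * s ^ (DIM('a) - 1)) * indicator {0..r} s \<partial>lborel) = ?\<omega> * r ^ DIM('a) - ?\<omega> * 0 ^ DIM('a)"
      proof (rule nn_integral_FTC_Icc[OF _ _ _ True])
        fix s :: real
        show "((\<lambda>s. ?\<omega> * s ^ DIM('a)) has_real_derivative real DIM('a) * ?\<omega> * s ^ (DIM('a) - 1)) (at s)"
          by (auto intro!: derivative_eq_intros)
      qed auto
      then show ?thesis using True by simp
    qed simp
    finally show ?thesis .
  qed
  show "Int_stable (range (\<lambda>r::real. {..r}))"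
    by (auto simp: Int_stable_def intro!: image_eqI[where x="min _ _"])
  show "emeasure ?L X = emeasure ?R X" if "X \<in> range (\<lambda>r::real. {..r})" for X
    using that L R by auto
  show "emeasure ?L {..real i} \<noteq> \<infinity>" for i by (simp add: L)
  show "sets ?L = sigma_sets UNIV (range (\<lambda>r::real. {..r}))" "sets ?R = sigma_sets UNIV (range (\<lambda>r::real. {..r}))"
    by (simp_all add: borel_eq_atMost)
  show "(\<Union>i. {..real i}) = UNIV" by (auto intro: real_arch_simple)
qed auto

lemma nn_integral_radial:
  assumes [measurable]: "f \<in> borel_measurable borel"
  shows "(\<integral>\<^sup>+y. f (norm y) \<partial>(lborel :: 'a::euclidean_space measure))
    = (\<integral>\<^sup>+r. ennreal (real DIM('a) * unit_ball_vol (real DIM('a)) * r ^ (DIM('a) - 1)) * indicator {0..} r * f r \<partial>lborel)"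
proof -
  have "(\<integral>\<^sup>+y. f (norm y) \<partial>(lborel :: 'a measure)) = (\<integral>\<^sup>+r. f r \<partial>distr (lborel :: 'a measure) borel norm)"
    by (subst nn_integral_distr) auto
  then show ?thesis unfolding distr_norm_lborel by (subst (asm) nn_integral_density) auto
qed

lemma integral_norm_powr_ball:
  fixes \<beta> :: real
  assumes \<beta>: "\<beta> < real DIM('a)" and \<rho>: "0 \<le> \<rho>"
  shows "integrable lborel (\<lambda>y::'a::euclidean_space. norm y powr - \<beta> * indicator (cball 0 \<rho>) y)" (is ?I)
    and "(LINT y|lborel. norm (y::'a) powr - \<beta> * indicator (cball 0 \<rho>) y)
      = real DIM('a) * unit_ball_vol (real DIM('a)) * (\<rho> powr (real DIM('a) - \<beta>) / (real DIM('a) - \<beta>))" (is ?E)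
proof -
  let ?k = "real DIM('a) * unit_ball_vol (real DIM('a))" and ?e = "real DIM('a) - 1 - \<beta>"
  let ?V = "?k * (\<rho> powr (real DIM('a) - \<beta>) / (real DIM('a) - \<beta>))"
  have h: "((\<lambda>r. r powr ?e) has_integral (\<rho> powr (?e + 1) / (?e + 1))) {0..\<rho>}"
    by (rule has_integral_powr_from_0) (use \<beta> \<rho> in auto)
  have "(\<integral>\<^sup>+y. ennreal (norm (y::'a) powr - \<beta> * indicator (cball 0 \<rho>) y) \<partial>lborel)
    = (\<integral>\<^sup>+y. (\<lambda>r. ennreal (r powr - \<beta> * indicator {0..\<rho>} r)) (norm (y::'a)) \<partial>lborel)"
    by (intro nn_integral_cong) (auto split: split_indicator)
  also have "\<dots> = (\<integral>\<^sup>+r. ennreal ?k * ennreal (indicator {0..\<rho>} r * r powr ?e) \<partial>lborel)"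
  proof (subst nn_integral_radial, measurable, intro nn_integral_cong_AE)
    show "AE r in lborel. ennreal (?k * r ^ (DIM('a) - 1)) * indicator {0..} r * ennreal (r powr - \<beta> * indicator {0..\<rho>} r)
       = ennreal ?k * ennreal (indicator {0..\<rho>} r * r powr ?e)"
      using AE_lborel_singleton[of "0::real"]
    proof eventually_elim
      fix r :: real assume "r \<noteq> 0"
      show "ennreal (?k * r ^ (DIM('a) - 1)) * indicator {0..} r * ennreal (r powr - \<beta> * indicator {0..\<rho>} r)
       = ennreal ?k * ennreal (indicator {0..\<rho>} r * r powr ?e)"
      proof (cases "0 < r \<and> r \<le> \<rho>")
        case True
        have "r ^ (DIM('a) - 1) * r powr - \<beta> = r powr ?e"
          using True DIM_positive[where 'a='a] by (simp add: powr_realpow[symmetric] powr_add[symmetric] of_nat_diff)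
        then show ?thesis using True by (simp add: ennreal_mult'[symmetric] mult.assoc)
      qed (use \<open>r \<noteq> 0\<close> in \<open>auto split: split_indicator\<close>)
    qed
  qed
  also have "\<dots> = ennreal ?k * ennreal (\<rho> powr (?e + 1) / (?e + 1))"
    using nn_integral_has_integral_lebesgue[OF _ h] by (subst nn_integral_cmult) auto
  also have "\<dots> = ennreal ?V"
    using \<beta> by (simp add: ennreal_mult'[symmetric] algebra_simps)
  finally have nn: "(\<integral>\<^sup>+y. ennreal (norm (y::'a) powr - \<beta> * indicator (cball 0 \<rho>) y) \<partial>lborel) = ennreal ?V" .
  have [measurable]: "cball (0::'a) \<rho> \<in> sets borel" by simp
  have m [simp]: "(\<lambda>y::'a. norm y powr - \<beta> * indicator (cball 0 \<rho>) y) \<in> borel_measurable borel" by measurable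
  show ?I
  proof (rule integrableI_nonneg)
    show "(\<integral>\<^sup>+y. ennreal (norm (y::'a) powr - \<beta> * indicator (cball 0 \<rho>) y) \<partial>lborel) < \<infinity>" unfolding nn by simp
  qed simp_all
  show ?E using \<beta> by (subst integral_eq_nn_integral) (auto simp: nn)
qed

lemma integral_norm_powr_shell:
  assumes \<rho>: "1 \<le> \<rho>"
  shows "integrable lborel (\<lambda>y::'a::euclidean_space. norm y powr - real DIM('a) * indicator {y. 1 \<le> norm y \<and> norm y \<le> \<rho>} y)" (is ?I)
    and "(LINT y|lborel. norm (y::'a) powr - real DIM('a) * indicator {y. 1 \<le> norm y \<and> norm y \<le> \<rho>} y)
      = real DIM('a) * unit_ball_vol (real DIM('a)) * ln \<rho>" (is ?E)
proof -
  let ?k = "real DIM('a) * unit_ball_vol (real DIM('a))"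
  have h: "((\<lambda>r. inverse r) has_integral (ln \<rho> - ln 1)) {1..\<rho>}"
    by (rule fundamental_theorem_of_calculus[OF \<rho>])
       (auto intro!: derivative_eq_intros simp: has_real_derivative_iff_has_vector_derivative[symmetric] inverse_eq_divide)
  have "(\<integral>\<^sup>+y. ennreal (norm (y::'a) powr - real DIM('a) * indicator {y. 1 \<le> norm y \<and> norm y \<le> \<rho>} y) \<partial>lborel)
    = (\<integral>\<^sup>+y. (\<lambda>r. ennreal (r powr - real DIM('a) * indicator {1..\<rho>} r)) (norm (y::'a)) \<partial>lborel)"
    by (intro nn_integral_cong) (auto split: split_indicator)
  also have "\<dots> = (\<integral>\<^sup>+r. ennreal ?k * ennreal (indicator {1..\<rho>} r * inverse r) \<partial>lborel)"
  proof (subst nn_integral_radial, measurable, intro nn_integral_cong)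
    fix r :: real
    show "ennreal (?k * r ^ (DIM('a) - 1)) * indicator {0..} r * ennreal (r powr - real DIM('a) * indicator {1..\<rho>} r)
       = ennreal ?k * ennreal (indicator {1..\<rho>} r * inverse r)"
    proof (cases "1 \<le> r \<and> r \<le> \<rho>")
      case True
      have "r ^ (DIM('a) - 1) * r powr - real DIM('a) = r powr -1"
        using True DIM_positive[where 'a='a] by (simp add: powr_realpow[symmetric] powr_add[symmetric] of_nat_diff)
      also have "\<dots> = inverse r" using True by (simp add: powr_minus)
      finally show ?thesis using True by (simp add: ennreal_mult'[symmetric] mult.assoc)
    qed (auto split: split_indicator)
  qed
  also have "\<dots> = ennreal ?k * ennreal (ln \<rho> - ln 1)"
    using nn_integral_has_integral_lebesgue[OF _ h] by (subst nn_integral_cmult) auto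
  also have "\<dots> = ennreal (?k * ln \<rho>)"
    by (simp add: ennreal_mult'[symmetric])
  finally have nn: "(\<integral>\<^sup>+y. ennreal (norm (y::'a) powr - real DIM('a) * indicator {y. 1 \<le> norm y \<and> norm y \<le> \<rho>} y) \<partial>lborel) = ennreal (?k * ln \<rho>)" .
  show ?I
  proof (rule integrableI_nonneg)
    show "(\<integral>\<^sup>+y. ennreal (norm (y::'a) powr - real DIM('a) * indicator {y. 1 \<le> norm y \<and> norm y \<le> \<rho>} y) \<partial>lborel) < \<infinity>" unfolding nn by simp
  qed simp_all
  show ?E using \<rho> by (subst integral_eq_nn_integral) (auto simp: nn)
qed

section \<open>Decay of caloric functions with algebraically decaying data\<close>

lemma gauss_scaled_le:
  assumes "0 < a" "0 < t"
  shows "gauss (1 / (4 * a * t)) (x::'a::euclidean_space) \<le> (4 * pi * a) powr - (DIM('a) / 2) * t powr - (DIM('a) / 2)"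
proof -
  have "gauss (1 / (4 * a * t)) x \<le> (1 / (4 * a * t) / pi) powr (DIM('a) / 2)"
    using assms by (intro gauss_le) simp
  also have "1 / (4 * a * t) / pi = inverse (4 * pi * a * t)" using assms by (simp add: field_simps)
  also have "inverse (4 * pi * a * t) powr (DIM('a) / 2) = (4 * pi * a) powr - (DIM('a) / 2) * t powr - (DIM('a) / 2)"
  proof -
    have "inverse (4 * pi * a * t) powr (DIM('a) / 2) = ((4 * pi * a) * t) powr - (DIM('a) / 2)"
      by (simp only: powr_minus inverse_powr)
    also have "\<dots> = (4 * pi * a) powr - (DIM('a) / 2) * t powr - (DIM('a) / 2)"
      by (rule powr_mult)
    finally show ?thesis .
  qed
  finally show ?thesis .
qed

lemma gauss_flip_integrable:
  assumes "0 < p"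
  shows "integrable lborel (\<lambda>y::'a::euclidean_space. gauss p (x - y))" "(LINT y|lborel. gauss p (x - y::'a)) = 1"
  using gauss_integrable[OF assms, where 'a='a] gauss_integral[OF assms, where 'a='a]
  by (simp_all add: lborel_integrable_reflect lborel_integral_reflect)

text \<open>Inside the ball of radius \<open>sqrt t\<close> the Gaussian is bounded by its maximum and the power is
  integrated; outside, the power is bounded by its value on the sphere and the Gaussian is integrated.\<close>

lemma gauss_norm_powr_bound:
  fixes \<beta> :: real
  assumes a: "0 < a" and \<beta>: "0 < \<beta>" "\<beta> < real DIM('a::euclidean_space)"
  shows "\<exists>C\<ge>0. \<forall>t>0. \<forall>x::'a. integrable lborel (\<lambda>y. gauss (1 / (4 * a * t)) (x - y) * norm y powr - \<beta>) \<and>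
    (LINT y|lborel. gauss (1 / (4 * a * t)) (x - y) * norm y powr - \<beta>) \<le> C * t powr - (\<beta> / 2)"
proof -
  let ?d = "real DIM('a)" and ?k = "(4 * pi * a) powr - (DIM('a) / 2)"
  let ?V = "?d * unit_ball_vol ?d / (?d - \<beta>)"
  define C where "C = ?k * ?V + 1"
  show ?thesis
  proof (intro exI[of _ C] conjI allI impI)
    show "0 \<le> C" using a \<beta> by (auto simp: C_def intro!: add_nonneg_nonneg mult_nonneg_nonneg divide_nonneg_nonneg)
    fix t :: real and x :: 'a assume t: "0 < t"
    let ?g = "\<lambda>y. gauss (1 / (4 * a * t)) (x - y)"
    have p: "0 < 1 / (4 * a * t)" using a t by simp
    let ?B = "\<lambda>y::'a. ?k * t powr - (?d / 2) * (norm y powr - \<beta> * indicator (cball 0 (sqrt t)) y) + t powr - (\<beta> / 2) * ?g y"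
    have le: "?g y * norm y powr - \<beta> \<le> ?B y" for y
    proof (cases "norm y \<le> sqrt t")
      case True
      have "?g y * norm y powr - \<beta> \<le> ?k * t powr - (?d / 2) * norm y powr - \<beta>"
        using gauss_scaled_le[OF a t, of "x - y"] by (intro mult_right_mono) auto
      then show ?thesis using True by (simp add: add_increasing2 mult.assoc)
    next
      case False
      then have "norm y powr - \<beta> \<le> sqrt t powr - \<beta>"
        using t \<beta> by (intro powr_mono2') auto
      also have "\<dots> = t powr - (\<beta> / 2)" using t by (simp add: powr_half_sqrt[symmetric] powr_powr)
      finally have "?g y * norm y powr - \<beta> \<le> ?g y * t powr - (\<beta> / 2)" by (intro mult_left_mono) auto
      then show ?thesis using False by (simp add: mult.commute)
    qed
    have Bi: "integrable lborel ?B"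
      using integral_norm_powr_ball(1)[OF \<beta>(2), of "sqrt t"] gauss_flip_integrable(1)[OF p, of x] t by auto
    show i: "integrable lborel (\<lambda>y. ?g y * norm y powr - \<beta>)"
      by (rule Bochner_Integration.integrable_bound[OF Bi]) (use le in \<open>auto intro!: AE_I2 simp: abs_of_nonneg order_trans[OF _ abs_ge_self]\<close>)
    have "(LINT y|lborel. ?g y * norm y powr - \<beta>) \<le> (LINT y|lborel. ?B y)"
      by (rule integral_mono[OF i Bi le])
    also have "\<dots> = ?k * t powr - (?d / 2) * (?d * unit_ball_vol ?d * (sqrt t powr (?d - \<beta>) / (?d - \<beta>))) + t powr - (\<beta> / 2)"
      using integral_norm_powr_ball[OF \<beta>(2), of "sqrt t"] gauss_flip_integrable[OF p, of x] t by simp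
    also have "sqrt t powr (?d - \<beta>) = t powr (?d / 2) * t powr - (\<beta> / 2)"
      using t by (simp add: powr_half_sqrt[symmetric] powr_powr powr_add[symmetric] diff_divide_distrib)
    also have "?k * t powr - (?d / 2) * (?d * unit_ball_vol ?d * (t powr (?d / 2) * t powr - (\<beta> / 2) / (?d - \<beta>))) + t powr - (\<beta> / 2)
       = C * t powr - (\<beta> / 2)"
    proof -
      have "t powr - (?d / 2) * t powr (?d / 2) = 1" using t by (simp add: powr_add[symmetric])
      then have "?k * t powr - (?d / 2) * (?d * unit_ball_vol ?d * (t powr (?d / 2) * t powr - (\<beta> / 2) / (?d - \<beta>)))
         = ?k * ?V * t powr - (\<beta> / 2)" by simp
      then show ?thesis by (simp add: C_def distrib_right)
    qed
    finally show "(LINT y|lborel. ?g y * norm y powr - \<beta>) \<le> C * t powr - (\<beta> / 2)" .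
  qed
qed

section \<open>Bootstrapping the rate of convergence\<close>

text \<open>The decay rate of the caloric function improves the total variation estimate on bounded data. Write
  \<open>P\<close> and \<open>G\<close> for the two semigroups at time \<open>s\<close>. As they commute,
  \<open>P P \<phi> - G G \<phi> = (P - G) (P \<phi> + G \<phi>)\<close>. The first factor contributes
  \<open>s powr - (1 / 2)\<close>, and the sup norm of the second is at most twice the decay of the caloric function plus the
  error at time \<open>s\<close>. So the bound for the error is propagated from \<open>s\<close> to \<open>2 * s\<close>.\<close>

theorem jump_gauss_difference_decay:
  fixes J :: "real^'n \<Rightarrow> real"
  assumes J: "convolution_kernel J"
  defines "a \<equiv> diffusivity J"
  assumes \<phi>: "bdd_borel M \<phi>"
    and Q: "\<And>t x. 0 < t \<Longrightarrow> \<bar>conv (gauss (1 / (4 * a * t))) \<phi> x\<bar> \<le> Q * t powr - b"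
    and \<gamma>: "0 \<le> \<gamma>" "\<gamma> \<le> b + 1 / 2"
  shows "\<exists>E\<ge>0. \<forall>t>0. \<forall>x. \<bar>jump_semigroup J t \<phi> x - conv (gauss (1 / (4 * a * t))) \<phi> x\<bar> \<le> E * t powr - \<gamma>"
proof -
  have a: "0 < a" unfolding a_def by (rule conv_power_gauss_difference(1)[OF J])
  interpret prob_kernel J
    by unfold_locales (rule conv_power_gauss_difference(3-5)[OF J])+
  let ?P = "\<lambda>t. jump_semigroup J t" and ?G = "\<lambda>t. conv (gauss (1 / (4 * a * t)))"
  obtain C where C: "0 \<le> C" and Cle: "\<And>t B \<psi> x. 0 < t \<Longrightarrow> bdd_borel B \<psi> \<Longrightarrow> \<bar>?P t \<psi> x - ?G t \<psi> x\<bar> \<le> C / sqrt t * B"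
    using jump_gauss_difference[OF J] unfolding a_def by blast
  have gp: "0 < 1 / (4 * a * t)" if "0 < t" for t using a that by simp
  have gi: "integrable lborel (gauss (1 / (4 * a * t)) :: real^'n \<Rightarrow> real)" if "0 < t" for t
    by (rule gauss_integrable[OF gp[OF that]])
  have Gb: "bdd_borel B (?G t \<psi>)" if "0 < t" "bdd_borel B \<psi>" for B t and \<psi> :: "real^'n \<Rightarrow> real"
    by (rule bdd_borel_conv_prob[OF gi[OF that(1)] gauss_nonneg gauss_integral[OF gp[OF that(1)]] that(2)])
  have Q0: "0 \<le> Q" using order_trans[OF abs_ge_zero Q[of 1 0]] by simp
  have M0: "0 \<le> M" by (rule bdd_borel_nonneg[OF \<phi>])
  have split: "\<bar>?P (s + s) \<phi> x - ?G (s + s) \<phi> x\<bar> \<le> C / sqrt s * (2 * (Q * s powr - b) + e)"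
    if s: "0 < s" and e: "\<And>x. \<bar>?P s \<phi> x - ?G s \<phi> x\<bar> \<le> e" for s e x
  proof -
    have GG: "?G s (?G s \<phi>) = ?G (s + s) \<phi>"
    proof -
      have "?G s (?G s \<phi>) = conv (conv (gauss (1 / (4 * a * s))) (gauss (1 / (4 * a * s)))) \<phi>"
        using conv_assoc[OF gi[OF s] gi[OF s] \<phi>] by blast
      also have "conv (gauss (1 / (4 * a * s))) (gauss (1 / (4 * a * s))) = (gauss (1 / (4 * a * (s + s))) :: real^'n \<Rightarrow> real)"
      proof -
        have eq: "q * q / (q + q) = q / 2" if "0 < q" for q :: real using that by (simp add: field_simps)
        have "1 / (4 * a * s) * (1 / (4 * a * s)) / (1 / (4 * a * s) + 1 / (4 * a * s)) = 1 / (4 * a * (s + s))"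
          unfolding eq[OF gp[OF s]] by simp
        then show ?thesis by (intro ext) (simp only: gauss_conv_gauss[OF gp[OF s] gp[OF s]])
      qed
      finally show ?thesis .
    qed
    have PP: "?P s (?P s \<phi>) = ?P (s + s) \<phi>" by (rule jump_semigroup_add[OF \<phi>]) (use s in auto)
    have GP: "?G s (?P s \<phi>) = ?P s (?G s \<phi>)" by (rule conv_jump_semigroup[OF \<phi> _ gi[OF s]]) (use s in simp)
    let ?q = "Q * s powr - b"
    have Gq: "bdd_borel ?q (?G s \<phi>)"
      using Gb[OF s \<phi>] Q[OF s] by (auto intro: bdd_borelI dest: bdd_borel_meas)
    have Pq: "bdd_borel (?q + e) (?P s \<phi>)"
    proof (rule bdd_borelI)
      show "?P s \<phi> \<in> borel_measurable borel" by (rule bdd_borel_meas[OF bdd_jump_semigroup[OF \<phi> less_imp_le[OF s]]])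
      show "\<bar>?P s \<phi> x\<bar> \<le> ?q + e" for x using Q[OF s, of x] e[of x] by linarith
    qed
    have "?P (s + s) \<phi> x - ?G (s + s) \<phi> x = (?P s (?P s \<phi>) x - ?G s (?P s \<phi>) x) + (?P s (?G s \<phi>) x - ?G s (?G s \<phi>) x)"
      by (simp add: PP GG GP)
    then have "\<bar>?P (s + s) \<phi> x - ?G (s + s) \<phi> x\<bar> \<le> C / sqrt s * (?q + e) + C / sqrt s * ?q"
      using Cle[OF s Pq, of x] Cle[OF s Gq, of x] by linarith
    also have "C / sqrt s * (?q + e) + C / sqrt s * ?q = C / sqrt s * (2 * ?q + e)"
      by (simp add: distrib_left)
    finally show ?thesis .
  qed
  \<comment> \<open>Beyond time T, the error at time s contributes at most half of the claimed bound at time 2 * s.\<close>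
  define T where "T = max 1 ((2 * C * 2 powr \<gamma>)\<^sup>2)"
  have T1: "1 \<le> T" by (simp add: T_def)
  have sT: "2 * C * 2 powr \<gamma> \<le> sqrt T"
    using C by (intro real_le_rsqrt) (simp add: T_def)
  define E where "E = 2 * M * (2 * T) powr \<gamma> + 4 * C * Q * 2 powr \<gamma>"
  have E0: "0 \<le> E" using M0 C Q0 by (simp add: E_def)
  have claim: "\<forall>t x. 0 < t \<and> t \<le> 2 ^ k * (2 * T) \<longrightarrow> \<bar>?P t \<phi> x - ?G t \<phi> x\<bar> \<le> E * t powr - \<gamma>" for k :: nat
  proof (induction k)
    case 0
    show ?case
    proof (intro allI impI)
      fix t x assume "0 < t \<and> t \<le> 2 ^ 0 * (2 * T)"
      then have t: "0 < t" "t \<le> 2 * T" by auto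
      have "\<bar>?P t \<phi> x - ?G t \<phi> x\<bar> \<le> 2 * M"
        using bdd_borel_le[OF bdd_jump_semigroup[OF \<phi>], of t x] bdd_borel_le[OF Gb[OF t(1) \<phi>], of x] t(1) by simp
      also have "\<dots> = 2 * M * (2 * T) powr \<gamma> * (2 * T) powr - \<gamma>"
        using T1 by (simp add: powr_minus)
      also have "\<dots> \<le> E * t powr - \<gamma>"
        using t \<gamma>(1) M0 C Q0 by (intro mult_mono powr_mono2') (auto simp: E_def)
      finally show "\<bar>?P t \<phi> x - ?G t \<phi> x\<bar> \<le> E * t powr - \<gamma>" .
    qed
  next
    case (Suc k)
    show ?case
    proof (intro allI impI)
      fix t x assume t: "0 < t \<and> t \<le> 2 ^ Suc k * (2 * T)"
      show "\<bar>?P t \<phi> x - ?G t \<phi> x\<bar> \<le> E * t powr - \<gamma>"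
      proof (cases "t \<le> 2 * T")
        case True
        have "2 * T \<le> 2 ^ k * (2 * T)" using T1 by simp
        then have "t \<le> 2 ^ k * (2 * T)" using True by (rule order_trans[rotated])
        then show ?thesis using Suc t by blast
      next
        case False
        define s where "s = t / 2"
        have s: "0 < s" "T < s" "s \<le> 2 ^ k * (2 * T)" "t = s + s" using False t by (auto simp: s_def)
        have s1: "1 \<le> s" using s T1 by linarith
        have sg: "s powr - \<gamma> = 2 powr \<gamma> * t powr - \<gamma>"
        proof -
          have "t = 2 * s" by (simp add: s_def)
          then have "t powr - \<gamma> = 2 powr - \<gamma> * s powr - \<gamma>" by (simp only: powr_mult)
          moreover have "2 powr \<gamma> * 2 powr - \<gamma> = (1::real)" by (simp add: powr_add[symmetric])
          ultimately show ?thesis by (simp add: mult.assoc[symmetric])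
        qed
        have "\<bar>?P (s + s) \<phi> x - ?G (s + s) \<phi> x\<bar> \<le> C / sqrt s * (2 * (Q * s powr - b) + E * s powr - \<gamma>)"
          by (rule split[OF s(1)]) (use Suc s(1,3) in blast)
        also have "\<dots> = 2 * C * Q * (s powr - b / sqrt s) + C / sqrt s * (E * s powr - \<gamma>)"
          by (simp add: distrib_left)
        also have "s powr - b / sqrt s = s powr - (b + 1 / 2)"
          using s(1) by (simp add: powr_half_sqrt[symmetric] powr_diff[symmetric])
        also have "2 * C * Q * s powr - (b + 1 / 2) \<le> 2 * C * Q * s powr - \<gamma>"
          using C Q0 \<gamma>(2) s1 by (intro mult_left_mono powr_mono) auto
        also have "2 * C * Q * s powr - \<gamma> \<le> E / 2 * t powr - \<gamma>"
        proof -
          have "2 * C * Q * s powr - \<gamma> = (2 * C * Q * 2 powr \<gamma>) * t powr - \<gamma>" by (simp add: sg)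
          also have "\<dots> \<le> E / 2 * t powr - \<gamma>"
            using M0 by (intro mult_right_mono) (auto simp: E_def)
          finally show ?thesis .
        qed
        also have "C / sqrt s * (E * s powr - \<gamma>) \<le> E / 2 * t powr - \<gamma>"
        proof -
          have "2 * C * 2 powr \<gamma> \<le> sqrt s" using sT s(2) by (meson less_imp_le order_trans real_sqrt_le_mono)
          then have "C / sqrt s * 2 powr \<gamma> \<le> 1 / 2" using s(1) by (simp add: field_simps)
          then have "(C / sqrt s * 2 powr \<gamma>) * (E * t powr - \<gamma>) \<le> 1 / 2 * (E * t powr - \<gamma>)"
            using E0 by (intro mult_right_mono) auto
          then show ?thesis by (simp add: sg mult_ac)
        qed
        finally show ?thesis using s(4) by simp
      qed
    qed
  qed
  show ?thesis
  proof (intro exI[of _ E] conjI E0 allI impI)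
    fix t :: real and x assume t: "0 < t"
    obtain k :: nat where k: "t < 2 ^ k" using real_arch_pow[of 2 t] by auto
    have "(2::real) ^ k \<le> 2 ^ k * (2 * T)" using T1 by simp
    then have "t \<le> 2 ^ k * (2 * T)" using k by linarith
    then show "\<bar>?P t \<phi> x - ?G t \<phi> x\<bar> \<le> E * t powr - \<gamma>" using claim[of k] t by blast
  qed
qed

section \<open>Data with a prescribed algebraic tail\<close>

lemma tendsto_norm_powr_at_infinity:
  assumes "0 < \<alpha>"
  shows "((\<lambda>x::'a::euclidean_space. norm x powr - \<alpha>) \<longlongrightarrow> 0) at_infinity"
  by (rule filterlim_compose[OF tendsto_neg_powr[of "- \<alpha>", OF _ filterlim_ident] filterlim_norm_at_top])
     (use assms in simp)

text \<open>The representative has to keep the limit at infinity everywhere and not only almost everywhere, so on the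
  exceptional null set it is given the limiting profile, cut off by the bound.\<close>

lemma borel_representative_with_tail:
  fixes u0 :: "'a::euclidean_space \<Rightarrow> real"
  assumes u0: "u0 \<in> borel_measurable lebesgue" "\<And>x. 0 \<le> u0 x" "\<And>x. u0 x \<le> M"
    and M: "0 < M" and A: "0 < A" and \<alpha>: "0 < \<alpha>"
    and lim: "((\<lambda>x. norm x powr \<alpha> * u0 x) \<longlongrightarrow> A) at_infinity"
  shows "\<exists>\<phi>. \<phi> \<in> borel_measurable borel \<and> (\<forall>x. 0 \<le> \<phi> x \<and> \<phi> x \<le> M) \<and> (AE x in lborel. u0 x = \<phi> x) \<and>
     ((\<lambda>x. norm x powr \<alpha> * \<phi> x) \<longlongrightarrow> A) at_infinity"
proof -
  obtain v where v: "v \<in> borel_measurable lborel" "AE x in lborel. u0 x = v x"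
    using completion_ex_borel_measurable_real[OF u0(1)] by blast
  obtain N where N: "N \<in> null_sets lborel" "{x \<in> space lborel. u0 x \<noteq> v x} \<subseteq> N"
    using v(2) unfolding eventually_ae_filter by blast
  have [measurable]: "v \<in> borel_measurable borel" "N \<in> sets borel" using v(1) N(1) by auto
  have eq: "u0 x = v x" if "x \<notin> N" for x using N(2) that by auto
  \<comment> \<open>On the null set N the limiting profile is used.\<close>
  define \<phi> where "\<phi> x = (if x \<in> N then min M (A * norm x powr - \<alpha>) else v x)" for x
  have "\<phi> \<in> borel_measurable borel" unfolding \<phi>_def[abs_def] by measurable
  moreover have "0 \<le> \<phi> x \<and> \<phi> x \<le> M" for x using u0(2,3)[of x] eq[of x] M A by (auto simp: \<phi>_def)
  moreover have "AE x in lborel. u0 x = \<phi> x"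
    using AE_not_in[OF N(1)] by eventually_elim (simp add: \<phi>_def eq)
  moreover have "((\<lambda>x. norm x powr \<alpha> * \<phi> x) \<longlongrightarrow> A) at_infinity"
  proof -
    have "((\<lambda>x::'a. A * norm x powr - \<alpha>) \<longlongrightarrow> A * 0) at_infinity"
      by (intro tendsto_mult tendsto_const tendsto_norm_powr_at_infinity \<alpha>)
    then have "eventually (\<lambda>x::'a. A * norm x powr - \<alpha> < M) at_infinity"
      using M by (intro order_tendstoD) auto
    moreover have "eventually (\<lambda>x::'a. 1 \<le> norm x) at_infinity"
      unfolding eventually_at_infinity by auto
    ultimately have "eventually (\<lambda>x. norm (norm x powr \<alpha> * \<phi> x - A) \<le> \<bar>norm x powr \<alpha> * u0 x - A\<bar>) at_infinity"
    proof eventually_elim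
      fix x :: 'a assume x: "A * norm x powr - \<alpha> < M" "1 \<le> norm x"
      have "0 < norm x" using x(2) by linarith
      then have "norm x powr \<alpha> * norm x powr - \<alpha> = 1" by (simp add: powr_add[symmetric])
      then have one: "norm x powr \<alpha> * (A * norm x powr - \<alpha>) = A" by (simp add: mult.left_commute)
      show "norm (norm x powr \<alpha> * \<phi> x - A) \<le> \<bar>norm x powr \<alpha> * u0 x - A\<bar>"
      proof (cases "x \<in> N")
        case True
        then have "\<phi> x = A * norm x powr - \<alpha>" using x(1) by (simp add: \<phi>_def min_def)
        then have "norm x powr \<alpha> * \<phi> x = A" by (simp only: one)
        then show ?thesis by simp
      qed (simp add: \<phi>_def eq)
    qed
    moreover have "((\<lambda>x. \<bar>norm x powr \<alpha> * u0 x - A\<bar>) \<longlongrightarrow> 0) at_infinity"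
      using lim by (simp add: tendsto_rabs_zero_iff LIM_zero)
    ultimately have "((\<lambda>x. norm x powr \<alpha> * \<phi> x - A) \<longlongrightarrow> 0) at_infinity"
      by (rule Lim_null_comparison)
    then show ?thesis by (rule LIM_zero_cancel)
  qed
  ultimately show ?thesis by blast
qed

locale tail_datum =
  fixes \<phi> :: "'a::euclidean_space \<Rightarrow> real" and M A \<alpha> :: real
  assumes meas [measurable]: "\<phi> \<in> borel_measurable borel"
    and nonneg: "0 \<le> \<phi> x" and le: "\<phi> x \<le> M"
    and A: "0 < A" and \<alpha>: "0 < \<alpha>"
    and tail: "((\<lambda>x. norm x powr \<alpha> * \<phi> x) \<longlongrightarrow> A) at_infinity"
begin

lemma bdd: "bdd_borel M \<phi>"
  by (rule bdd_borelI) (use nonneg le in \<open>auto simp: abs_of_nonneg\<close>)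

lemma M_nonneg: "0 \<le> M" using nonneg[of 0] le[of 0] by linarith

lemma tail_close:
  assumes \<epsilon>: "0 < \<epsilon>"
  obtains R where "1 \<le> R" "\<And>y. R \<le> norm y \<Longrightarrow> \<bar>\<phi> y - A * norm y powr - \<alpha>\<bar> \<le> \<epsilon> * norm y powr - \<alpha>"
proof -
  obtain R0 where R0: "\<And>y. R0 \<le> norm y \<Longrightarrow> \<bar>norm y powr \<alpha> * \<phi> y - A\<bar> < \<epsilon>"
    using tendstoD[OF tail \<epsilon>] unfolding eventually_at_infinity by (auto simp: dist_real_def)
  have "\<bar>\<phi> y - A * norm y powr - \<alpha>\<bar> \<le> \<epsilon> * norm y powr - \<alpha>" if y: "max 1 R0 \<le> norm y" for y
  proof -
    have "0 < norm y" using y by linarith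
    then have "norm y powr - \<alpha> * norm y powr \<alpha> = 1" by (simp add: powr_add[symmetric])
    then have "\<phi> y - A * norm y powr - \<alpha> = norm y powr - \<alpha> * (norm y powr \<alpha> * \<phi> y - A)"
      by (simp add: right_diff_distrib mult.assoc[symmetric])
    then have "\<bar>\<phi> y - A * norm y powr - \<alpha>\<bar> = norm y powr - \<alpha> * \<bar>norm y powr \<alpha> * \<phi> y - A\<bar>"
      by (simp add: abs_mult)
    also have "\<dots> \<le> norm y powr - \<alpha> * \<epsilon>" using R0[of y] y by (intro mult_left_mono) auto
    finally show ?thesis by (simp add: mult.commute)
  qed
  then show ?thesis using that[of "max 1 R0"] by simp
qed

lemma powr_bound:
  assumes \<beta>: "0 \<le> \<beta>" "\<beta> \<le> \<alpha>"
  obtains D where "0 \<le> D" "\<And>y. y \<noteq> 0 \<Longrightarrow> \<phi> y \<le> D * norm y powr - \<beta>"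
proof -
  obtain R where R: "1 \<le> R" "\<And>y. R \<le> norm y \<Longrightarrow> \<bar>\<phi> y - A * norm y powr - \<alpha>\<bar> \<le> 1 * norm y powr - \<alpha>"
    using tail_close[of 1] by auto
  have "\<phi> y \<le> (A + 1 + M * R powr \<beta>) * norm y powr - \<beta>" if "y \<noteq> 0" for y
  proof (cases "R \<le> norm y")
    case True
    have "\<phi> y \<le> (A + 1) * norm y powr - \<alpha>" using R(2)[OF True] by (simp add: distrib_right abs_le_iff)
    also have "\<dots> \<le> (A + 1) * norm y powr - \<beta>"
      using True R(1) \<beta> A by (intro mult_left_mono powr_mono) auto
    also have "\<dots> \<le> (A + 1 + M * R powr \<beta>) * norm y powr - \<beta>"
      using M_nonneg by (intro mult_right_mono) auto
    finally show ?thesis .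
  next
    case False
    have "\<phi> y \<le> M * (R powr \<beta> * R powr - \<beta>)" using le[of y] R(1) by (simp add: powr_add[symmetric])
    also have "\<dots> \<le> M * (R powr \<beta> * norm y powr - \<beta>)"
      using False that \<beta> M_nonneg by (intro mult_left_mono powr_mono2') auto
    also have "\<dots> \<le> (A + 1 + M * R powr \<beta>) * norm y powr - \<beta>"
      using A by (simp add: distrib_right)
    finally show ?thesis .
  qed
  then show ?thesis using that[of "A + 1 + M * R powr \<beta>"] A M_nonneg by auto
qed

text \<open>For a bounded datum with tail exponent \<open>\<alpha>\<close> all smaller exponents are also available. This covers the
  critical case, where the exponent of the datum itself is not integrable at the origin.\<close>

lemma caloric_decay:
  assumes a: "0 < a" and \<beta>: "0 < \<beta>" "\<beta> \<le> \<alpha>" "\<beta> < real DIM('a)"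
  shows "\<exists>Q\<ge>0. \<forall>t>0. \<forall>x. \<bar>conv (gauss (1 / (4 * a * t))) \<phi> x\<bar> \<le> Q * t powr - (\<beta> / 2)"
proof -
  obtain D where D: "0 \<le> D" "\<And>y. y \<noteq> 0 \<Longrightarrow> \<phi> y \<le> D * norm y powr - \<beta>"
    using powr_bound[of \<beta>] \<beta> by auto
  obtain C where C: "0 \<le> C" and Ci: "\<And>t x. 0 < t \<Longrightarrow> integrable lborel (\<lambda>y::'a. gauss (1 / (4 * a * t)) (x - y) * norm y powr - \<beta>)"
    and Cle: "\<And>t x. 0 < t \<Longrightarrow> (LINT y|lborel. gauss (1 / (4 * a * t)) (x - y::'a) * norm y powr - \<beta>) \<le> C * t powr - (\<beta> / 2)"
    using gauss_norm_powr_bound[OF a \<beta>(1,3)] by blast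
  show ?thesis
  proof (intro exI[of _ "D * C"] conjI allI impI)
    show "0 \<le> D * C" using D C by simp
    fix t :: real and x :: 'a assume t: "0 < t"
    let ?g = "\<lambda>y. gauss (1 / (4 * a * t)) (x - y)"
    have p: "0 < 1 / (4 * a * t)" using a t by simp
    have eq: "conv (gauss (1 / (4 * a * t))) \<phi> x = (LINT y|lborel. ?g y * \<phi> y)"
      by (rule conv_flip) measurable
    have "0 \<le> (LINT y|lborel. ?g y * \<phi> y)" by (rule Bochner_Integration.integral_nonneg) (simp add: nonneg)
    moreover have "(LINT y|lborel. ?g y * \<phi> y) \<le> (LINT y|lborel. D * (?g y * norm y powr - \<beta>))"
    proof (rule integral_mono_AE)
      show "integrable lborel (\<lambda>y. ?g y * \<phi> y)" by (rule conv_flip_integrable[OF gauss_integrable[OF p] bdd])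
      show "integrable lborel (\<lambda>y. D * (?g y * norm y powr - \<beta>))" using Ci[OF t] by simp
      show "AE y in lborel. ?g y * \<phi> y \<le> D * (?g y * norm y powr - \<beta>)"
        using AE_lborel_singleton[of "0::'a"]
      proof eventually_elim
        fix y :: 'a assume "y \<noteq> 0"
        then have "?g y * \<phi> y \<le> ?g y * (D * norm y powr - \<beta>)" by (intro mult_left_mono D) auto
        then show "?g y * \<phi> y \<le> D * (?g y * norm y powr - \<beta>)" by (simp add: mult_ac)
      qed
    qed
    moreover have "(LINT y|lborel. D * (?g y * norm y powr - \<beta>)) \<le> D * (C * t powr - (\<beta> / 2))"
      using Cle[OF t, of x] D(1) by (simp add: mult_left_mono)
    ultimately show "\<bar>conv (gauss (1 / (4 * a * t))) \<phi> x\<bar> \<le> D * C * t powr - (\<beta> / 2)"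
      unfolding eq by (simp add: mult.assoc)
  qed
qed

text \<open>Far out the datum is relatively close to its limiting power, for which the self-similar decay is known;
  the bounded region that is left has finite mass and decays faster, since \<open>\<alpha>\<close> is below the dimension.\<close>

theorem caloric_selfsimilar_limit:
  assumes a: "0 < a" and \<alpha>d: "\<alpha> < real DIM('a)" and \<epsilon>: "0 < \<epsilon>"
  shows "eventually (\<lambda>t. \<forall>x. t powr (\<alpha> / 2) *
     \<bar>conv (gauss (1 / (4 * a * t))) \<phi> x - (LINT y|lborel. gauss (1 / (4 * a * t)) (x - y) * (A * norm y powr - \<alpha>))\<bar> \<le> \<epsilon>) at_top"
proof -
  let ?d = "real DIM('a)" and ?k = "(4 * pi * a) powr - (DIM('a) / 2)"
  obtain C where C: "0 \<le> C" and Ci: "\<And>t x. 0 < t \<Longrightarrow> integrable lborel (\<lambda>y::'a. gauss (1 / (4 * a * t)) (x - y) * norm y powr - \<alpha>)"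
    and Cle: "\<And>t x. 0 < t \<Longrightarrow> (LINT y|lborel. gauss (1 / (4 * a * t)) (x - y::'a) * norm y powr - \<alpha>) \<le> C * t powr - (\<alpha> / 2)"
    using gauss_norm_powr_bound[OF a \<alpha> \<alpha>d] by blast
  \<comment> \<open>The relative error of the tail that costs at most half of the tolerance.\<close>
  define \<eta> where "\<eta> = \<epsilon> / (2 * (C + 1))"
  have \<eta>: "0 < \<eta>" "\<eta> * C \<le> \<epsilon> / 2" using \<epsilon> C by (auto simp: \<eta>_def field_simps)
  obtain R where R: "1 \<le> R" "\<And>y. R \<le> norm y \<Longrightarrow> \<bar>\<phi> y - A * norm y powr - \<alpha>\<bar> \<le> \<eta> * norm y powr - \<alpha>"
    using tail_close[OF \<eta>(1)] by blast
  let ?W = "\<lambda>y::'a. M * indicator (cball 0 R) y + A * (norm y powr - \<alpha> * indicator (cball 0 R) y)"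
  define Z where "Z = (LINT y|lborel. ?W y)"
  have Wi: "integrable lborel ?W"
    using integral_norm_powr_ball(1)[OF \<alpha>d, of R] R(1) by (auto simp: emeasure_cball intro!: Bochner_Integration.integrable_add)
  have W0: "0 \<le> ?W y" for y using M_nonneg A by (auto split: split_indicator)
  have Z0: "0 \<le> Z" unfolding Z_def by (rule Bochner_Integration.integral_nonneg) (use W0 in auto)
  have close: "\<bar>\<phi> y - A * norm y powr - \<alpha>\<bar> \<le> \<eta> * norm y powr - \<alpha> + ?W y" for y
  proof (cases "R \<le> norm y")
    case True
    then show ?thesis using R(2)[OF True] W0[of y] by linarith
  next
    case False
    have "\<bar>\<phi> y - A * norm y powr - \<alpha>\<bar> \<le> M + A * norm y powr - \<alpha>"
    proof -
      have "0 \<le> A * norm y powr - \<alpha>" using A by simp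
      then show ?thesis using nonneg[of y] le[of y] by linarith
    qed
    then show ?thesis using False \<eta>(1) by (simp add: add_increasing)
  qed
  have est: "t powr (\<alpha> / 2) * \<bar>conv (gauss (1 / (4 * a * t))) \<phi> x - (LINT y|lborel. gauss (1 / (4 * a * t)) (x - y) * (A * norm y powr - \<alpha>))\<bar>
     \<le> \<epsilon> / 2 + ?k * Z * t powr ((\<alpha> - ?d) / 2)" if t: "0 < t" for t x
  proof -
    let ?g = "\<lambda>y. gauss (1 / (4 * a * t)) (x - y)"
    have p: "0 < 1 / (4 * a * t)" using a t by simp
    have eq: "conv (gauss (1 / (4 * a * t))) \<phi> x = (LINT y|lborel. ?g y * \<phi> y)"
      by (rule conv_flip) measurable
    have i1: "integrable lborel (\<lambda>y. ?g y * \<phi> y)" by (rule conv_flip_integrable[OF gauss_integrable[OF p] bdd])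
    have i2: "integrable lborel (\<lambda>y. ?g y * (A * norm y powr - \<alpha>))"
      using integrable_mult_right[OF Ci[OF t, of x], of A] by (simp add: mult_ac)
    have "\<bar>(LINT y|lborel. ?g y * \<phi> y) - (LINT y|lborel. ?g y * (A * norm y powr - \<alpha>))\<bar>
       = \<bar>LINT y|lborel. ?g y * (\<phi> y - A * norm y powr - \<alpha>)\<bar>"
      using i1 i2 by (simp add: right_diff_distrib)
    also have "\<dots> \<le> (LINT y|lborel. \<bar>?g y * (\<phi> y - A * norm y powr - \<alpha>)\<bar>)" by (rule integral_abs_bound)
    also have "\<dots> \<le> (LINT y|lborel. \<eta> * (?g y * norm y powr - \<alpha>) + ?k * t powr - (?d / 2) * ?W y)"
    proof (rule integral_mono)
      show "integrable lborel (\<lambda>y. \<bar>?g y * (\<phi> y - A * norm y powr - \<alpha>)\<bar>)"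
        using i1 i2 by (auto simp: right_diff_distrib)
      show "integrable lborel (\<lambda>y. \<eta> * (?g y * norm y powr - \<alpha>) + ?k * t powr - (?d / 2) * ?W y)"
        by (intro Bochner_Integration.integrable_add integrable_mult_right Ci[OF t] Wi)
      fix y
      have "\<bar>?g y * (\<phi> y - A * norm y powr - \<alpha>)\<bar> \<le> ?g y * (\<eta> * norm y powr - \<alpha> + ?W y)"
        unfolding abs_mult using close[of y] by (simp only: abs_of_nonneg[OF gauss_nonneg]) (rule mult_left_mono, auto)
      also have "\<dots> = \<eta> * (?g y * norm y powr - \<alpha>) + ?g y * ?W y" by (simp only: distrib_left mult.left_commute)
      also have "?g y * ?W y \<le> ?k * t powr - (?d / 2) * ?W y"
        by (rule mult_right_mono[OF gauss_scaled_le[OF a t] W0])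
      finally show "\<bar>?g y * (\<phi> y - A * norm y powr - \<alpha>)\<bar> \<le> \<eta> * (?g y * norm y powr - \<alpha>) + ?k * t powr - (?d / 2) * ?W y" by simp
    qed
    also have "\<dots> = \<eta> * (LINT y|lborel. ?g y * norm y powr - \<alpha>) + ?k * t powr - (?d / 2) * Z"
      using Ci[OF t, of x] Wi unfolding Z_def by (subst Bochner_Integration.integral_add) auto
    also have "\<dots> \<le> \<eta> * (C * t powr - (\<alpha> / 2)) + ?k * t powr - (?d / 2) * Z"
      using Cle[OF t, of x] \<eta>(1) by (intro add_right_mono mult_left_mono) auto
    finally have "\<bar>conv (gauss (1 / (4 * a * t))) \<phi> x - (LINT y|lborel. ?g y * (A * norm y powr - \<alpha>))\<bar>
       \<le> \<eta> * (C * t powr - (\<alpha> / 2)) + ?k * t powr - (?d / 2) * Z" unfolding eq .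
    then have "t powr (\<alpha> / 2) * \<bar>conv (gauss (1 / (4 * a * t))) \<phi> x - (LINT y|lborel. ?g y * (A * norm y powr - \<alpha>))\<bar>
       \<le> t powr (\<alpha> / 2) * (\<eta> * (C * t powr - (\<alpha> / 2)) + ?k * t powr - (?d / 2) * Z)" by (intro mult_left_mono) auto
    also have "\<dots> = \<eta> * C * (t powr (\<alpha> / 2) * t powr - (\<alpha> / 2)) + ?k * Z * (t powr (\<alpha> / 2) * t powr - (?d / 2))"
      by (simp add: distrib_left mult_ac)
    also have "t powr (\<alpha> / 2) * t powr - (\<alpha> / 2) = 1" using t by (simp add: powr_add[symmetric])
    also have "t powr (\<alpha> / 2) * t powr - (?d / 2) = t powr ((\<alpha> - ?d) / 2)"
      by (simp add: powr_add[symmetric] diff_divide_distrib)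
    finally show ?thesis using \<eta>(2) by simp
  qed
  have "((\<lambda>t. ?k * Z * t powr ((\<alpha> - ?d) / 2)) \<longlongrightarrow> ?k * Z * 0) at_top"
    using \<alpha>d by (intro tendsto_mult tendsto_const tendsto_neg_powr filterlim_ident) simp
  then have "eventually (\<lambda>t. ?k * Z * t powr ((\<alpha> - ?d) / 2) < \<epsilon> / 2) at_top"
    using \<epsilon> by (intro order_tendstoD) auto
  then show ?thesis
    using eventually_gt_at_top[of 0]
  proof eventually_elim
    fix t :: real assume t: "?k * Z * t powr ((\<alpha> - ?d) / 2) < \<epsilon> / 2" "0 < t"
    show "\<forall>x. t powr (\<alpha> / 2) *
     \<bar>conv (gauss (1 / (4 * a * t))) \<phi> x - (LINT y|lborel. gauss (1 / (4 * a * t)) (x - y) * (A * norm y powr - \<alpha>))\<bar> \<le> \<epsilon>"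
    proof
      fix x
      show "t powr (\<alpha> / 2) *
     \<bar>conv (gauss (1 / (4 * a * t))) \<phi> x - (LINT y|lborel. gauss (1 / (4 * a * t)) (x - y) * (A * norm y powr - \<alpha>))\<bar> \<le> \<epsilon>"
        using est[OF t(2), of x] t(1) by linarith
    qed
  qed
qed

end

text \<open>The profile \<open>exp (- r\<^sup>2)\<close> is Lipschitz with constant 1.\<close>

lemma gauss_translate_difference:
  assumes p: "0 < p"
  shows "\<bar>gauss p (x - y) - gauss p (x::'a::euclidean_space)\<bar> \<le> (p / pi) powr (DIM('a) / 2) * (sqrt p * norm y)"
proof -
  have lip: "\<bar>exp (- r\<^sup>2) - exp (- s\<^sup>2)\<bar> \<le> 1 * \<bar>r - s\<bar>" for r s :: real
  proof -
    have "norm (exp (- r\<^sup>2) - exp (- s\<^sup>2)) \<le> 1 * norm (r - s)"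
    proof (rule field_differentiable_bound[where S=UNIV and f'="\<lambda>r. - (2 * r * exp (- r\<^sup>2))"])
      fix r :: real
      show "((\<lambda>r. exp (- r\<^sup>2)) has_field_derivative - (2 * r * exp (- r\<^sup>2))) (at r within UNIV)"
        by (auto intro!: derivative_eq_intros)
      have "2 * \<bar>r\<bar> \<le> 1 + r\<^sup>2"
        using zero_le_power2[of "\<bar>r\<bar> - 1"] by (simp add: power2_diff)
      also have "\<dots> \<le> exp (r\<^sup>2)" by (rule exp_ge_add_one_self)
      finally have "2 * \<bar>r\<bar> * exp (- r\<^sup>2) \<le> exp (r\<^sup>2) * exp (- r\<^sup>2)" by (rule mult_right_mono) simp
      then show "norm (- (2 * r * exp (- r\<^sup>2))) \<le> 1" by (simp add: abs_mult exp_minus)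
    qed auto
    then show ?thesis by simp
  qed
  have sq: "exp (- p * (norm z)\<^sup>2) = exp (- (sqrt p * norm z)\<^sup>2)" for z :: 'a
    using p by (simp add: power_mult_distrib)
  have "\<bar>exp (- p * (norm (x - y))\<^sup>2) - exp (- p * (norm x)\<^sup>2)\<bar> \<le> \<bar>sqrt p * norm (x - y) - sqrt p * norm x\<bar>"
    unfolding sq using lip by simp
  also have "\<dots> = sqrt p * \<bar>norm (x - y) - norm x\<bar>"
    using p by (simp add: right_diff_distrib[symmetric] abs_mult)
  also have "\<dots> \<le> sqrt p * norm y"
    using norm_triangle_ineq3[of "x - y" x] p by (intro mult_left_mono) auto
  finally have "(p / pi) powr (DIM('a) / 2) * \<bar>exp (- p * (norm (x - y))\<^sup>2) - exp (- p * (norm x)\<^sup>2)\<bar> \<le> (p / pi) powr (DIM('a) / 2) * (sqrt p * norm y)"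
    by (rule mult_left_mono) simp
  then show ?thesis
    unfolding gauss_def by (simp add: right_diff_distrib[symmetric] abs_mult)
qed

section \<open>The critical exponent\<close>

context tail_datum
begin

text \<open>In the critical case the mass of the datum in a ball grows logarithmically, with a coefficient given by the
  area of the unit sphere.\<close>

lemma critical_mass_growth:
  assumes crit: "\<alpha> = real DIM('a)" and \<epsilon>: "0 < \<epsilon>"
  defines "\<kappa> \<equiv> real DIM('a) * unit_ball_vol (real DIM('a))"
  shows "\<exists>K\<ge>0. \<forall>\<rho>\<ge>1. \<bar>(LINT y|lborel. \<phi> y * indicator (cball 0 \<rho>) y) - A * \<kappa> * ln \<rho>\<bar> \<le> \<epsilon> * \<kappa> * ln \<rho> + K"
proof -
  obtain R where R: "1 \<le> R" "\<And>y. R \<le> norm y \<Longrightarrow> \<bar>\<phi> y - A * norm y powr - \<alpha>\<bar> \<le> \<epsilon> * norm y powr - \<alpha>"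
    using tail_close[OF \<epsilon>] by blast
  define K where "K = (LINT y|lborel. (M + A) * indicator (cball (0::'a) R) y)"
  have cb [simp]: "integrable lborel (indicator (cball (0::'a) r) :: 'a \<Rightarrow> real)" for r
    by (cases "0 \<le> r") (auto simp: emeasure_cball)
  show ?thesis
  proof (intro exI[of _ K] conjI allI impI)
    show "0 \<le> K" unfolding K_def using M_nonneg A by (intro Bochner_Integration.integral_nonneg) auto
    fix \<rho> :: real assume \<rho>: "1 \<le> \<rho>"
    let ?S = "{y::'a. 1 \<le> norm y \<and> norm y \<le> \<rho>}"
    let ?s = "\<lambda>y::'a. norm y powr - real DIM('a) * indicator ?S y"
    have si: "integrable lborel ?s" and sv: "(LINT y|lborel. ?s y) = \<kappa> * ln \<rho>"
      using integral_norm_powr_shell[OF \<rho>, where 'a='a] by (simp_all add: \<kappa>_def)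
    have Ii: "integrable lborel (\<lambda>y. \<phi> y * indicator (cball 0 \<rho>) y)"
      using integrable_mult_bdd[OF cb[of \<rho>] bdd] by (simp add: mult.commute)
    have pt: "\<bar>\<phi> y * indicator (cball 0 \<rho>) y - A * ?s y\<bar> \<le> \<epsilon> * ?s y + (M + A) * indicator (cball 0 R) y" for y
    proof -
      consider "\<rho> < norm y" | "norm y \<le> \<rho>" "R \<le> norm y" | "norm y \<le> \<rho>" "norm y < R" "1 \<le> norm y" | "norm y \<le> \<rho>" "norm y < R" "norm y < 1" by linarith
      then show ?thesis
      proof cases
        case 1
        then show ?thesis using \<epsilon> M_nonneg A by (auto split: split_indicator)
      next
        case 2
        then show ?thesis using R(1) R(2)[OF 2(2)] M_nonneg A by (auto simp: crit split: split_indicator)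
      next
        case 3
        have "0 < norm y" using 3 by linarith
        then have s1: "norm y powr - real DIM('a) \<le> 1" using powr_mono[of "- real DIM('a)" 0 "norm y"] 3 by simp
        have "\<bar>\<phi> y - A * norm y powr - real DIM('a)\<bar> \<le> M + A"
        proof -
          have "0 \<le> A * norm y powr - real DIM('a)" "A * norm y powr - real DIM('a) \<le> A * 1"
            using A s1 by (simp, intro mult_left_mono) auto
          then show ?thesis using nonneg[of y] le[of y] A by linarith
        qed
        moreover have "0 \<le> \<epsilon> * norm y powr - real DIM('a)" using \<epsilon> by simp
        ultimately have "\<bar>\<phi> y - A * norm y powr - real DIM('a)\<bar> \<le> \<epsilon> * norm y powr - real DIM('a) + (M + A)" by linarith
        then show ?thesis using 3 by simp
      next
        case 4
        then show ?thesis using nonneg[of y] le[of y] A by simp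
      qed
    qed
    have "\<bar>(LINT y|lborel. \<phi> y * indicator (cball 0 \<rho>) y) - A * \<kappa> * ln \<rho>\<bar>
       = \<bar>LINT y|lborel. \<phi> y * indicator (cball 0 \<rho>) y - A * ?s y\<bar>"
      using Ii si by (subst Bochner_Integration.integral_diff) (simp_all add: sv mult.assoc)
    also have "\<dots> \<le> (LINT y|lborel. \<bar>\<phi> y * indicator (cball 0 \<rho>) y - A * ?s y\<bar>)" by (rule integral_abs_bound)
    also have "\<dots> \<le> (LINT y|lborel. \<epsilon> * ?s y + (M + A) * indicator (cball 0 R) y)"
      by (rule integral_mono[OF _ _ pt]) 
         (intro integrable_abs Bochner_Integration.integrable_diff Bochner_Integration.integrable_add integrable_mult_right Ii si cb)+
    also have "\<dots> = \<epsilon> * \<kappa> * ln \<rho> + K"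
      using si by (subst Bochner_Integration.integral_add) (simp_all add: sv K_def mult.assoc)
    finally show "\<bar>(LINT y|lborel. \<phi> y * indicator (cball 0 \<rho>) y) - A * \<kappa> * ln \<rho>\<bar> \<le> \<epsilon> * \<kappa> * ln \<rho> + K" .
  qed
qed

text \<open>Up to relatively small errors, the caloric function is the heat kernel centred at the origin times the mass of
  the datum within distance \<open>sqrt t\<close>. Moving the mass at \<open>y\<close> to the origin costs a factor
  \<open>norm y / sqrt t\<close> by the Lipschitz bound, which makes the singular power integrable; the mass outside
  contributes its maximal density.\<close>

lemma critical_caloric_concentration:
  assumes a: "0 < a" and crit: "\<alpha> = real DIM('a)"
  shows "\<exists>C\<ge>0. \<forall>t>0. \<forall>x. t powr (DIM('a) / 2) * \<bar>conv (gauss (1 / (4 * a * t))) \<phi> x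
     - gauss (1 / (4 * a * t)) x * (LINT y|lborel. \<phi> y * indicator (cball 0 (sqrt t)) y)\<bar> \<le> C"
proof -
  let ?d = "real DIM('a)" and ?k = "(4 * pi * a) powr - (DIM('a) / 2)"
  let ?\<kappa> = "?d * unit_ball_vol ?d"
  obtain D where D: "0 \<le> D" "\<And>y. y \<noteq> 0 \<Longrightarrow> \<phi> y \<le> D * norm y powr - ?d"
    using powr_bound[of ?d] crit by auto
  define \<beta> where "\<beta> = ?d - 1"
  have \<beta>: "\<beta> < ?d" "?d - \<beta> = 1" by (simp_all add: \<beta>_def)
  define C where "C = ?k * (1 / (2 * sqrt a)) * D * ?\<kappa> + D"
  show ?thesis
  proof (intro exI[of _ C] conjI allI impI)
    show "0 \<le> C" using D(1) a by (simp add: C_def)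
    fix t :: real and x :: 'a assume t: "0 < t"
    define p where "p = 1 / (4 * a * t)"
    have p: "0 < p" using a t by (simp add: p_def)
    have sp: "sqrt p * sqrt t = 1 / (2 * sqrt a)"
    proof -
      have "sqrt p * sqrt t = sqrt (1 / (4 * a))" using t by (simp add: p_def real_sqrt_mult[symmetric])
      then show ?thesis by (simp add: real_sqrt_divide real_sqrt_mult)
    qed
    have kt: "(p / pi) powr (DIM('a) / 2) = ?k * t powr - (?d / 2)"
    proof -
      have "p / pi = inverse ((4 * pi * a) * t)" using a t by (simp add: p_def field_simps)
      then have "(p / pi) powr (DIM('a) / 2) = ((4 * pi * a) * t) powr - (DIM('a) / 2)"
        by (simp only: powr_minus inverse_powr)
      then show ?thesis by (simp only: powr_mult)
    qed
    let ?c = "\<lambda>y::'a. indicator (cball 0 (sqrt t)) y :: real"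
    have cb: "integrable lborel ?c" using t by (auto simp: emeasure_cball)
    have i1: "integrable lborel (\<lambda>y. gauss p (x - y) * \<phi> y)" by (rule conv_flip_integrable[OF gauss_integrable[OF p] bdd])
    have i2: "integrable lborel (\<lambda>y. gauss p x * (\<phi> y * ?c y))"
      using integrable_mult_bdd[OF cb bdd] by (simp add: mult.commute)
    let ?b = "\<lambda>y::'a. norm y powr - \<beta> * indicator (cball 0 (sqrt t)) y"
    let ?B = "\<lambda>y. ?k * t powr - (?d / 2) * sqrt p * D * ?b y + D * t powr - (?d / 2) * gauss p (x - y)"
    have bi: "integrable lborel ?b" and bv: "(LINT y|lborel. ?b y) = ?\<kappa> * sqrt t"
      using integral_norm_powr_ball[OF \<beta>(1), of "sqrt t"] t by (simp_all add: \<beta>(2))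
    have Bi: "integrable lborel ?B"
      by (intro Bochner_Integration.integrable_add integrable_mult_right bi gauss_flip_integrable(1)[OF p])
    have pt: "\<bar>gauss p (x - y) * \<phi> y - gauss p x * (\<phi> y * ?c y)\<bar> \<le> ?B y" if y: "y \<noteq> 0" for y
    proof (cases "norm y \<le> sqrt t")
      case True
      have "norm y * norm y powr - ?d = norm y powr - \<beta>"
      proof -
        have "norm y powr - \<beta> = norm y powr (1 + - ?d)" by (simp add: \<beta>_def)
        also have "\<dots> = norm y powr 1 * norm y powr - ?d" by (rule powr_add)
        finally show ?thesis by simp
      qed
      then have nb: "norm y * (D * norm y powr - ?d) = D * ?b y" using True by simp
      have "\<bar>gauss p (x - y) * \<phi> y - gauss p x * (\<phi> y * ?c y)\<bar> = \<bar>gauss p (x - y) - gauss p x\<bar> * \<phi> y"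
        using True nonneg[of y] by (simp add: left_diff_distrib[symmetric] abs_mult)
      also have "\<dots> \<le> (?k * t powr - (?d / 2) * (sqrt p * norm y)) * (D * norm y powr - ?d)"
        using gauss_translate_difference[OF p, of x y] D(2)[OF y] nonneg[of y] unfolding kt
        by (intro mult_mono) auto
      also have "\<dots> = ?k * t powr - (?d / 2) * sqrt p * (norm y * (D * norm y powr - ?d))" by simp
      also have "\<dots> = ?k * t powr - (?d / 2) * sqrt p * D * ?b y" by (simp only: nb mult.assoc)
      also have "\<dots> \<le> ?B y" using D(1) by simp
      finally show ?thesis .
    next
      case False
      have "norm y powr - ?d \<le> sqrt t powr - ?d" using False t by (intro powr_mono2') auto
      also have "\<dots> = t powr - (?d / 2)" using t by (simp add: powr_half_sqrt[symmetric] powr_powr)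
      finally have "\<phi> y \<le> D * t powr - (?d / 2)"
        using D(2)[OF y] D(1) by (meson mult_left_mono order_trans)
      then have "gauss p (x - y) * \<phi> y \<le> gauss p (x - y) * (D * t powr - (?d / 2))" by (rule mult_left_mono) simp
      then show ?thesis using False nonneg[of y] by (simp add: mult.commute)
    qed
    have eq: "conv (gauss p) \<phi> x = (LINT y|lborel. gauss p (x - y) * \<phi> y)" by (rule conv_flip) measurable
    have "\<bar>conv (gauss p) \<phi> x - gauss p x * (LINT y|lborel. \<phi> y * ?c y)\<bar>
        = \<bar>LINT y|lborel. gauss p (x - y) * \<phi> y - gauss p x * (\<phi> y * ?c y)\<bar>"
      unfolding eq using i1 i2 by simp
    also have "\<dots> \<le> (LINT y|lborel. \<bar>gauss p (x - y) * \<phi> y - gauss p x * (\<phi> y * ?c y)\<bar>)" by (rule integral_abs_bound)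
    also have "\<dots> \<le> (LINT y|lborel. ?B y)"
    proof (rule integral_mono_AE[OF _ Bi])
      show "integrable lborel (\<lambda>y. \<bar>gauss p (x - y) * \<phi> y - gauss p x * (\<phi> y * ?c y)\<bar>)"
        by (intro integrable_abs Bochner_Integration.integrable_diff i1 i2)
      show "AE y in lborel. \<bar>gauss p (x - y) * \<phi> y - gauss p x * (\<phi> y * ?c y)\<bar> \<le> ?B y"
        using AE_lborel_singleton[of "0::'a"] by eventually_elim (rule pt)
    qed
    also have "\<dots> = ?k * t powr - (?d / 2) * sqrt p * D * (?\<kappa> * sqrt t) + D * t powr - (?d / 2)"
      using bi gauss_flip_integrable[OF p, of x] by (subst Bochner_Integration.integral_add) (simp_all add: bv)
    also have "\<dots> = t powr - (?d / 2) * (?k * (sqrt p * sqrt t) * D * ?\<kappa> + D)" by (simp add: algebra_simps)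
    also have "\<dots> = t powr - (?d / 2) * C" by (simp only: sp C_def)
    finally have "t powr (?d / 2) * \<bar>conv (gauss p) \<phi> x - gauss p x * (LINT y|lborel. \<phi> y * ?c y)\<bar> \<le> t powr (?d / 2) * (t powr - (?d / 2) * C)"
      by (rule mult_left_mono) simp
    also have "\<dots> = C" using t by (simp add: powr_add[symmetric] mult.assoc[symmetric])
    finally show "t powr (?d / 2) * \<bar>conv (gauss (1 / (4 * a * t))) \<phi> x
     - gauss (1 / (4 * a * t)) x * (LINT y|lborel. \<phi> y * indicator (cball 0 (sqrt t)) y)\<bar> \<le> C"
      by (simp add: p_def)
  qed
qed

text \<open>The mass within distance \<open>sqrt t\<close> is asymptotic to half the growth coefficient times \<open>ln t\<close>.\<close>

theorem caloric_critical_limit: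
  assumes a: "0 < a" and crit: "\<alpha> = real DIM('a)" and \<epsilon>: "0 < \<epsilon>"
  shows "eventually (\<lambda>t. \<forall>x. t powr (DIM('a) / 2) *
     \<bar>conv (gauss (1 / (4 * a * t))) \<phi> x / ln t - A * (DIM('a) * unit_ball_vol (DIM('a))) / 2 * gauss (1 / (4 * a * t)) x\<bar> \<le> \<epsilon>) at_top"
proof -
  let ?d = "real DIM('a)" and ?k = "(4 * pi * a) powr - (DIM('a) / 2)"
  let ?\<kappa> = "?d * unit_ball_vol ?d"
  have k: "0 < ?k" and \<kappa>: "0 < ?\<kappa>" using a by simp_all
  define \<eta> where "\<eta> = \<epsilon> / (?k * ?\<kappa>)"
  have \<eta>: "0 < \<eta>" "?k * (\<eta> * ?\<kappa> / 2) = \<epsilon> / 2"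
  proof -
    show "0 < \<eta>" unfolding \<eta>_def by (rule divide_pos_pos[OF \<epsilon> mult_pos_pos[OF k \<kappa>]])
    have "r * (\<epsilon> / (r * s) * s / 2) = \<epsilon> / 2" if "0 < r" "0 < s" for r s :: real using that by simp
    then show "?k * (\<eta> * ?\<kappa> / 2) = \<epsilon> / 2" unfolding \<eta>_def using k \<kappa> by blast
  qed
  obtain C where C: "0 \<le> C" "\<And>t x. 0 < t \<Longrightarrow> t powr (DIM('a) / 2) * \<bar>conv (gauss (1 / (4 * a * t))) \<phi> x
     - gauss (1 / (4 * a * t)) x * (LINT y|lborel. \<phi> y * indicator (cball 0 (sqrt t)) y)\<bar> \<le> C"
    using critical_caloric_concentration[OF a crit] by blast
  obtain K where K: "0 \<le> K" "\<And>\<rho>. 1 \<le> \<rho> \<Longrightarrow> \<bar>(LINT y|lborel. \<phi> y * indicator (cball 0 \<rho>) y) - A * ?\<kappa> * ln \<rho>\<bar> \<le> \<eta> * ?\<kappa> * ln \<rho> + K"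
    using critical_mass_growth[OF crit \<eta>(1)] by blast
  have est: "t powr (DIM('a) / 2) * \<bar>conv (gauss (1 / (4 * a * t))) \<phi> x / ln t - A * ?\<kappa> / 2 * gauss (1 / (4 * a * t)) x\<bar>
     \<le> \<epsilon> / 2 + (C + ?k * K) / ln t" if t: "1 < t" for t x
  proof -
    let ?G = "gauss (1 / (4 * a * t)) x" and ?h = "conv (gauss (1 / (4 * a * t))) \<phi> x" and ?tp = "t powr (DIM('a) / 2)"
    define I where "I = (LINT y|lborel. \<phi> y * indicator (cball 0 (sqrt t)) y)"
    have l: "0 < ln t" using t by simp
    have ls: "ln (sqrt t) = ln t / 2" using t by (simp add: ln_sqrt)
    have I: "\<bar>I - A * ?\<kappa> * (ln t / 2)\<bar> \<le> \<eta> * ?\<kappa> * (ln t / 2) + K"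
      using K(2)[of "sqrt t"] t by (simp add: I_def ls)
    have tG: "?tp * ?G \<le> ?k"
    proof -
      have "?tp * ?G \<le> ?tp * (?k * t powr - (DIM('a) / 2))"
        using gauss_scaled_le[OF a, of t x] t by (intro mult_left_mono) auto
      also have "\<dots> = ?k * (?tp * t powr - (DIM('a) / 2))" by simp
      also have "?tp * t powr - (DIM('a) / 2) = 1" using t by (simp add: powr_add[symmetric])
      finally show ?thesis by simp
    qed
    have "?h / ln t - A * ?\<kappa> / 2 * ?G = ((?h - ?G * I) + ?G * (I - A * ?\<kappa> * (ln t / 2))) / ln t"
      using l by (simp add: field_simps)
    then have "?tp * \<bar>?h / ln t - A * ?\<kappa> / 2 * ?G\<bar> = ?tp * \<bar>(?h - ?G * I) + ?G * (I - A * ?\<kappa> * (ln t / 2))\<bar> / ln t"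
      using l by simp
    also have "\<dots> \<le> (?tp * \<bar>?h - ?G * I\<bar> + ?tp * ?G * \<bar>I - A * ?\<kappa> * (ln t / 2)\<bar>) / ln t"
    proof (rule divide_right_mono)
      have "\<bar>(?h - ?G * I) + ?G * (I - A * ?\<kappa> * (ln t / 2))\<bar> \<le> \<bar>?h - ?G * I\<bar> + ?G * \<bar>I - A * ?\<kappa> * (ln t / 2)\<bar>"
        by (rule order_trans[OF abs_triangle_ineq]) (simp add: abs_mult)
      then have "?tp * \<bar>(?h - ?G * I) + ?G * (I - A * ?\<kappa> * (ln t / 2))\<bar> \<le> ?tp * (\<bar>?h - ?G * I\<bar> + ?G * \<bar>I - A * ?\<kappa> * (ln t / 2)\<bar>)"
        by (rule mult_left_mono) simp
      then show "?tp * \<bar>(?h - ?G * I) + ?G * (I - A * ?\<kappa> * (ln t / 2))\<bar> \<le> ?tp * \<bar>?h - ?G * I\<bar> + ?tp * ?G * \<bar>I - A * ?\<kappa> * (ln t / 2)\<bar>"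
        by (simp only: distrib_left mult.assoc)
    qed (use l in simp)
    also have "\<dots> \<le> (C + ?k * (\<eta> * ?\<kappa> * (ln t / 2) + K)) / ln t"
    proof (intro divide_right_mono add_mono)
      show "?tp * \<bar>?h - ?G * I\<bar> \<le> C" using C(2)[of t x] t by (simp add: I_def)
      show "?tp * ?G * \<bar>I - A * ?\<kappa> * (ln t / 2)\<bar> \<le> ?k * (\<eta> * ?\<kappa> * (ln t / 2) + K)"
        using tG I by (intro mult_mono) auto
    qed (use l in simp)
    also have "\<dots> = ?k * (\<eta> * ?\<kappa> / 2) + (C + ?k * K) / ln t"
      using l by (simp add: field_simps)
    finally show ?thesis by (simp only: \<eta>(2))
  qed
  have "((\<lambda>t::real. (C + ?k * K) / ln t) \<longlongrightarrow> 0) at_top"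
    by (intro tendsto_divide_0[OF tendsto_const] filterlim_at_top_imp_at_infinity ln_at_top)
  then have "eventually (\<lambda>t. (C + ?k * K) / ln t < \<epsilon> / 2) at_top"
    using \<epsilon> by (intro order_tendstoD) auto
  then show ?thesis
    using eventually_gt_at_top[of 1]
  proof eventually_elim
    fix t :: real assume t: "(C + ?k * K) / ln t < \<epsilon> / 2" "1 < t"
    show "\<forall>x. t powr (DIM('a) / 2) *
     \<bar>conv (gauss (1 / (4 * a * t))) \<phi> x / ln t - A * (DIM('a) * unit_ball_vol (DIM('a))) / 2 * gauss (1 / (4 * a * t)) x\<bar> \<le> \<epsilon>"
    proof
      fix x
      show "t powr (DIM('a) / 2) *
     \<bar>conv (gauss (1 / (4 * a * t))) \<phi> x / ln t - A * (DIM('a) * unit_ball_vol (DIM('a))) / 2 * gauss (1 / (4 * a * t)) x\<bar> \<le> \<epsilon>"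
        using est[OF t(2), of x] t(1) by linarith
    qed
  qed
qed

end

section \<open>Asymptotics of the nonlocal solution\<close>

lemma heat_kernel_gauss:
  assumes "0 < a" "0 < t"
  shows "heat_kernel a x t = gauss (1 / (4 * a * t)) x"
proof -
  have "(1 / (4 * a * t) / pi) = inverse (4 * pi * a * t)" using assms by (simp add: field_simps)
  then have "(1 / (4 * a * t) / pi) powr (real CARD('a) / 2) = (4 * pi * a * t) powr - (real CARD('a) / 2)"
    by (simp only: powr_minus inverse_powr)
  then show ?thesis by (simp add: heat_kernel_def gauss_def)
qed

lemma Linf_norm_le:
  assumes "w \<in> borel_measurable lebesgue" "\<And>x. \<bar>w x\<bar> \<le> c"
  shows "Linf_norm S w \<le> ennreal c"
  unfolding Linf_norm_def
proof (rule esssup_I)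
  have "w \<in> borel_measurable (lebesgue_on S)" using assms(1) by (rule measurable_restrict_space1)
  then show "(\<lambda>x. ennreal \<bar>w x\<bar>) \<in> borel_measurable (lebesgue_on S)" by measurable
  show "AE x in lebesgue_on S. ennreal \<bar>w x\<bar> \<le> ennreal c" using assms(2) by (intro AE_I2 ennreal_leI)
qed

lemma weighted_Linf_norm_le:
  assumes "w \<in> borel_measurable lebesgue" "0 < c" "\<And>x. c * \<bar>w x\<bar> \<le> d"
  shows "ennreal c * Linf_norm S w \<le> ennreal d"
proof -
  have "ennreal c * Linf_norm S w \<le> ennreal c * ennreal (d / c)"
    by (intro mult_left_mono Linf_norm_le) (use assms in \<open>auto simp: le_divide_eq mult.commute\<close>)
  also have "\<dots> = ennreal d" using assms(2) by (simp add: ennreal_mult'[symmetric])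
  finally show ?thesis .
qed

text \<open>The estimates below are uniform in the space variable, so the convergence holds with the
  supremum over the whole space and a fortiori over any family of sets \<open>S t\<close>.\<close>

lemma weighted_Linf_norm_tendsto_0:
  assumes meas: "\<And>t. 0 < t \<Longrightarrow> w t \<in> borel_measurable lebesgue"
    and lim: "\<And>\<epsilon>. 0 < \<epsilon> \<Longrightarrow> eventually (\<lambda>t. \<forall>x. t powr b * \<bar>w t x\<bar> \<le> \<epsilon>) at_top"
  shows "((\<lambda>t. ennreal (t powr b) * Linf_norm (S t) (w t)) \<longlongrightarrow> 0) at_top"
proof (rule order_tendstoI)
  fix e :: ennreal assume "0 < e"
  then obtain r where r: "0 < r" "r < e" using dense by blast
  then obtain \<epsilon> where \<epsilon>: "r = ennreal \<epsilon>" "0 < \<epsilon>" by (cases r) (auto simp: ennreal_less_zero_iff)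
  show "eventually (\<lambda>t. ennreal (t powr b) * Linf_norm (S t) (w t) < e) at_top"
    using lim[OF \<epsilon>(2)] eventually_gt_at_top[of 0]
  proof eventually_elim
    fix t :: real assume t: "\<forall>x. t powr b * \<bar>w t x\<bar> \<le> \<epsilon>" "0 < t"
    have "ennreal (t powr b) * Linf_norm (S t) (w t) \<le> r"
      unfolding \<epsilon>(1) by (rule weighted_Linf_norm_le) (use t meas in auto)
    then show "ennreal (t powr b) * Linf_norm (S t) (w t) < e" using r(2) by (rule le_less_trans)
  qed
qed simp

lemma exp_minus_le_powr:
  fixes \<gamma> :: real
  assumes "0 \<le> \<gamma>"
  shows "\<exists>C\<ge>0. \<forall>t>0. exp (- t) \<le> C * t powr - \<gamma>"
proof -
  obtain n :: nat where n: "\<gamma> \<le> real n" using real_arch_simple by blast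
  have "exp (- t) \<le> (1 + fact n) * t powr - \<gamma>" if t: "0 < t" for t :: real
  proof -
    have "t powr \<gamma> \<le> 1 + t ^ n"
    proof (cases "t \<le> 1")
      case True
      then have "t powr \<gamma> \<le> 1" using t assms by (intro powr_le1) auto
      then show ?thesis using t by (simp add: add_increasing2)
    next
      case False
      then have "t powr \<gamma> \<le> t powr real n" using n by (intro powr_mono) auto
      then show ?thesis using t by (simp add: powr_realpow)
    qed
    also have "t ^ n \<le> fact n * exp t"
    proof -
      have "(\<Sum>k\<in>{n}. t ^ k / fact k) \<le> exp t"
        unfolding sums_unique[OF exp_sums] using t by (intro sum_le_suminf sums_summable[OF exp_sums]) auto
      then show ?thesis by (simp add: divide_le_eq mult.commute)
    qed
    also have "1 + fact n * exp t \<le> (1 + fact n) * exp t" using t by (simp add: distrib_right)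
    finally have "t powr \<gamma> \<le> (1 + fact n) * exp t" by simp
    then show ?thesis using t by (simp add: exp_minus powr_minus field_simps)
  qed
  then show ?thesis by (intro exI[of _ "1 + fact n"]) auto
qed

text \<open>A solution with its datum replaced by a Borel representative \<open>\<phi>\<close>.\<close>

locale nonlocal_problem = tail_datum \<phi> M A \<alpha>
  for \<phi> :: "real^'n \<Rightarrow> real" and M A \<alpha> +
  fixes J :: "real^'n \<Rightarrow> real" and u0 :: "real^'n \<Rightarrow> real" and u :: "real^'n \<Rightarrow> real \<Rightarrow> real"
  assumes J: "convolution_kernel J" and sol: "nonlocal_solution J u0 u"
    and u0_meas: "u0 \<in> borel_measurable lebesgue" and u0_le: "\<And>x. \<bar>u0 x\<bar> \<le> M"
    and u0_AE: "AE x in lborel. u0 x = \<phi> x" and \<alpha>_le: "\<alpha> \<le> real CARD('n)"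
begin

definition a :: real where "a = diffusivity J"

lemma a_pos: "0 < a" unfolding a_def by (rule conv_power_gauss_difference(1)[OF J])

sublocale prob_kernel J
  by unfold_locales (rule conv_power_gauss_difference(3-5)[OF J])+

text \<open>The caloric function with the same datum and the diffusivity of the jump kernel.\<close>

definition h :: "real^'n \<Rightarrow> real \<Rightarrow> real" where
  "h x t = conv (gauss (1 / (4 * a * t))) \<phi> x"

lemma heat_solution_eq:
  assumes "0 < t"
  shows "heat_solution a u0 x t = h x t"
proof -
  have "heat_solution a u0 x t = (LINT y|lebesgue. gauss (1 / (4 * a * t)) (x - y) * u0 y)"
    unfolding heat_solution_def by (simp add: heat_kernel_gauss[OF a_pos assms])
  also have "\<dots> = h x t"
    unfolding h_def by (rule lebesgue_conv_eq) (use u0_meas u0_AE in auto)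
  finally show ?thesis .
qed

lemma U_power_eq:
  assumes "0 < t"
  shows "U_power a \<alpha> A x t = (LINT y|lborel. gauss (1 / (4 * a * t)) (x - y) * (A * norm y powr - \<alpha>))"
  unfolding U_power_def heat_solution_def heat_kernel_gauss[OF a_pos assms]
  by (rule integral_completion) measurable

lemma h_measurable [measurable]: "(\<lambda>x. h x t) \<in> borel_measurable borel"
  unfolding h_def[abs_def] by measurable

lemma representation: "0 \<le> t \<Longrightarrow> u x t = exp (- t) * (u0 x - \<phi> x) + jump_semigroup J t \<phi> x"
  by (rule nonlocal_solution_representation[OF J sol u0_meas u0_le bdd u0_AE])

lemma u_measurable:
  assumes "0 \<le> t"
  shows "(\<lambda>x. u x t) \<in> borel_measurable lebesgue"
proof -
  have "jump_semigroup J t \<phi> \<in> borel_measurable lebesgue"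
    using bdd_borel_meas[OF bdd_jump_semigroup[OF bdd assms]] by (simp add: measurable_completion)
  moreover have "\<phi> \<in> borel_measurable lebesgue" by (simp add: measurable_completion)
  ultimately show ?thesis unfolding representation[OF assms] using u0_meas by measurable
qed

lemma lborel_to_lebesgue: "f \<in> borel_measurable borel \<Longrightarrow> f \<in> borel_measurable lebesgue"
  for f :: "real^'n \<Rightarrow> real"
  by (simp add: measurable_completion)

text \<open>The caloric function decays with any exponent \<open>\<beta> / 2\<close> below \<open>\<alpha> / 2\<close>, and the comparison of the semigroups
  gains one half. As \<open>\<mu>\<close> is below one half, such a \<open>\<beta>\<close> reaches the required exponent.\<close>

lemma rate:
  assumes \<mu>: "0 < \<mu>" "\<mu> < \<alpha> / (2 * real CARD('n))"
  shows "\<exists>C\<ge>0. \<forall>t>0. \<forall>x. \<bar>u x t - h x t\<bar> \<le> C * t powr - (\<alpha> / 2 + \<mu>)"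
proof -
  let ?\<gamma> = "\<alpha> / 2 + \<mu>"
  have "\<alpha> / (2 * real CARD('n)) \<le> 1 / 2" using \<alpha>_le by (simp add: divide_le_eq)
  then have "2 * \<mu> < 1" using \<mu>(2) by linarith
  \<comment> \<open>The exponent must be positive, below \<alpha>, and satisfy \<alpha> / 2 + \<mu> \<le> \<beta> / 2 + 1 / 2.\<close>
  then have "max 0 (\<alpha> + 2 * \<mu> - 1) < \<alpha>" using \<alpha> by (simp add: max_def)
  then obtain \<beta> where "max 0 (\<alpha> + 2 * \<mu> - 1) < \<beta>" "\<beta> < \<alpha>" using dense by blast
  then have \<beta>: "0 < \<beta>" "\<alpha> + 2 * \<mu> - 1 < \<beta>" "\<beta> < \<alpha>" by auto
  obtain Q where Q: "\<And>t x. 0 < t \<Longrightarrow> \<bar>conv (gauss (1 / (4 * a * t))) \<phi> x\<bar> \<le> Q * t powr - (\<beta> / 2)"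
    using caloric_decay[OF a_pos \<beta>(1)] \<beta>(3) \<alpha>_le by auto
  obtain E where E: "0 \<le> E" "\<And>t x. 0 < t \<Longrightarrow> \<bar>jump_semigroup J t \<phi> x - h x t\<bar> \<le> E * t powr - ?\<gamma>"
    using jump_gauss_difference_decay[OF J bdd, folded a_def, OF Q, of ?\<gamma>] \<beta> \<alpha> \<mu> unfolding h_def by auto
  obtain D where D: "0 \<le> D" "\<And>t. 0 < t \<Longrightarrow> exp (- t) \<le> D * t powr - ?\<gamma>"
    using exp_minus_le_powr[of ?\<gamma>] \<alpha> \<mu> by auto
  show ?thesis
  proof (intro exI[of _ "E + 2 * M * D"] conjI allI impI)
    show "0 \<le> E + 2 * M * D" using E(1) D(1) M_nonneg by simp
    fix t :: real and x assume t: "0 < t"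
    have "\<bar>exp (- t) * (u0 x - \<phi> x)\<bar> \<le> exp (- t) * (2 * M)"
      using u0_le[of x] bdd_borel_le[OF bdd, of x] by (simp add: abs_mult)
    also have "\<dots> \<le> D * t powr - ?\<gamma> * (2 * M)" using D(2)[OF t] M_nonneg by (intro mult_right_mono) auto
    finally have "\<bar>u x t - h x t\<bar> \<le> E * t powr - ?\<gamma> + D * t powr - ?\<gamma> * (2 * M)"
      using E(2)[OF t, of x] representation[of t x] t by linarith
    then show "\<bar>u x t - h x t\<bar> \<le> (E + 2 * M * D) * t powr - ?\<gamma>" by (simp add: algebra_simps)
  qed
qed

lemma some_rate:
  obtains C \<mu> where "0 \<le> C" "0 < \<mu>" "\<And>t x. 0 < t \<Longrightarrow> t powr (\<alpha> / 2) * \<bar>u x t - h x t\<bar> \<le> C * t powr - \<mu>"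
proof -
  define \<mu> where "\<mu> = \<alpha> / (4 * real CARD('n))"
  have \<mu>: "0 < \<mu>" "\<mu> < \<alpha> / (2 * real CARD('n))" using \<alpha> by (auto simp: \<mu>_def field_simps)
  obtain C where C: "0 \<le> C" "\<And>t x. 0 < t \<Longrightarrow> \<bar>u x t - h x t\<bar> \<le> C * t powr - (\<alpha> / 2 + \<mu>)"
    using rate[OF \<mu>] by blast
  have "t powr (\<alpha> / 2) * \<bar>u x t - h x t\<bar> \<le> C * t powr - \<mu>" if t: "0 < t" for t x
  proof -
    have "t powr (\<alpha> / 2) * \<bar>u x t - h x t\<bar> \<le> t powr (\<alpha> / 2) * (C * t powr - (\<alpha> / 2 + \<mu>))"
      by (rule mult_left_mono[OF C(2)[OF t]]) simp
    also have "\<dots> = C * (t powr (\<alpha> / 2) * t powr - (\<alpha> / 2 + \<mu>))" by simp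
    also have "t powr (\<alpha> / 2) * t powr - (\<alpha> / 2 + \<mu>) = t powr - \<mu>" by (simp add: powr_add[symmetric])
    finally show ?thesis .
  qed
  then show ?thesis using that[OF C(1) \<mu>(1)] by blast
qed

lemma weighted_difference_small:
  assumes "0 < \<epsilon>"
  shows "eventually (\<lambda>t. \<forall>x. t powr (\<alpha> / 2) * \<bar>u x t - h x t\<bar> \<le> \<epsilon>) at_top"
proof -
  obtain C \<mu> where C: "0 \<le> C" "0 < \<mu>" "\<And>t x. 0 < t \<Longrightarrow> t powr (\<alpha> / 2) * \<bar>u x t - h x t\<bar> \<le> C * t powr - \<mu>"
    using some_rate by blast
  have "((\<lambda>t. C * t powr - \<mu>) \<longlongrightarrow> C * 0) at_top"
    using C(2) by (intro tendsto_mult tendsto_const tendsto_neg_powr filterlim_ident) simp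
  then have "eventually (\<lambda>t. C * t powr - \<mu> < \<epsilon>) at_top" using assms by (intro order_tendstoD) auto
  then show ?thesis using eventually_gt_at_top[of 0]
    by eventually_elim (use C(3) in \<open>meson less_imp_le order_trans\<close>)
qed

lemma u_bounded: "\<exists>B\<ge>0. \<forall>x. \<forall>t\<ge>0. u x t \<le> B"
proof -
  obtain B where B: "\<And>x t. 0 \<le> t \<Longrightarrow> \<bar>u x t\<bar> \<le> B" using sol by (auto simp: nonlocal_solution_def)
  have "0 \<le> B" using order_trans[OF abs_ge_zero B[of 0 0]] by simp
  moreover have "u x t \<le> B" if "0 \<le> t" for x t using B[OF that, of x] by linarith
  ultimately show ?thesis by blast
qed

lemma subcritical_decay:
  assumes "\<alpha> < real CARD('n)"
  shows "\<exists>C. \<forall>x. \<forall>t>0. u x t \<le> C * t powr - (\<alpha> / 2)"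
proof -
  obtain C \<mu> where C: "0 \<le> C" "0 < \<mu>" "\<And>t x. 0 < t \<Longrightarrow> t powr (\<alpha> / 2) * \<bar>u x t - h x t\<bar> \<le> C * t powr - \<mu>"
    using some_rate by blast
  obtain Q where Q: "0 \<le> Q" "\<And>t x. 0 < t \<Longrightarrow> \<bar>h x t\<bar> \<le> Q * t powr - (\<alpha> / 2)"
    using caloric_decay[OF a_pos \<alpha>] assms unfolding h_def by auto
  obtain B where B: "0 \<le> B" "\<And>x t. 0 \<le> t \<Longrightarrow> u x t \<le> B" using u_bounded by blast
  have "u x t \<le> (C + Q + B) * t powr - (\<alpha> / 2)" if t: "0 < t" for x t
  proof (cases "t \<le> 1")
    case True
    have "1 \<le> t powr - (\<alpha> / 2)" using True t \<alpha> powr_mono2'[of "- (\<alpha> / 2)" t 1] by simp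
    then have "B * 1 \<le> (C + Q + B) * t powr - (\<alpha> / 2)" using B(1) C(1) Q(1) by (intro mult_mono) auto
    then show ?thesis using B(2)[of t x] t by simp
  next
    case False
    have "t powr - \<mu> \<le> 1" using False C(2) powr_mono[of "- \<mu>" 0 t] by simp
    then have "C * t powr - \<mu> \<le> C * 1" using C(1) by (rule mult_left_mono)
    then have "t powr (\<alpha> / 2) * \<bar>u x t - h x t\<bar> \<le> C" using C(3)[OF t, of x] by simp
    then have "\<bar>u x t - h x t\<bar> \<le> C * t powr - (\<alpha> / 2)"
      using t by (simp add: powr_minus field_simps)
    then have "u x t \<le> (C + Q) * t powr - (\<alpha> / 2)" using Q(2)[OF t, of x] by (simp add: distrib_right)
    also have "\<dots> \<le> (C + Q + B) * t powr - (\<alpha> / 2)" using B(1) by (intro mult_right_mono) auto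
    finally show ?thesis .
  qed
  then show ?thesis by blast
qed

lemma subcritical_limit:
  assumes "\<alpha> < real CARD('n)"
  shows "((\<lambda>t. ennreal (t powr (\<alpha> / 2)) * Linf_norm (S t) (\<lambda>x. u x t - U_power a \<alpha> A x t)) \<longlongrightarrow> 0) at_top"
proof (rule weighted_Linf_norm_tendsto_0)
  fix t :: real assume t: "0 < t"
  have "(\<lambda>x. U_power a \<alpha> A x t) \<in> borel_measurable borel"
    unfolding U_power_eq[OF t] by measurable
  then show "(\<lambda>x. u x t - U_power a \<alpha> A x t) \<in> borel_measurable lebesgue"
    using t by (intro borel_measurable_diff u_measurable lborel_to_lebesgue) auto
next
  fix \<epsilon> :: real assume \<epsilon>: "0 < \<epsilon>"
  then have \<epsilon>2: "0 < \<epsilon> / 2" by simp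
  have "\<alpha> < real DIM(real^'n)" using assms by simp
  from weighted_difference_small[OF \<epsilon>2] caloric_selfsimilar_limit[OF a_pos this \<epsilon>2] eventually_gt_at_top[of 0]
  show "eventually (\<lambda>t. \<forall>x. t powr (\<alpha> / 2) * \<bar>u x t - U_power a \<alpha> A x t\<bar> \<le> \<epsilon>) at_top"
  proof eventually_elim
    case (elim t)
    show ?case
    proof
      fix x
      have "\<bar>u x t - U_power a \<alpha> A x t\<bar> \<le> \<bar>u x t - h x t\<bar> + \<bar>h x t - U_power a \<alpha> A x t\<bar>" by simp
      then have "t powr (\<alpha> / 2) * \<bar>u x t - U_power a \<alpha> A x t\<bar> \<le> t powr (\<alpha> / 2) * (\<bar>u x t - h x t\<bar> + \<bar>h x t - U_power a \<alpha> A x t\<bar>)"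
        by (rule mult_left_mono) simp
      moreover have "t powr (\<alpha> / 2) * \<bar>h x t - U_power a \<alpha> A x t\<bar> \<le> \<epsilon> / 2"
        unfolding U_power_eq[OF elim(3)] h_def using elim(2) by blast
      ultimately show "t powr (\<alpha> / 2) * \<bar>u x t - U_power a \<alpha> A x t\<bar> \<le> \<epsilon>"
        using elim(1)[rule_format, of x] by (simp add: distrib_left)
    qed
  qed
qed

lemma critical_small:
  assumes crit: "\<alpha> = real CARD('n)" and \<epsilon>: "0 < \<epsilon>"
  shows "eventually (\<lambda>t. \<forall>x. t powr (real CARD('n) / 2) *
    \<bar>u x t / ln t - A * (real CARD('n) * unit_ball_vol (real CARD('n))) / 2 * heat_kernel a x t\<bar> \<le> \<epsilon>) at_top"
proof -
  have \<epsilon>2: "0 < \<epsilon> / 2" using \<epsilon> by simp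
  have "\<alpha> = real DIM(real^'n)" using crit by simp
  from weighted_difference_small[OF \<epsilon>2] caloric_critical_limit[OF a_pos this \<epsilon>2] eventually_ge_at_top[of "exp 1"]
  show ?thesis
  proof eventually_elim
    case (elim t)
    have t: "0 < t" "1 \<le> ln t"
      using elim(3) less_le_trans[OF exp_gt_zero elim(3)] by (auto simp: ln_ge_iff)
    show ?case
    proof
      fix x
      let ?c = "A * (real CARD('n) * unit_ball_vol (real CARD('n))) / 2" and ?p = "t powr (real CARD('n) / 2)"
      have "\<bar>u x t - h x t\<bar> / ln t \<le> \<bar>u x t - h x t\<bar>"
        using t(2) mult_left_mono[OF t(2), of "\<bar>u x t - h x t\<bar>"] by (simp add: divide_le_eq)
      moreover have "u x t / ln t - ?c * heat_kernel a x t = (u x t - h x t) / ln t + (h x t / ln t - ?c * heat_kernel a x t)"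
        by (simp add: diff_divide_distrib)
      then have "\<bar>u x t / ln t - ?c * heat_kernel a x t\<bar> \<le> \<bar>u x t - h x t\<bar> / ln t + \<bar>h x t / ln t - ?c * heat_kernel a x t\<bar>"
        using abs_triangle_ineq[of "(u x t - h x t) / ln t" "h x t / ln t - ?c * heat_kernel a x t"] t(2) by simp
      ultimately have "\<bar>u x t / ln t - ?c * heat_kernel a x t\<bar> \<le> \<bar>u x t - h x t\<bar> + \<bar>h x t / ln t - ?c * heat_kernel a x t\<bar>" by linarith
      then have "?p * \<bar>u x t / ln t - ?c * heat_kernel a x t\<bar> \<le> ?p * (\<bar>u x t - h x t\<bar> + \<bar>h x t / ln t - ?c * heat_kernel a x t\<bar>)"
        by (rule mult_left_mono) simp
      moreover have "?p * \<bar>u x t - h x t\<bar> \<le> \<epsilon> / 2" using elim(1) by (simp add: crit)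
      moreover have "?p * \<bar>h x t / ln t - ?c * heat_kernel a x t\<bar> \<le> \<epsilon> / 2"
        using elim(2) unfolding h_def heat_kernel_gauss[OF a_pos t(1)] by simp
      ultimately show "?p * \<bar>u x t / ln t - ?c * heat_kernel a x t\<bar> \<le> \<epsilon>" by (simp add: distrib_left)
    qed
  qed
qed

lemma critical_limit:
  assumes crit: "\<alpha> = real CARD('n)"
  shows "((\<lambda>t. ennreal (t powr (real CARD('n) / 2)) * Linf_norm (S t)
    (\<lambda>x. u x t / ln t - A * (real CARD('n) * unit_ball_vol (real CARD('n))) / 2 * heat_kernel a x t)) \<longlongrightarrow> 0) at_top"
proof (rule weighted_Linf_norm_tendsto_0[OF _ critical_small[OF crit]])
  fix t :: real assume t: "0 < t"
  show "(\<lambda>x. u x t / ln t - A * (real CARD('n) * unit_ball_vol (real CARD('n))) / 2 * heat_kernel a x t) \<in> borel_measurable lebesgue"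
    unfolding heat_kernel_gauss[OF a_pos t]
    by (intro borel_measurable_diff borel_measurable_divide u_measurable borel_measurable_const lborel_to_lebesgue)
       (use t in \<open>auto intro!: borel_measurable_times\<close>)
qed

lemma critical_decay:
  assumes crit: "\<alpha> = real CARD('n)"
  shows "\<exists>C. \<forall>x. \<forall>t\<ge>2. u x t \<le> C * t powr - (real CARD('n) / 2) * ln t"
proof -
  let ?N = "real CARD('n)"
  let ?c = "A * (?N * unit_ball_vol ?N) / 2" and ?k = "(4 * pi * a) powr - (?N / 2)"
  obtain T0 where T0: "\<And>t x. T0 \<le> t \<Longrightarrow> t powr (?N / 2) * \<bar>u x t / ln t - ?c * heat_kernel a x t\<bar> \<le> 1"
    using critical_small[OF crit, of 1] unfolding eventually_at_top_linorder by auto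
  define T where "T = max 2 T0"
  obtain B where B: "0 \<le> B" "\<And>x t. 0 \<le> t \<Longrightarrow> u x t \<le> B" using u_bounded by blast
  have c0: "0 \<le> ?c" using A by simp
  define C where "C = 1 + ?c * ?k + B * T powr (?N / 2) / ln 2"
  have l2: "0 < ln (2::real)" by simp
  have "u x t \<le> C * t powr - (?N / 2) * ln t" if t: "2 \<le> t" for x t
  proof (cases "T \<le> t")
    case True
    have l: "0 < ln t" using t by simp
    let ?p = "t powr (?N / 2)"
    have pp: "?p * t powr - (?N / 2) = 1" using t by (simp add: powr_add[symmetric])
    have "heat_kernel a x t \<le> ?k * t powr - (?N / 2)"
      using gauss_scaled_le[OF a_pos, of t x] t by (simp add: heat_kernel_gauss[OF a_pos])
    then have "?p * (?c * heat_kernel a x t) \<le> ?p * (?c * (?k * t powr - (?N / 2)))"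
      using c0 by (intro mult_left_mono) auto
    also have "\<dots> = ?c * ?k * (?p * t powr - (?N / 2))" by simp
    finally have 1: "?p * (?c * heat_kernel a x t) \<le> ?c * ?k" unfolding pp by simp
    have "?p * (u x t / ln t - ?c * heat_kernel a x t) \<le> ?p * \<bar>u x t / ln t - ?c * heat_kernel a x t\<bar>"
      by (rule mult_left_mono) auto
    also have "\<dots> \<le> 1" using T0[of t x] True by (simp add: T_def)
    finally have "?p * (u x t / ln t) \<le> 1 + ?c * ?k" using 1 by (simp add: right_diff_distrib)
    also have "\<dots> \<le> C" using B(1) l2 by (simp add: C_def)
    finally have "t powr - (?N / 2) * (?p * (u x t / ln t)) \<le> t powr - (?N / 2) * C" by (rule mult_left_mono) simp
    moreover have "t powr - (?N / 2) * (?p * (u x t / ln t)) = (?p * t powr - (?N / 2)) * (u x t / ln t)"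
      by (simp only: mult_ac)
    ultimately have "u x t / ln t \<le> t powr - (?N / 2) * C" by (simp only: pp mult_1)
    then have "u x t / ln t \<le> C * t powr - (?N / 2)" by (simp only: mult.commute)
    then show ?thesis by (simp only: pos_divide_le_eq[OF l])
  next
    case False
    have "B = B * T powr (?N / 2) / ln 2 * T powr - (?N / 2) * ln 2"
      using l2 by (simp add: powr_minus T_def)
    also have "\<dots> \<le> C * t powr - (?N / 2) * ln t"
    proof (intro mult_mono)
      show "B * T powr (?N / 2) / ln 2 \<le> C" using c0 by (simp add: C_def)
      show "T powr - (?N / 2) \<le> t powr - (?N / 2)" using False t by (intro powr_mono2') auto
      show "ln 2 \<le> ln t" using t by simp
    qed (use B(1) c0 l2 in \<open>auto simp: C_def intro!: add_nonneg_nonneg mult_nonneg_nonneg divide_nonneg_nonneg\<close>)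
    finally show ?thesis using B(2)[of t x] t by simp
  qed
  then show ?thesis by blast
qed

lemma global_rate:
  assumes \<mu>: "0 < \<mu>" "\<mu> < \<alpha> / (2 * real CARD('n))"
  shows "\<exists>C. \<forall>t>0. ennreal (t powr (\<alpha> / 2)) * Linf_norm UNIV (\<lambda>x. u x t - heat_solution a u0 x t)
    \<le> ennreal (C * t powr - \<mu>)"
proof -
  obtain C where C: "\<And>t x. 0 < t \<Longrightarrow> \<bar>u x t - h x t\<bar> \<le> C * t powr - (\<alpha> / 2 + \<mu>)"
    using rate[OF \<mu>] by blast
  show ?thesis
  proof (intro exI[of _ C] allI impI weighted_Linf_norm_le)
    fix t :: real assume t: "0 < t"
    show "(\<lambda>x. u x t - heat_solution a u0 x t) \<in> borel_measurable lebesgue"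
      unfolding heat_solution_eq[OF t] using t by (intro borel_measurable_diff u_measurable lborel_to_lebesgue h_measurable) simp
    show "0 < t powr (\<alpha> / 2)" using t by simp
    fix x
    have "t powr (\<alpha> / 2) * \<bar>u x t - h x t\<bar> \<le> t powr (\<alpha> / 2) * (C * t powr - (\<alpha> / 2 + \<mu>))"
      by (rule mult_left_mono[OF C[OF t]]) simp
    also have "\<dots> = C * (t powr (\<alpha> / 2) * t powr - (\<alpha> / 2 + \<mu>))" by simp
    also have "t powr (\<alpha> / 2) * t powr - (\<alpha> / 2 + \<mu>) = t powr - \<mu>" by (simp add: powr_add[symmetric])
    finally show "t powr (\<alpha> / 2) * \<bar>u x t - heat_solution a u0 x t\<bar> \<le> C * t powr - \<mu>"
      unfolding heat_solution_eq[OF t] .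
  qed
qed

end

theorem theorem2p1:
  fixes A :: real
  assumes "A > 0"
  shows "\<exists>C_AN :: real. \<forall>(J :: real^'n \<Rightarrow> real) (u0 :: real^'n \<Rightarrow> real) (\<alpha> :: real)
            (u :: real^'n \<Rightarrow> real \<Rightarrow> real).
     convolution_kernel J \<longrightarrow>
     u0 \<in> borel_measurable lebesgue \<longrightarrow>
     bounded (range u0) \<longrightarrow>
     (\<forall>x. 0 \<le> u0 x) \<longrightarrow>
     0 < \<alpha> \<longrightarrow> \<alpha> \<le> real CARD('n) \<longrightarrow>
     ((\<lambda>x. norm x powr \<alpha> * u0 x) \<longlongrightarrow> A) at_infinity \<longrightarrow>
     nonlocal_solution J u0 u \<longrightarrow>
       (\<forall>\<mu>. 0 < \<mu> \<and> \<mu> < \<alpha> / (2 * real CARD('n)) \<longrightarrow>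
          (\<exists>C :: real. \<forall>t>0.
             ennreal (t powr (\<alpha> / 2)) *
               Linf_norm UNIV (\<lambda>x. u x t - heat_solution (diffusivity J) u0 x t)
             \<le> ennreal (C * t powr (- \<mu>)))) \<and>
       (\<alpha> < real CARD('n) \<longrightarrow>
          (\<exists>C :: real. \<forall>x. \<forall>t>0. u x t \<le> C * t powr (- (\<alpha> / 2))) \<and>
          (\<forall>K>0. ((\<lambda>t. ennreal (t powr (\<alpha> / 2)) *
               Linf_norm {x. norm x \<le> K * sqrt t}
                 (\<lambda>x. u x t - U_power (diffusivity J) \<alpha> A x t)) \<longlongrightarrow> 0) at_top)) \<and>
       (\<alpha> = real CARD('n) \<longrightarrow>
          (\<exists>C :: real. \<forall>x. \<forall>t\<ge>2. u x t \<le> C * t powr (- (real CARD('n) / 2)) * ln t) \<and>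
          (\<forall>K>0. ((\<lambda>t. ennreal (t powr (real CARD('n) / 2)) *
               Linf_norm {x. norm x \<le> K * sqrt t}
                 (\<lambda>x. u x t / ln t - C_AN * heat_kernel (diffusivity J) x t)) \<longlongrightarrow> 0) at_top))"
\<comment> \<open>Half of A times the area of the unit sphere; the half comes from the logarithm of the square root of t.\<close>
proof (rule exI[of _ "A * (real CARD('n) * unit_ball_vol (real CARD('n))) / 2"], intro allI impI)
  fix J u0 :: "real^'n \<Rightarrow> real" and \<alpha> :: real and u :: "real^'n \<Rightarrow> real \<Rightarrow> real"
  assume J: "convolution_kernel J" and u0: "u0 \<in> borel_measurable lebesgue" "bounded (range u0)" "\<forall>x. 0 \<le> u0 x"
    and \<alpha>: "0 < \<alpha>" "\<alpha> \<le> real CARD('n)"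
    and lim: "((\<lambda>x. norm x powr \<alpha> * u0 x) \<longlongrightarrow> A) at_infinity"
    and sol: "nonlocal_solution J u0 u"
  obtain B where B: "\<And>x. \<bar>u0 x\<bar> \<le> B" using u0(2) by (auto simp: bounded_iff)
  define M where "M = B + 1"
  have M: "0 < M" "\<And>x. u0 x \<le> M" "\<And>x. \<bar>u0 x\<bar> \<le> M"
  proof -
    show "0 < M" using B[of 0] by (simp add: M_def)
    show "u0 x \<le> M" "\<bar>u0 x\<bar> \<le> M" for x using B[of x] by (simp_all add: M_def)
  qed
  have pos: "\<And>x. 0 \<le> u0 x" using u0(3) by blast
  obtain \<phi> where \<phi>: "\<phi> \<in> borel_measurable borel" "\<forall>x. 0 \<le> \<phi> x \<and> \<phi> x \<le> M" "AE x in lborel. u0 x = \<phi> x"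
      "((\<lambda>x. norm x powr \<alpha> * \<phi> x) \<longlongrightarrow> A) at_infinity"
    using borel_representative_with_tail[OF u0(1) pos M(2,1) assms \<alpha>(1) lim] by blast
  interpret P: nonlocal_problem \<phi> M A \<alpha> J u0 u
    by unfold_locales (use \<phi> assms \<alpha> J sol u0(1) M in auto)
  show "(\<forall>\<mu>. 0 < \<mu> \<and> \<mu> < \<alpha> / (2 * real CARD('n)) \<longrightarrow>
          (\<exists>C :: real. \<forall>t>0.
             ennreal (t powr (\<alpha> / 2)) *
               Linf_norm UNIV (\<lambda>x. u x t - heat_solution (diffusivity J) u0 x t)
             \<le> ennreal (C * t powr (- \<mu>)))) \<and>
       (\<alpha> < real CARD('n) \<longrightarrow>
          (\<exists>C :: real. \<forall>x. \<forall>t>0. u x t \<le> C * t powr (- (\<alpha> / 2))) \<and>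
          (\<forall>K>0. ((\<lambda>t. ennreal (t powr (\<alpha> / 2)) *
               Linf_norm {x. norm x \<le> K * sqrt t}
                 (\<lambda>x. u x t - U_power (diffusivity J) \<alpha> A x t)) \<longlongrightarrow> 0) at_top)) \<and>
       (\<alpha> = real CARD('n) \<longrightarrow>
          (\<exists>C :: real. \<forall>x. \<forall>t\<ge>2. u x t \<le> C * t powr (- (real CARD('n) / 2)) * ln t) \<and>
          (\<forall>K>0. ((\<lambda>t. ennreal (t powr (real CARD('n) / 2)) *
               Linf_norm {x. norm x \<le> K * sqrt t}
                 (\<lambda>x. u x t / ln t - A * (real CARD('n) * unit_ball_vol (real CARD('n))) / 2 * heat_kernel (diffusivity J) x t)) \<longlongrightarrow> 0) at_top))"
    unfolding P.a_def[symmetric]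
  proof (intro conjI allI impI)
    fix \<mu> assume "0 < \<mu> \<and> \<mu> < \<alpha> / (2 * real CARD('n))"
    then show "\<exists>C. \<forall>t>0. ennreal (t powr (\<alpha> / 2)) * Linf_norm UNIV (\<lambda>x. u x t - heat_solution P.a u0 x t)
        \<le> ennreal (C * t powr - \<mu>)"
      by (intro P.global_rate) auto
  qed (rule P.subcritical_decay P.subcritical_limit P.critical_decay P.critical_limit; assumption)+
qed

end
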